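(* There is an algorithm that, given positive integers $p,k,n$, a matrix $A\in\mathbb{R}^{k\times n}$, an oracle presentation of a nonempty set $\Lambda$ of $p$-shapes of $n$, and an oracle presentation of a convex functional $C$ on $\mathbb{R}^{k\times p}$, solves the Shaped Partition Problem of finding a $\Lambda$-partition $\pi^*$ which maximizes $f(\pi)=C(A^\pi)$ over all $\Lambda$-partitions $\pi$, using $O\big(n^{kp^2}\big)$ real arithmetic operations and oracle queries, where the constant implied by $O(\cdot)$ depends only on $k$ and $p$. For rational $A$, fixed $p$ and $k$, and $M$-guaranteed oracle for $C$, the running time of this oracle algorithm is strongly polynomial in $n$, $M$ and the bit size of $A$.
   Context: Write $[n]=\{1,\ldots,n\}$ and let $A^i$ denote the $i$th column of $A$. A $p$-partition of $[n]$ is an ordered tuple $\pi=(\pi_1,\ldots,\pi_p)$ of pairwise disjoint, possibly empty, sets whose union is $[n]$. A $p$-shape of $n$ is a tuple $\lambda=(\lambda_1,\ldots,\lambda_p)$ of nonnegative integers with $\sum_{i=1}^p\lambda_i=n$. The shape of $\pi$ is $|\pi|=(|\pi_1|,\ldots,|\pi_p|)$, and $\pi$ is a $\Lambda$-partition if $|\pi|\in\Lambda$. The $A$-matrix of $\pi$ is the $k\times p$ matrix $A^\pi=\big[\sum_{i\in\pi_1}A^i,\ldots,\sum_{i\in\pi_p}A^i\big]$, where an empty sum is $0$. Oracle presentation of $\Lambda$: an oracle which, queried on a $p$-shape $\lambda$ of $n$, answers whether or not $\lambda\in\Lambda$. Oracle presentation of $C$: an oracle which, queried on $A^\pi$ with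 $\pi$ a $\Lambda$-partition, answers with the value $C(A^\pi)$. The oracle for $C$ is $M$-guaranteed if for every $\Lambda$-partition $\pi$ the value $C(A^\pi)$ is guaranteed to be a rational number whose binary encoding is no longer than $M$ bits. In the real arithmetic model each arithmetic operation ($+,-,\times,\div$) or comparison of real numbers is a single step. Strongly polynomial means that, in the real arithmetic model, the number of arithmetic operations and oracle queries is polynomial in $n$ (for fixed $p,k$), and, on rational data, the bit sizes of all numbers occurring and hence the total running time are polynomial in the indicated parameters ($n$, $M$ and the bit size of $A$). *)

theory Defs
  imports Complex_Main "HOL-Library.Log_Nat" "Jordan_Normal_Form.Matrix"
begin

section \<open>Shaped partition problems\<close>

text \<open>
  The ground set is \<open>{..<n}\<close> and parts, rows and columns are numbered from 0. A tuple
  \<open>\<pi>\<close> of sets is a list of sets, so that the first part is \<open>\<pi> ! 0\<close>.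
\<close>

definition p_partition :: "nat \<Rightarrow> nat \<Rightarrow> nat set list \<Rightarrow> bool" where
  "p_partition p n \<pi> \<longleftrightarrow> length \<pi> = p \<and>
     (\<forall>i<p. \<forall>j<p. i \<noteq> j \<longrightarrow> \<pi> ! i \<inter> \<pi> ! j = {}) \<and> \<Union> (set \<pi>) = {..<n}"

definition p_shapes :: "nat \<Rightarrow> nat \<Rightarrow> nat list set" where
  "p_shapes p n = {l. length l = p \<and> sum_list l = n}"

definition shape :: "nat set list \<Rightarrow> nat list" where
  "shape \<pi> = map card \<pi>"

definition Lambda_partition :: "nat \<Rightarrow> nat \<Rightarrow> nat list set \<Rightarrow> nat set list \<Rightarrow> bool" where
  "Lambda_partition p n \<Lambda> \<pi> \<longleftrightarrow> p_partition p n \<pi> \<and> shape \<pi> \<in> \<Lambda>"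

definition A_matrix :: "real mat \<Rightarrow> nat set list \<Rightarrow> real mat" where
  "A_matrix A \<pi> = mat (dim_row A) (length \<pi>) (\<lambda>(r, j). \<Sum>i\<in>\<pi> ! j. A $$ (r, i))"

text \<open>The type of matrices is not a vector space, so convexity is spelled out.\<close>

definition convex_functional :: "nat \<Rightarrow> nat \<Rightarrow> (real mat \<Rightarrow> real) \<Rightarrow> bool" where
  "convex_functional k p C \<longleftrightarrow>
     (\<forall>X\<in>carrier_mat k p. \<forall>Y\<in>carrier_mat k p. \<forall>t. 0 \<le> t \<and> t \<le> 1 \<longrightarrow>
        C ((1 - t) \<cdot>\<^sub>m X + t \<cdot>\<^sub>m Y) \<le> (1 - t) * C X + t * C Y)"

definition optimal_partition ::
  "nat \<Rightarrow> nat \<Rightarrow> real mat \<Rightarrow> nat list set \<Rightarrow> (real mat \<Rightarrow> real) \<Rightarrow> nat set list \<Rightarrow> bool" where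
  "optimal_partition p n A \<Lambda> C \<pi>' \<longleftrightarrow> Lambda_partition p n \<Lambda> \<pi>' \<and>
     (\<forall>\<pi>. Lambda_partition p n \<Lambda> \<pi> \<longrightarrow> C (A_matrix A \<pi>) \<le> C (A_matrix A \<pi>'))"

text \<open>
  An oracle is a function whose answers are prescribed on the admissible queries only; on any other
  query it may answer arbitrarily.
\<close>

definition presents_shapes :: "(nat list \<Rightarrow> bool) \<Rightarrow> nat \<Rightarrow> nat \<Rightarrow> nat list set \<Rightarrow> bool" where
  "presents_shapes lam_oracle p n \<Lambda> \<longleftrightarrow> (\<forall>l\<in>p_shapes p n. lam_oracle l \<longleftrightarrow> l \<in> \<Lambda>)"

definition presents_functional ::
  "(real mat \<Rightarrow> real) \<Rightarrow> nat \<Rightarrow> nat \<Rightarrow> real mat \<Rightarrow> nat list set \<Rightarrow> (real mat \<Rightarrow> real) \<Rightarrow> bool" where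
  "presents_functional val_oracle p n A \<Lambda> C \<longleftrightarrow>
     (\<forall>\<pi>. Lambda_partition p n \<Lambda> \<pi> \<longrightarrow> val_oracle (A_matrix A \<pi>) = C (A_matrix A \<pi>))"


section \<open>Binary encodings of rational numbers\<close>

text \<open>One sign bit, and the binary digits of numerator and denominator in lowest terms.\<close>

definition rat_bits :: "rat \<Rightarrow> nat" where
  "rat_bits q = (case quotient_of q of (a, b) \<Rightarrow> 1 + floorlog 2 (nat \<bar>a\<bar>) + floorlog 2 (nat b))"

text \<open>Only meaningful for rational arguments.\<close>

definition bits :: "real \<Rightarrow> nat" where
  "bits x = rat_bits (THE q. x = of_rat q)"

definition rational_mat :: "real mat \<Rightarrow> bool" where
  "rational_mat A \<longleftrightarrow> elements_mat A \<subseteq> \<rat>"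

definition mat_bits :: "real mat \<Rightarrow> nat" where
  "mat_bits A = (\<Sum>r<dim_row A. \<Sum>i<dim_col A. bits (A $$ (r, i)))"

definition guaranteed ::
  "nat \<Rightarrow> nat \<Rightarrow> nat \<Rightarrow> real mat \<Rightarrow> nat list set \<Rightarrow> (real mat \<Rightarrow> real) \<Rightarrow> bool" where
  "guaranteed M p n A \<Lambda> C \<longleftrightarrow>
     (\<forall>\<pi>. Lambda_partition p n \<Lambda> \<pi> \<longrightarrow>
        C (A_matrix A \<pi>) \<in> \<rat> \<and> bits (C (A_matrix A \<pi>)) \<le> M)"


section \<open>Real random access machines with oracles\<close>

text \<open>
  Programs are finite syntactic objects. A program uses finitely many named arrays, each
  with infinitely many cells, holding either natural numbers (for counters, addresses, shapes,
  partitions) or real numbers. A scalar variable is cell 0 of an array. Real values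
  can be inspected only through comparisons and combined only through the field operations, and
  there are no real constants apart from those obtained from natural number constants.
  Subtraction of natural numbers is truncated and division by zero yields 0.
\<close>

datatype nexp =
    NConst nat
  | NGet string nexp
  | NAdd nexp nexp
  | NSub nexp nexp
  | NMul nexp nexp

datatype rexp =
    RNat nexp
  | RGet string nexp
  | RAdd rexp rexp
  | RSub rexp rexp
  | RMul rexp rexp
  | RDiv rexp rexp

datatype bexp =
    NLess nexp nexp
  | RLess rexp rexp
  | Neg bexp
  | Conj bexp bexp

text \<open>
  \<open>AskShape a e x l\<close> queries the first oracle on the tuple stored in the first \<open>l\<close> cells of
  the natural array \<open>x\<close> and stores the answer, as 0 or 1, in cell \<open>e\<close> of the natural array
  \<open>a\<close>. \<open>AskValue a e x r c\<close> queries the second oracle on the \<open>r\<times>c\<close> matrix stored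
  column by column in the real array \<open>x\<close> and stores the answer in cell \<open>e\<close> of the real
  array \<open>a\<close>.
\<close>

datatype com =
    Skip
  | NSet string nexp nexp
  | RSet string nexp rexp
  | AskShape string nexp string nexp
  | AskValue string nexp string nexp nexp
  | Seq com com
  | If bexp com com
  | While bexp com

record state =
  nat_mem :: "string \<Rightarrow> nat \<Rightarrow> nat"
  real_mem :: "string \<Rightarrow> nat \<Rightarrow> real"

definition set_nat :: "string \<Rightarrow> nat \<Rightarrow> nat \<Rightarrow> state \<Rightarrow> state" where
  "set_nat a i v s = s\<lparr>nat_mem := (nat_mem s)(a := (nat_mem s a)(i := v))\<rparr>"

definition set_real :: "string \<Rightarrow> nat \<Rightarrow> real \<Rightarrow> state \<Rightarrow> state" where
  "set_real a i v s = s\<lparr>real_mem := (real_mem s)(a := (real_mem s a)(i := v))\<rparr>"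

definition read_tuple :: "state \<Rightarrow> string \<Rightarrow> nat \<Rightarrow> nat list" where
  "read_tuple s x l = map (nat_mem s x) [0..<l]"

definition read_mat :: "state \<Rightarrow> string \<Rightarrow> nat \<Rightarrow> nat \<Rightarrow> real mat" where
  "read_mat s x r c = mat r c (\<lambda>(i, j). real_mem s x (j * r + i))"

fun nval :: "state \<Rightarrow> nexp \<Rightarrow> nat" where
  "nval s (NConst m) = m"
| "nval s (NGet a e) = nat_mem s a (nval s e)"
| "nval s (NAdd e f) = nval s e + nval s f"
| "nval s (NSub e f) = nval s e - nval s f"
| "nval s (NMul e f) = nval s e * nval s f"

fun rval :: "state \<Rightarrow> rexp \<Rightarrow> real" where
  "rval s (RNat e) = real (nval s e)"
| "rval s (RGet a e) = real_mem s a (nval s e)"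
| "rval s (RAdd e f) = rval s e + rval s f"
| "rval s (RSub e f) = rval s e - rval s f"
| "rval s (RMul e f) = rval s e * rval s f"
| "rval s (RDiv e f) = rval s e / rval s f"

fun bval :: "state \<Rightarrow> bexp \<Rightarrow> bool" where
  "bval s (NLess e f) \<longleftrightarrow> nval s e < nval s f"
| "bval s (RLess e f) \<longleftrightarrow> rval s e < rval s f"
| "bval s (Neg b) \<longleftrightarrow> \<not> bval s b"
| "bval s (Conj b c) \<longleftrightarrow> bval s b \<and> bval s c"

text \<open>
  A computation leaves a trace of elementary steps. Each step records all the numbers it handles:
  constants, addresses, operands, oracle arguments and results.
\<close>

datatype step =
    is_Move: Move (numbers: "real list")
  | Arith (numbers: "real list")
  | Compare (numbers: "real list")
  | Query (numbers: "real list")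

fun ntrace :: "state \<Rightarrow> nexp \<Rightarrow> step list" where
  "ntrace s (NConst m) = [Move [real m]]"
| "ntrace s (NGet a e) = ntrace s e @ [Move [real (nval s e), real (nval s (NGet a e))]]"
| "ntrace s (NAdd e f) = ntrace s e @ ntrace s f @
     [Arith [real (nval s e), real (nval s f), real (nval s (NAdd e f))]]"
| "ntrace s (NSub e f) = ntrace s e @ ntrace s f @
     [Arith [real (nval s e), real (nval s f), real (nval s (NSub e f))]]"
| "ntrace s (NMul e f) = ntrace s e @ ntrace s f @
     [Arith [real (nval s e), real (nval s f), real (nval s (NMul e f))]]"

fun rtrace :: "state \<Rightarrow> rexp \<Rightarrow> step list" where
  "rtrace s (RNat e) = ntrace s e @ [Move [rval s (RNat e)]]"
| "rtrace s (RGet a e) = ntrace s e @ [Move [real (nval s e), rval s (RGet a e)]]"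
| "rtrace s (RAdd e f) = rtrace s e @ rtrace s f @
     [Arith [rval s e, rval s f, rval s (RAdd e f)]]"
| "rtrace s (RSub e f) = rtrace s e @ rtrace s f @
     [Arith [rval s e, rval s f, rval s (RSub e f)]]"
| "rtrace s (RMul e f) = rtrace s e @ rtrace s f @
     [Arith [rval s e, rval s f, rval s (RMul e f)]]"
| "rtrace s (RDiv e f) = rtrace s e @ rtrace s f @
     [Arith [rval s e, rval s f, rval s (RDiv e f)]]"

fun btrace :: "state \<Rightarrow> bexp \<Rightarrow> step list" where
  "btrace s (NLess e f) = ntrace s e @ ntrace s f @ [Compare [real (nval s e), real (nval s f)]]"
| "btrace s (RLess e f) = rtrace s e @ rtrace s f @ [Compare [rval s e, rval s f]]"
| "btrace s (Neg b) = btrace s b"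
| "btrace s (Conj b c) = btrace s b @ btrace s c"

text \<open>
  \<open>exec lam_oracle val_oracle c s t tr\<close>: program \<open>c\<close> started in \<open>s\<close> halts in \<open>t\<close>
  with trace \<open>tr\<close>. A nonterminating computation has no halting state.
\<close>

inductive exec ::
  "(nat list \<Rightarrow> bool) \<Rightarrow> (real mat \<Rightarrow> real) \<Rightarrow> com \<Rightarrow> state \<Rightarrow> state \<Rightarrow> step list \<Rightarrow> bool"
  for lam_oracle :: "nat list \<Rightarrow> bool" and val_oracle :: "real mat \<Rightarrow> real" where
  Skip: "exec lam_oracle val_oracle Skip s s []"
| NSet: "exec lam_oracle val_oracle (NSet a e f) s
    (set_nat a (nval s e) (nval s f) s)
    (ntrace s e @ ntrace s f @ [Move [real (nval s e), real (nval s f)]])"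
| RSet: "exec lam_oracle val_oracle (RSet a e f) s
    (set_real a (nval s e) (rval s f) s)
    (ntrace s e @ rtrace s f @ [Move [real (nval s e), rval s f]])"
| AskShape: "\<lbrakk> query = read_tuple s x (nval s l);
     answer = of_bool (lam_oracle query) \<rbrakk> \<Longrightarrow>
   exec lam_oracle val_oracle (AskShape a e x l) s
    (set_nat a (nval s e) answer s)
    (ntrace s e @ ntrace s l @
     [Query ([real (nval s e), real (nval s l)] @ map real query @ [real answer])])"
| AskValue: "\<lbrakk> query = read_mat s x (nval s r) (nval s c);
     answer = val_oracle query \<rbrakk> \<Longrightarrow>
   exec lam_oracle val_oracle (AskValue a e x r c) s
    (set_real a (nval s e) answer s)
    (ntrace s e @ ntrace s r @ ntrace s c @
     [Query ([real (nval s e), real (nval s r), real (nval s c)] @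
             map (real_mem s x) [0..<nval s r * nval s c] @ [answer])])"
| Seq: "\<lbrakk> exec lam_oracle val_oracle c1 s1 s2 tr1; exec lam_oracle val_oracle c2 s2 s3 tr2 \<rbrakk> \<Longrightarrow>
   exec lam_oracle val_oracle (Seq c1 c2) s1 s3 (tr1 @ tr2)"
| IfTrue: "\<lbrakk> bval s b; exec lam_oracle val_oracle c1 s t tr \<rbrakk> \<Longrightarrow>
   exec lam_oracle val_oracle (If b c1 c2) s t (btrace s b @ tr)"
| IfFalse: "\<lbrakk> \<not> bval s b; exec lam_oracle val_oracle c2 s t tr \<rbrakk> \<Longrightarrow>
   exec lam_oracle val_oracle (If b c1 c2) s t (btrace s b @ tr)"
| WhileFalse: "\<not> bval s b \<Longrightarrow> exec lam_oracle val_oracle (While b c) s s (btrace s b)"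
| WhileTrue: "\<lbrakk> bval s1 b; exec lam_oracle val_oracle c s1 s2 tr1;
     exec lam_oracle val_oracle (While b c) s2 s3 tr2 \<rbrakk> \<Longrightarrow>
   exec lam_oracle val_oracle (While b c) s1 s3 (btrace s1 b @ tr1 @ tr2)"

lemma exec_deterministic:
  "exec lam_oracle val_oracle c s t tr \<Longrightarrow> exec lam_oracle val_oracle c s t' tr' \<Longrightarrow>
    t' = t \<and> tr' = tr"
proof (induction arbitrary: t' tr' rule: exec.induct)
  case (Seq c1 s1 s2 tr1 c2 s3 tr2)
  from Seq.prems show ?case by (cases rule: exec.cases) (use Seq.IH in blast)+
next
  case (IfTrue s b c1 t tr c2)
  from IfTrue.prems show ?case by (cases rule: exec.cases) (use IfTrue in blast)+
next
  case (IfFalse s b c2 t tr c1)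
  from IfFalse.prems show ?case by (cases rule: exec.cases) (use IfFalse in blast)+
next
  case (WhileTrue s1 b c s2 tr1 s3 tr2)
  from WhileTrue.prems show ?case by (cases rule: exec.cases) (use WhileTrue in blast)+
qed (erule exec.cases; simp)+

text \<open>
  In the real arithmetic model arithmetic operations (on real numbers as well as on counters and
  addresses), comparisons and oracle queries cost one each. Copying is free; since each iteration
  of a loop evaluates a comparison, a halting program copies at most proportionally often.
\<close>

definition operation_count :: "step list \<Rightarrow> nat" where
  "operation_count tr = length (filter (\<lambda>st. \<not> is_Move st) tr)"

text \<open>
  On rational data every step, including copying, is charged the total bit size of the numbers
  it handles (logarithmic cost), which is polynomially equivalent to Turing machine time.
\<close>

definition all_numbers :: "step list \<Rightarrow> real set" where
  "all_numbers tr = (\<Union>st\<in>set tr. set (numbers st))"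

definition bit_time :: "step list \<Rightarrow> nat" where
  "bit_time tr = (\<Sum>st\<leftarrow>tr. 1 + (\<Sum>x\<leftarrow>numbers st. bits x))"

text \<open>
  Input: the scalars \<open>p\<close>, \<open>k\<close>, \<open>n\<close>, and the \<open>k\<times>n\<close> matrix stored column by
  column. All other cells are 0.
\<close>

definition initial_state :: "nat \<Rightarrow> nat \<Rightarrow> nat \<Rightarrow> real mat \<Rightarrow> state" where
  "initial_state p k n A = \<lparr>
     nat_mem = (\<lambda>a i. if i \<noteq> 0 then 0 else if a = ''p'' then p else if a = ''k'' then k
                       else if a = ''n'' then n else 0),
     real_mem = (\<lambda>a i. if a = ''A'' \<and> i < k * n then A $$ (i mod k, i div k) else 0) \<rparr>"

text \<open>Output: cell \<open>i\<close> of the array \<open>out\<close> holds the index of the part containing \<open>i\<close>.\<close>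

definition output_partition :: "nat \<Rightarrow> nat \<Rightarrow> state \<Rightarrow> nat set list" where
  "output_partition p n t = map (\<lambda>j. {i. i < n \<and> nat_mem t ''out'' i = j}) [0..<p]"

end

theory Submission
  imports Defs
begin

text \<open>
  Number the columns $a_0,\<dots>,a_{n-1}$ of $A$ from 0 and lift them to the vectors
  $w_i = (1, a_i, i)$ of dimension $k + 2$. The entry 1 turns affine hyperplanes into linear ones,
  and the entry $i$ makes the points distinct even where $A$ has equal columns.

  \<^emph>\<open>Some optimal partition is separated.\<close> Among the optimal partitions take one that maximizes
  the sum of the squared entries of the part sums of the $w_i$. Suppose that the convex hulls of
  two of its parts, as sets of lifted points, meet. Swapping one element of the first part with one
  of the second keeps the shape, and averaging over all such swaps, with the product weights of the
  two convex combinations that give the common point, reproduces the part sums. By convexity of $C$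
  every swap of positive weight is then optimal as well, and by strict convexity of the square one
  of them has a larger sum of squares. Hence any two parts are strictly separated
  (\<open>separated_optimum_exists\<close>).

  \<^emph>\<open>A separation is coded by $k + 1$ pivots.\<close> Gaussian elimination with the pivot points
  $l_0,\<dots>,l_k$ sends each $w_i$ to a sequence of entries, the $j$-th one being the entry in
  coordinate $j$ at the moment when that coordinate is eliminated. Every strict separation of two
  sets of points is given by the sign of the last nonzero entry of these sequences, up to one sign
  per coordinate, for suitable pivots (\<open>side_exists\<close>). In degenerate positions many
  points have a vanishing entry, and their sides are decided by the coordinates before it. With
  the signs packed into the pivots, a pair of parts costs $k + 1$ digits below $4n$, so that
  $(4n)^Q$ codes with $Q = (k + 1)p(p - 1)/2$ contain one of an optimal partition. The sides that
  an element takes in the pairs are turned into its part by a knock-out tournament among the parts;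
  in this way every code yields a partition (\<open>separated_is_candidate\<close>).

  \<^emph>\<open>The program tries all codes.\<close> Each code costs $O(n)$ operations, and
  $Q + 1 \<le> kp^2$. The numbers in the program are counters, partial sums of entries of $A$,
  answers of the oracle, and the results of at most $k + 1$ elimination steps, each of which
  multiplies the bit size of an entry by at most 5. All of them have bit size
  linear in $n$, $M$ and the bit size of $A$. The verification
  treats the real model and the rational one by the same argument: a family of sets
  of admissible numbers, closed under the operations with a known growth, is a parameter
  (\<open>level_sets\<close>), to be instantiated with all reals and with the rationals of bounded height.
\<close>

section \<open>Pivoting in pointed families of vectors\<close>

text \<open>
  By Gordan's theorem these are the families that lie in an open half-space. Linear relations are the
  more convenient side of that duality: a failed separation of two parts of a partition provides a
  relation directly, and elimination transports relations without a choice of a functional.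
\<close>

definition pointed :: "nat set \<Rightarrow> nat \<Rightarrow> (nat \<Rightarrow> nat \<Rightarrow> real) \<Rightarrow> bool" where
  "pointed I d y \<longleftrightarrow> (\<forall>lam. (\<forall>i\<in>I. 0 \<le> lam i) \<and> (\<forall>c<d. (\<Sum>i\<in>I. lam i * y i c) = 0) \<longrightarrow>
     (\<forall>i\<in>I. lam i = 0))"

lemma pointedD:
  assumes "pointed I d y" "\<And>i. i \<in> I \<Longrightarrow> 0 \<le> lam i"
    "\<And>c. c < d \<Longrightarrow> (\<Sum>i\<in>I. lam i * y i c) = 0" "i \<in> I"
  shows "lam i = 0"
  using assms unfolding pointed_def by blast

text \<open>
  With $q \<le> 0$ the equation $y_i - q y_l = 0$ would itself be a forbidden relation.
\<close>

lemma pointed_parallel: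
  assumes "pointed I d y" "finite I" "i \<in> I" "l \<in> I" "\<And>c. c < d \<Longrightarrow> y i c = q * y l c"
  shows "0 < q"
proof (rule ccontr)
  assume "\<not> 0 < q"
  define lam where "lam x = of_bool (x = i) + (- q) * of_bool (x = l)" for x
  have "(\<Sum>x\<in>I. lam x * y x c) = 0" if "c < d" for c
  proof -
    have "(\<Sum>x\<in>I. lam x * y x c) =
        (\<Sum>x\<in>I. (if x = i then y x c else 0) + (if x = l then - q * y x c else 0))"
      by (rule sum.cong) (auto simp: lam_def algebra_simps)
    also have "\<dots> = y i c - q * y l c"
      using assms(2-4) by (simp add: sum.distrib)
    finally show ?thesis using assms(5)[OF that] by simp
  qed
  moreover have "0 \<le> lam x" for x
    using \<open>\<not> 0 < q\<close> by (auto simp: lam_def)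
  ultimately have "lam i = 0"
    using pointedD[OF assms(1), of lam i] assms(3) by blast
  then show False using \<open>\<not> 0 < q\<close> by (cases "i = l") (auto simp: lam_def)
qed

lemma pointed_nonzero:
  assumes "pointed I d y" "finite I" "i \<in> I"
  shows "\<exists>c<d. y i c \<noteq> 0"
  using pointed_parallel[OF assms(1-3) assms(3), of 0] by auto

text \<open>
  For a pointed family the set $J$ picks one vector from each extreme ray of the generated cone.
\<close>

lemma minimal_generators:
  fixes y :: "nat \<Rightarrow> nat \<Rightarrow> real" and d :: nat
  assumes "finite I"
  defines "gen \<equiv> \<lambda>J. \<forall>i\<in>I. \<exists>mu. (\<forall>j\<in>J. 0 \<le> mu j) \<and> (\<forall>c<d. y i c = (\<Sum>j\<in>J. mu j * y j c))"
  obtains J where "J \<subseteq> I" "gen J" "\<And>J'. J' \<subset> J \<Longrightarrow> \<not> gen J'"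
proof -
  have "gen I" unfolding gen_def
  proof
    fix i assume "i \<in> I"
    have "(\<Sum>j\<in>I. of_bool (j = i) * y j c) = y i c" for c
    proof -
      have "(\<Sum>j\<in>I. of_bool (j = i) * y j c) = (\<Sum>j\<in>I. if j = i then y j c else 0)"
        by (rule sum.cong) auto
      then show ?thesis using \<open>i \<in> I\<close> assms(1) by simp
    qed
    then show "\<exists>mu. (\<forall>j\<in>I. 0 \<le> mu j) \<and> (\<forall>c<d. y i c = (\<Sum>j\<in>I. mu j * y j c))"
      by (intro exI[of _ "\<lambda>j. of_bool (j = i)"]) simp
  qed
  then obtain J where J: "J \<subseteq> I \<and> gen J" "\<And>J'. J' \<subseteq> I \<and> gen J' \<Longrightarrow> card J \<le> card J'"
    using ex_has_least_nat[of "\<lambda>J. J \<subseteq> I \<and> gen J" I card] by blast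
  show ?thesis
  proof (rule that)
    fix J' assume "J' \<subset> J"
    then have "card J' < card J"
      using J(1) assms(1) by (meson finite_subset psubset_card_mono)
    then show "\<not> gen J'" using J \<open>J' \<subset> J\<close> by (meson leD psubsetE subset_trans)
  qed (use J in auto)
qed

text \<open>
  Projection along an extreme ray of a pointed cone leaves the vectors outside that ray pointed. Not
  all extreme rays lie in the hyperplane of vectors with vanishing coordinate $j$, because then the
  whole family would, so there is one along which coordinate $j$ can be eliminated.
\<close>

lemma pointed_pivot_exists:
  fixes y :: "nat \<Rightarrow> nat \<Rightarrow> real"
  assumes fin: "finite I" and pt: "pointed I d y" and i0: "i0 \<in> I" "j < d" "y i0 j \<noteq> 0"
  obtains l where "l \<in> I" "y l j \<noteq> 0"
    "pointed {i\<in>I. \<exists>c<d. y i c - y i j / y l j * y l c \<noteq> 0} d (\<lambda>i c. y i c - y i j / y l j * y l c)"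
proof -
  obtain J where J: "J \<subseteq> I"
    and gen: "\<forall>i\<in>I. \<exists>mu. (\<forall>j\<in>J. 0 \<le> mu j) \<and> (\<forall>c<d. y i c = (\<Sum>j\<in>J. mu j * y j c))"
    and min: "\<And>J'. J' \<subset> J \<Longrightarrow>
       \<not> (\<forall>i\<in>I. \<exists>mu. (\<forall>j\<in>J'. 0 \<le> mu j) \<and> (\<forall>c<d. y i c = (\<Sum>j\<in>J'. mu j * y j c)))"
    using minimal_generators[OF fin, of d y] by blast
  have finJ: "finite J" using J fin finite_subset by blast
  from gen obtain mu where mu0: "\<And>i j. i \<in> I \<Longrightarrow> j \<in> J \<Longrightarrow> 0 \<le> mu i j"
    and mu: "\<And>i c. i \<in> I \<Longrightarrow> c < d \<Longrightarrow> y i c = (\<Sum>j\<in>J. mu i j * y j c)"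
    by metis
  have "\<exists>l\<in>J. y l j \<noteq> 0"
  proof (rule ccontr)
    assume "\<not> ?thesis"
    then have "y i0 j = 0" unfolding mu[OF i0(1,2)] by (intro sum.neutral) auto
    then show False using i0(3) by simp
  qed
  then obtain l where l: "l \<in> J" "y l j \<noteq> 0" by blast
  define z where "z i c = y i c - y i j / y l j * y l c" for i c
  define I' where "I' = {i\<in>I. \<exists>c<d. z i c \<noteq> 0}"
  have finI': "finite I'" and I'I: "I' \<subseteq> I" using fin by (auto simp: I'_def)
  \<comment> \<open>A relation among the projections expresses a multiple of $y_l$ by the generators. Either it makes the
    generator $y_l$ superfluous, or it is a relation among the generators that leaves only vectors parallel to $y_l$.\<close>
  have "pointed I' d z" unfolding pointed_def
  proof (intro allI impI ballI, elim conjE, rule ccontr)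
    fix lam i1
    assume lam0: "\<forall>i\<in>I'. 0 \<le> lam i" and lam: "\<forall>c<d. (\<Sum>i\<in>I'. lam i * z i c) = 0"
      and i1: "i1 \<in> I'" "lam i1 \<noteq> 0"
    define e where "e = (\<Sum>i\<in>I'. lam i * (y i j / y l j))"
    define nu where "nu x = (\<Sum>i\<in>I'. lam i * mu i x)" for x
    have nu0: "0 \<le> nu x" if "x \<in> J" for x
      unfolding nu_def by (rule sum_nonneg) (use lam0 mu0 I'I that in auto)
    have rel: "(\<Sum>x\<in>J. nu x * y x c) = e * y l c" if "c < d" for c
    proof -
      have "(\<Sum>x\<in>J. nu x * y x c) = (\<Sum>x\<in>J. \<Sum>i\<in>I'. lam i * (mu i x * y x c))"
        by (simp add: nu_def sum_distrib_right mult.assoc)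
      also have "\<dots> = (\<Sum>i\<in>I'. lam i * (\<Sum>x\<in>J. mu i x * y x c))"
        by (subst sum.swap) (simp add: sum_distrib_left)
      also have "\<dots> = (\<Sum>i\<in>I'. lam i * y i c)"
        by (rule sum.cong) (use mu that I'I in auto)
      also have "\<dots> = (\<Sum>i\<in>I'. lam i * z i c + lam i * (y i j / y l j) * y l c)"
        by (rule sum.cong) (auto simp: z_def algebra_simps)
      also have "\<dots> = e * y l c"
        using lam that by (simp add: sum.distrib e_def sum_distrib_right)
      finally show ?thesis .
    qed
    have rel': "(\<Sum>x\<in>J - {l}. nu x * y x c) = (e - nu l) * y l c" if "c < d" for c
      using rel[OF that] sum.remove[OF finJ l(1), of "\<lambda>x. nu x * y x c"] by (simp add: algebra_simps)
    show False
    proof (cases "nu l < e")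
      case True
      have yl: "y l c = (\<Sum>x\<in>J - {l}. nu x / (e - nu l) * y x c)" if "c < d" for c
        using rel'[OF that] True by (simp add: sum_divide_distrib[symmetric] field_simps)
      have "\<exists>mu'. (\<forall>x\<in>J - {l}. 0 \<le> mu' x) \<and> (\<forall>c<d. y i c = (\<Sum>x\<in>J - {l}. mu' x * y x c))"
        if i: "i \<in> I" for i
      proof (intro exI[of _ "\<lambda>x. mu i x + mu i l * (nu x / (e - nu l))"] conjI ballI allI impI)
        fix x assume "x \<in> J - {l}"
        then show "0 \<le> mu i x + mu i l * (nu x / (e - nu l))"
          using mu0[OF i] nu0 True l by (intro add_nonneg_nonneg mult_nonneg_nonneg) auto
      next
        fix c assume c: "c < d"
        have "y i c = mu i l * y l c + (\<Sum>x\<in>J - {l}. mu i x * y x c)"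
          using mu[OF i c] sum.remove[OF finJ l(1), of "\<lambda>x. mu i x * y x c"] by simp
        also have "\<dots> = (\<Sum>x\<in>J - {l}. (mu i x + mu i l * (nu x / (e - nu l))) * y x c)"
          by (subst yl[OF c]) (simp add: sum_distrib_left sum.distrib algebra_simps)
        finally show "y i c = \<dots>" .
      qed
      then show False using min[of "J - {l}"] l by blast
    next
      case False
      define lam' where "lam' x = (if x = l then nu l - e else if x \<in> J then nu x else 0)" for x
      have "lam' x = 0" if "x \<in> I" for x
      proof (rule pointedD[OF pt, of lam'])
        show "x \<in> I" by fact
        show "0 \<le> lam' i" for i using nu0 False by (auto simp: lam'_def)
        fix c assume c: "c < d"
        have "(\<Sum>i\<in>I. lam' i * y i c) = (\<Sum>i\<in>J. lam' i * y i c)"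
          by (rule sum.mono_neutral_right[OF fin J]) (use l in \<open>auto simp: lam'_def\<close>)
        also have "\<dots> = (nu l - e) * y l c + (\<Sum>x\<in>J - {l}. nu x * y x c)"
          using sum.remove[OF finJ l(1), of "\<lambda>x. lam' x * y x c"] by (simp add: lam'_def)
        also have "\<dots> = 0" using rel'[OF c] by (simp add: algebra_simps)
        finally show "(\<Sum>i\<in>I. lam' i * y i c) = 0" .
      qed
      then have nu_zero: "nu x = 0" if "x \<in> J - {l}" for x
        using that J unfolding lam'_def by (metis Diff_iff insertI1 subsetD)
      have mu_zero: "mu i1 x = 0" if "x \<in> J - {l}" for x
      proof -
        have "\<forall>i\<in>I'. lam i * mu i x = 0"
          using nu_zero[OF that] lam0 mu0 I'I that finI' unfolding nu_def
          by (subst (asm) sum_nonneg_eq_0_iff) auto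
        then show ?thesis using i1 by auto
      qed
      have par: "y i1 c = mu i1 l * y l c" if "c < d" for c
        using mu[OF subsetD[OF I'I i1(1)] that] sum.remove[OF finJ l(1), of "\<lambda>x. mu i1 x * y x c"]
          mu_zero by simp
      then have "z i1 c = 0" if "c < d" for c
        using par[OF that] par[OF i0(2)] l(2) by (simp add: z_def)
      then show False using i1 by (auto simp: I'_def)
    qed
  qed
  then show ?thesis
    using that[of l] l J unfolding I'_def z_def by blast
qed

text \<open>
  Gaussian elimination: step $j$ subtracts from all vectors multiples of the pivot vector $L_j$ so that
  coordinate $j$ vanishes. If the pivot entry is 0, division by zero yields 0 and the step does nothing,
  which is what is needed when the vectors of interest already have a vanishing coordinate $j$.
\<close>

fun reduced :: "(nat \<Rightarrow> nat) \<Rightarrow> (nat \<Rightarrow> nat \<Rightarrow> real) \<Rightarrow> nat \<Rightarrow> nat \<Rightarrow> nat \<Rightarrow> real" where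
  "reduced L w 0 i c = w i c"
| "reduced L w (Suc j) i c = reduced L w j i c -
     reduced L w j i j / reduced L w j (L j) j * reduced L w j (L j) c"

text \<open>
  The last nonzero entry among those that were eliminated, with the sign $D_j$ of its coordinate. Later
  coordinates take precedence: the signs are those of a functional in which every coordinate has
  infinitesimally small weight compared with the next one.
\<close>

fun mark :: "(nat \<Rightarrow> nat) \<Rightarrow> (nat \<Rightarrow> real) \<Rightarrow> (nat \<Rightarrow> nat \<Rightarrow> real) \<Rightarrow> nat \<Rightarrow> nat \<Rightarrow> real" where
  "mark L D w 0 i = 0"
| "mark L D w (Suc j) i = (if reduced L w j i j = 0 then mark L D w j i
     else D j * reduced L w j i j)"

definition side ::
  "(nat \<Rightarrow> nat) \<Rightarrow> (nat \<Rightarrow> real) \<Rightarrow> real \<Rightarrow> (nat \<Rightarrow> nat \<Rightarrow> real) \<Rightarrow> nat \<Rightarrow> nat \<Rightarrow> real" where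
  "side L D E w m i = (if reduced L w m i m = 0 then mark L D w m i else E * reduced L w m i m)"

lemma reduced_cong: "(\<And>x. x < j \<Longrightarrow> L x = L' x) \<Longrightarrow> reduced L w j = reduced L' w j"
  by (induction j) (auto simp: fun_eq_iff)

lemma mark_cong:
  "(\<And>x. x < j \<Longrightarrow> L x = L' x \<and> D x = D' x) \<Longrightarrow> mark L D w j = mark L' D' w j"
proof (induction j)
  case (Suc j)
  then have "reduced L w j = reduced L' w j" by (intro reduced_cong) auto
  with Suc show ?case by (simp add: fun_eq_iff)
qed (simp add: fun_eq_iff)

text \<open>
  The elements of $I$ whose vectors have been reduced to 0 already carry the right mark, and the others
  still form a pointed family, in which the next pivot is found. An element reduced to 0 by step $j$
  is a multiple of the pivot vector, by a positive factor since the family is pointed;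
  hence one sign $D_j$ serves all of them.
\<close>

lemma pivots_exist:
  fixes w :: "nat \<Rightarrow> nat \<Rightarrow> real" and sg :: "nat \<Rightarrow> real"
  assumes I: "I \<subseteq> {..<n}" and n: "0 < n" and sg: "\<And>i. i \<in> I \<Longrightarrow> sg i = 1 \<or> sg i = -1"
    and pt: "pointed I d (\<lambda>i c. sg i * w i c)" and "j \<le> d"
  shows "\<exists>L D. (\<forall>x. L x < n) \<and> (\<forall>x. D x = 1 \<or> D x = -1) \<and>
    (\<forall>i\<in>I. \<forall>c<j. reduced L w j i c = 0) \<and>
    pointed {i\<in>I. \<exists>c<d. reduced L w j i c \<noteq> 0} d (\<lambda>i c. sg i * reduced L w j i c) \<and>
    (\<forall>i\<in>I. (\<forall>c<d. reduced L w j i c = 0) \<longrightarrow> 0 < sg i * mark L D w j i)"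
  using \<open>j \<le> d\<close>
proof (induction j)
  case 0
  have fin: "finite I" using I finite_subset by blast
  have nz: "\<exists>c<d. w i c \<noteq> 0" if "i \<in> I" for i
    using pointed_nonzero[OF pt fin that] by auto
  then have "{i\<in>I. \<exists>c<d. w i c \<noteq> 0} = I" by auto
  then show ?case
    using pt n nz by (intro exI[of _ "\<lambda>_. 0"] exI[of _ "\<lambda>_. 1"]) auto
next
  case (Suc j)
  have fin: "finite I" using I finite_subset by blast
  from Suc obtain L D where LD: "\<forall>x. L x < n" "\<forall>x. D x = 1 \<or> D x = -1"
    and zero: "\<forall>i\<in>I. \<forall>c<j. reduced L w j i c = 0"
    and pt': "pointed {i\<in>I. \<exists>c<d. reduced L w j i c \<noteq> 0} d (\<lambda>i c. sg i * reduced L w j i c)"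
    and marked: "\<forall>i\<in>I. (\<forall>c<d. reduced L w j i c = 0) \<longrightarrow> 0 < sg i * mark L D w j i"
    by auto
  define I' where "I' = {i\<in>I. \<exists>c<d. reduced L w j i c \<noteq> 0}"
  define v where "v = reduced L w j"
  have finI': "finite I'" and I'I: "I' \<subseteq> I" using fin by (auto simp: I'_def)
  note pt' = pt'[folded I'_def v_def]
  show ?case
  proof (cases "\<exists>i\<in>I'. v i j \<noteq> 0")
    case True
    then obtain i0 where i0: "i0 \<in> I'" "v i0 j \<noteq> 0" by blast
    then have "sg i0 * v i0 j \<noteq> 0" using sg I'I by force
    moreover have "j < d" using Suc.prems by simp
    ultimately obtain l where l: "l \<in> I'" "sg l * v l j \<noteq> 0"
      and pt2: "pointed {i\<in>I'. \<exists>c<d. sg i * v i c - sg i * v i j / (sg l * v l j) * (sg l * v l c) \<noteq> 0} d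
         (\<lambda>i c. sg i * v i c - sg i * v i j / (sg l * v l j) * (sg l * v l c))"
      using pointed_pivot_exists[OF finI' pt' i0(1)] by blast
    define L' where "L' = L(j := l)"
    \<comment> \<open>The sign that makes the mark of the pivot itself correct.\<close>
    define D' where "D' = D(j := sgn (sg l * v l j))"
    have redj: "reduced L' w j = v" unfolding v_def by (rule reduced_cong) (simp add: L'_def)
    have markj: "mark L' D' w j = mark L D w j" by (rule mark_cong) (simp add: L'_def D'_def)
    have red: "reduced L' w (Suc j) i c = v i c - v i j / v l j * v l c" for i c
      by (simp add: redj) (simp add: L'_def)
    have sl: "sg l \<noteq> 0" using l by auto
    have fac: "sg i * v i c - sg i * v i j / (sg l * v l j) * (sg l * v l c) =
        sg i * reduced L' w (Suc j) i c" for i c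
      unfolding red using sl by (simp add: field_simps)
    have zv: "v i c = 0" if "i \<in> I - I'" "c < d" for i c
      using that by (auto simp: I'_def v_def)
    have sub: "{i\<in>I'. \<exists>c<d. sg i * reduced L' w (Suc j) i c \<noteq> 0} =
        {i\<in>I. \<exists>c<d. reduced L' w (Suc j) i c \<noteq> 0}"
    proof (rule equalityI; rule subsetI)
      fix i assume "i \<in> {i\<in>I. \<exists>c<d. reduced L' w (Suc j) i c \<noteq> 0}"
      then obtain c where c: "i \<in> I" "c < d" "reduced L' w (Suc j) i c \<noteq> 0" by blast
      then have "i \<in> I'" using zv[of i c] zv[of i j] Suc.prems red[of i c] by force
      then show "i \<in> {i\<in>I'. \<exists>c<d. sg i * reduced L' w (Suc j) i c \<noteq> 0}"
        using c sg[OF c(1)] by auto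
    qed (use I'I in auto)
    show ?thesis
    proof (intro exI[of _ L'] exI[of _ D'] conjI)
      show "\<forall>x. L' x < n" using LD l I'I I by (auto simp: L'_def)
      show "\<forall>x. D' x = 1 \<or> D' x = -1" using LD l(2) by (auto simp: D'_def sgn_if)
      show "\<forall>i\<in>I. \<forall>c<Suc j. reduced L' w (Suc j) i c = 0"
      proof (intro ballI allI impI)
        fix i c assume i: "i \<in> I" and c: "c < Suc j"
        show "reduced L' w (Suc j) i c = 0"
        proof (cases "c = j")
          case True then show ?thesis using l by (simp only: red) simp
        next
          case False
          then have "c < j" using c by simp
          then show ?thesis using zero i l I'I by (simp only: red) (auto simp: v_def)
        qed
      qed
      show "pointed {i\<in>I. \<exists>c<d. reduced L' w (Suc j) i c \<noteq> 0} d
          (\<lambda>i c. sg i * reduced L' w (Suc j) i c)"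
        using pt2 unfolding fac sub .
      show "\<forall>i\<in>I. (\<forall>c<d. reduced L' w (Suc j) i c = 0) \<longrightarrow> 0 < sg i * mark L' D' w (Suc j) i"
      proof (intro ballI impI)
        fix i assume i: "i \<in> I" and all0: "\<forall>c<d. reduced L' w (Suc j) i c = 0"
        show "0 < sg i * mark L' D' w (Suc j) i"
        proof (cases "i \<in> I'")
          case True
          define q where "q = (sg i * v i j) / (sg l * v l j)"
          have "sg i * v i c = q * (sg l * v l c)" if "c < d" for c
            using fac[of i c] all0 that by (simp add: q_def)
          from pointed_parallel[OF pt' finI' True l(1) this] have q: "0 < q" .
          then have sgn_eq: "sgn (sg l * v l j) = sgn (sg i * v i j)" "v i j \<noteq> 0" "sg i \<noteq> 0"
            by (auto simp: q_def sgn_if zero_less_divide_iff)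
          have "sg i * (D' j * v i j) = \<bar>sg i * v i j\<bar>"
            by (simp add: D'_def sgn_eq abs_sgn ac_simps)
          also have "\<dots> > 0" using sgn_eq by simp
          finally show ?thesis using sgn_eq by (simp add: redj)
        next
          case False
          then have "v i j = 0" using zv[of i j] i Suc.prems by auto
          moreover have "0 < sg i * mark L D w j i" using marked i False by (auto simp: I'_def)
          ultimately show ?thesis by (simp add: redj markj)
        qed
      qed
    qed
  next
    case False
    then have v0: "v i j = 0" if "i \<in> I" for i
      using that Suc.prems by (auto simp: I'_def v_def)
    then have red: "reduced L w (Suc j) i c = v i c" if "i \<in> I" for i c
      using that by (simp add: v_def)
    have sub: "{i\<in>I. \<exists>c<d. reduced L w (Suc j) i c \<noteq> 0} = I'"
      using red by (auto simp: I'_def v_def simp del: reduced.simps)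
    have pt3: "pointed I' d (\<lambda>i c. sg i * reduced L w (Suc j) i c)"
    proof -
      have "(\<Sum>i\<in>I'. lam i * (sg i * reduced L w (Suc j) i c)) = (\<Sum>i\<in>I'. lam i * (sg i * v i c))"
        for lam c by (rule sum.cong) (use I'I red in \<open>auto simp del: reduced.simps\<close>)
      then show ?thesis using pt' unfolding pointed_def by simp
    qed
    have "\<forall>i\<in>I. \<forall>c<Suc j. reduced L w (Suc j) i c = 0"
      using red zero v0 by (auto simp: v_def less_Suc_eq simp del: reduced.simps)
    moreover have "\<forall>i\<in>I. (\<forall>c<d. reduced L w (Suc j) i c = 0) \<longrightarrow> 0 < sg i * mark L D w (Suc j) i"
    proof (intro ballI impI)
      fix i assume i: "i \<in> I" and "\<forall>c<d. reduced L w (Suc j) i c = 0"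
      then have "0 < sg i * mark L D w j i" using red marked by (auto simp: v_def simp del: reduced.simps)
      then show "0 < sg i * mark L D w (Suc j) i" using v0[OF i] by (simp add: v_def)
    qed
    ultimately show ?thesis using LD pt3 sub by blast
  qed
qed

text \<open>
  After $m$ steps only coordinate $m$ can be nonzero, and in a pointed family of vectors on a line all
  vectors point in the same direction.
\<close>

lemma side_exists:
  fixes w :: "nat \<Rightarrow> nat \<Rightarrow> real" and sg :: "nat \<Rightarrow> real"
  assumes I: "I \<subseteq> {..<n}" and n: "0 < n" and sg: "\<And>i. i \<in> I \<Longrightarrow> sg i = 1 \<or> sg i = -1"
    and pt: "pointed I (Suc m) (\<lambda>i c. sg i * w i c)"
  obtains L D E where "\<And>x. L x < n" "\<And>x. D x = 1 \<or> D x = -1" "E = 1 \<or> E = -1"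
    "\<And>i. i \<in> I \<Longrightarrow> 0 < sg i * side L D E w m i"
proof -
  have fin: "finite I" using I finite_subset by blast
  from pivots_exist[OF I n sg pt, of m] obtain L D
    where LD: "\<forall>x. L x < n" "\<forall>x. D x = 1 \<or> D x = -1"
      and zero: "\<forall>i\<in>I. \<forall>c<m. reduced L w m i c = 0"
      and pt': "pointed {i\<in>I. \<exists>c<Suc m. reduced L w m i c \<noteq> 0} (Suc m) (\<lambda>i c. sg i * reduced L w m i c)"
      and marked: "\<forall>i\<in>I. (\<forall>c<Suc m. reduced L w m i c = 0) \<longrightarrow> 0 < sg i * mark L D w m i"
    by auto
  define v where "v = reduced L w m"
  define I' where "I' = {i\<in>I. v i m \<noteq> 0}"
  have I'_eq: "{i\<in>I. \<exists>c<Suc m. reduced L w m i c \<noteq> 0} = I'"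
    using zero by (auto simp: I'_def v_def less_Suc_eq)
  have same: "0 < (sg i * v i m) / (sg l * v l m)" if "i \<in> I'" "l \<in> I'" for i l
  proof (rule pointed_parallel[OF pt'[unfolded I'_eq] _ that])
    show "finite I'" using fin by (simp add: I'_def)
    fix c assume "c < Suc m"
    then show "sg i * reduced L w m i c =
        sg i * v i m / (sg l * v l m) * (sg l * reduced L w m l c)"
      using that zero sg[of l] by (cases "c = m") (auto simp: I'_def v_def)
  qed
  have "\<exists>E. (E = 1 \<or> E = -1) \<and> (\<forall>i\<in>I'. 0 < sg i * (E * v i m))"
  proof (cases "I' = {}")
    case False
    then obtain l where l: "l \<in> I'" by blast
    define E where "E = sgn (sg l * v l m)"
    have "0 < sg i * (E * v i m)" if "i \<in> I'" for i
    proof -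
      have "sg i * (E * v i m) = \<bar>sg i * v i m\<bar>"
        using same[OF that l] by (auto simp: E_def sgn_if zero_less_divide_iff)
      also have "\<dots> > 0" using that sg[of i] by (auto simp: I'_def)
      finally show ?thesis .
    qed
    moreover have "E = 1 \<or> E = -1" using l sg[of l] by (auto simp: I'_def E_def sgn_if)
    ultimately show ?thesis by blast
  qed auto
  then obtain E where E: "E = 1 \<or> E = -1" "\<forall>i\<in>I'. 0 < sg i * (E * v i m)" by blast
  show ?thesis
  proof (rule that[of L D E])
    fix i assume i: "i \<in> I"
    show "0 < sg i * side L D E w m i"
      using E(2) marked zero i by (auto simp: side_def I'_def v_def less_Suc_eq)
  qed (use LD E in auto)
qed

section \<open>An optimal partition with separated parts\<close>

definition partition_of :: "nat \<Rightarrow> nat \<Rightarrow> (nat \<Rightarrow> nat) \<Rightarrow> nat set list" where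
  "partition_of p n f = map (\<lambda>j. {i. i < n \<and> f i = j}) [0..<p]"

lemma partition_of_cong: "(\<And>i. i < n \<Longrightarrow> f i = g i) \<Longrightarrow> partition_of p n f = partition_of p n g"
  by (auto simp: partition_of_def)

lemma p_partition_partition_of:
  assumes "\<And>i. i < n \<Longrightarrow> f i < p"
  shows "p_partition p n (partition_of p n f)"
  using assms by (auto simp: p_partition_def partition_of_def)

lemma p_partition_obtain:
  assumes "p_partition p n \<pi>"
  obtains f where "\<And>i. i < n \<Longrightarrow> f i < p" "\<pi> = partition_of p n f"
proof -
  have len: "length \<pi> = p" and disj: "\<And>i j. i < p \<Longrightarrow> j < p \<Longrightarrow> i \<noteq> j \<Longrightarrow> \<pi> ! i \<inter> \<pi> ! j = {}"
    and un: "\<Union> (set \<pi>) = {..<n}"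
    using assms by (auto simp: p_partition_def)
  have "\<exists>j<p. i \<in> \<pi> ! j" if "i < n" for i
    using that un len by (metis UnionE in_set_conv_nth lessThan_iff)
  then obtain f where f: "\<And>i. i < n \<Longrightarrow> f i < p \<and> i \<in> \<pi> ! (f i)" by metis
  have "\<pi> ! j = {i. i < n \<and> f i = j}" if "j < p" for j
  proof (intro equalityI subsetI)
    fix i assume i: "i \<in> \<pi> ! j"
    then have "i < n" using un that len by (metis UnionI lessThan_iff nth_mem)
    then show "i \<in> {i. i < n \<and> f i = j}" using f disj[of j "f i"] that i by blast
  qed (use f in auto)
  then have "\<pi> = partition_of p n f"
    by (intro nth_equalityI) (auto simp: partition_of_def len)
  with f show ?thesis using that by blast
qed

text \<open>
  This makes the set of $\<Lambda>$-partitions nonempty, so that an optimal one exists.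
\<close>

lemma assignment_of_shape:
  "\<exists>f. (\<forall>i<sum_list l. f i < length l) \<and> (\<forall>j<length l. card {i. i < sum_list l \<and> f i = j} = l ! j)"
proof (induction l rule: rev_induct)
  case (snoc x l)
  then obtain f where f: "\<forall>i<sum_list l. f i < length l"
    "\<forall>j<length l. card {i. i < sum_list l \<and> f i = j} = l ! j" by blast
  define g where "g i = (if i < sum_list l then f i else length l)" for i
  have "card {i. i < sum_list (l @ [x]) \<and> g i = j} = (l @ [x]) ! j" if "j < length (l @ [x])" for j
  proof (cases "j < length l")
    case True
    then have "{i. i < sum_list (l @ [x]) \<and> g i = j} = {i. i < sum_list l \<and> f i = j}"
      by (auto simp: g_def)
    then show ?thesis using True f(2) by (simp add: nth_append)
  next
    case False
    then have j: "j = length l" using that by simp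
    have "i < sum_list (l @ [x]) \<and> g i = j \<longleftrightarrow> i \<in> {sum_list l..<sum_list l + x}" for i
      using f(1)[rule_format, of i] by (cases "i < sum_list l") (auto simp: g_def j)
    then have "{i. i < sum_list (l @ [x]) \<and> g i = j} = {sum_list l..<sum_list l + x}"
      unfolding set_eq_iff mem_Collect_eq by blast
    then show ?thesis using False that by (simp add: nth_append)
  qed
  then show ?case by (intro exI[of _ g]) (use f in \<open>auto simp: g_def less_SucI\<close>)
qed simp

definition part_sum :: "nat \<Rightarrow> (nat \<Rightarrow> real) \<Rightarrow> (nat \<Rightarrow> nat) \<Rightarrow> nat \<Rightarrow> real" where
  "part_sum n h f q = (\<Sum>x<n. of_bool (f x = q) * h x)"

lemma part_sum_eq: "(\<Sum>x\<in>{x. x < n \<and> f x = q}. h x) = part_sum n h f q"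
proof -
  have "part_sum n h f q = (\<Sum>x<n. if f x = q then h x else 0)"
    unfolding part_sum_def by (rule sum.cong) auto
  also have "\<dots> = (\<Sum>x\<in>{..<n} \<inter> {x. f x = q}. h x)"
    by (subst sum.If_cases) (auto intro: sum.cong)
  also have "{..<n} \<inter> {x. f x = q} = {x. x < n \<and> f x = q}" by auto
  finally show ?thesis by simp
qed

lemma A_matrix_partition_of:
  assumes "A \<in> carrier_mat k n"
  shows "A_matrix A (partition_of p n f) = mat k p (\<lambda>(r, q). part_sum n (\<lambda>i. A $$ (r, i)) f q)"
  using assms by (intro eq_matI) (auto simp: A_matrix_def partition_of_def part_sum_eq)

lemma part_sum_swap:
  assumes "i < n" "j < n" "f i = r" "f j = s" "r \<noteq> s"
  shows "part_sum n h (f(i := s, j := r)) q =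
    part_sum n h f q + (of_bool (q = r) - of_bool (q = s)) * (h j - h i)"
proof -
  let ?g = "f(i := s, j := r)"
  have ij: "i \<noteq> j" using assms by auto
  have "part_sum n h ?g q - part_sum n h f q =
      (\<Sum>x<n. (of_bool (?g x = q) - of_bool (f x = q)) * h x)"
    by (simp add: part_sum_def sum_subtractf left_diff_distrib)
  also have "\<dots> = (\<Sum>x\<in>{i, j}. (of_bool (?g x = q) - of_bool (f x = q)) * h x)"
    using assms by (intro sum.mono_neutral_right) auto
  also have "\<dots> = (of_bool (q = r) - of_bool (q = s)) * (h j - h i)"
    using ij assms by (auto simp: algebra_simps)
  finally show ?thesis by simp
qed

lemma shape_partition_of: "shape (partition_of p n f) = map (\<lambda>j. card {i. i < n \<and> f i = j}) [0..<p]"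
  by (simp add: shape_def partition_of_def)

lemma card_part: "real (card {x. x < n \<and> f x = q}) = part_sum n (\<lambda>_. 1) f q"
  by (subst part_sum_eq[symmetric]) simp

lemma shape_swap:
  assumes "i < n" "j < n" "f i = r" "f j = s" "r \<noteq> s"
  shows "shape (partition_of p n (f(i := s, j := r))) = shape (partition_of p n f)"
proof -
  have "card {x. x < n \<and> (f(i := s, j := r)) x = q} = card {x. x < n \<and> f x = q}" for q
    using part_sum_swap[OF assms, of "\<lambda>_. 1" q] unfolding card_part[symmetric] by simp
  then show ?thesis by (simp add: shape_partition_of)
qed

text \<open>
  Jensen's inequality for matrices. Matrices of a fixed size do not form a type, hence
  the proof by induction on the index set from the two-point inequality.
\<close>

lemma convex_functional_sum:
  assumes C: "convex_functional k p C" and "finite T" "\<And>t. t \<in> T \<Longrightarrow> 0 \<le> th t" "sum th T = 1"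
  shows "C (mat k p (\<lambda>(r, q). \<Sum>t\<in>T. th t * X t r q)) \<le>
    (\<Sum>t\<in>T. th t * C (mat k p (\<lambda>(r, q). X t r q)))"
  using assms(2-4)
proof (induction T arbitrary: th rule: finite_induct)
  case (insert t T)
  have sum1: "sum th T = 1 - th t" using insert by simp
  have nn: "0 \<le> th x" if "x \<in> insert t T" for x using insert.prems(1) that by blast
  show ?case
  proof (cases "th t = 1")
    case True
    then have "sum th T = 0" using sum1 by simp
    then have "\<forall>x\<in>T. th x = 0" using insert nn by (subst (asm) sum_nonneg_eq_0_iff) auto
    then show ?thesis using True insert by simp
  next
    case False
    have "sum th T \<ge> 0" using nn by (intro sum_nonneg) auto
    then have lt: "th t < 1" using sum1 False by simp
    define Y where "Y = mat k p (\<lambda>(r, q). \<Sum>x\<in>T. (th x / (1 - th t)) * X x r q)"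
    define Z where "Z = mat k p (\<lambda>(r, q). X t r q)"
    have "(\<Sum>x\<in>insert t T. th x * X x r q) =
        (1 - th t) * (\<Sum>x\<in>T. (th x / (1 - th t)) * X x r q) + th t * X t r q" for r q
    proof -
      have "(1 - th t) * (th x / (1 - th t) * y) = th x * y" for x y using lt by simp
      then show ?thesis using insert.hyps by (simp add: sum_distrib_left)
    qed
    then have "mat k p (\<lambda>(r, q). \<Sum>x\<in>insert t T. th x * X x r q) =
        (1 - th t) \<cdot>\<^sub>m Y + th t \<cdot>\<^sub>m Z"
      by (intro eq_matI) (auto simp: Y_def Z_def)
    moreover have "C ((1 - th t) \<cdot>\<^sub>m Y + th t \<cdot>\<^sub>m Z) \<le> (1 - th t) * C Y + th t * C Z"
      using C lt nn[of t] unfolding convex_functional_def by (auto simp: Y_def Z_def)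
    moreover have "C Y \<le> (\<Sum>x\<in>T. (th x / (1 - th t)) * C (mat k p (\<lambda>(r, q). X x r q)))"
      unfolding Y_def
    proof (rule insert.IH)
      show "0 \<le> th x / (1 - th t)" if "x \<in> T" for x using nn that lt by simp
      show "(\<Sum>x\<in>T. th x / (1 - th t)) = 1"
        using sum1 lt by (simp add: sum_divide_distrib[symmetric])
    qed
    then have "(1 - th t) * C Y \<le> (\<Sum>x\<in>T. th x * C (mat k p (\<lambda>(r, q). X x r q)))"
      using lt by (simp add: sum_divide_distrib[symmetric] pos_le_divide_eq mult.commute)
    ultimately show ?thesis using insert by (simp add: Z_def)
  qed
qed simp

definition lift :: "nat \<Rightarrow> (nat \<Rightarrow> nat \<Rightarrow> real) \<Rightarrow> nat \<Rightarrow> nat \<Rightarrow> real" where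
  "lift k a i c = (if c = 0 then 1 else if c \<le> k then a i (c - 1) else real i)"

lemma finite_lexicographic_max:
  fixes F N :: "'a \<Rightarrow> real"
  assumes "finite S" "S \<noteq> {}"
  obtains x where "x \<in> S" "\<And>y. y \<in> S \<Longrightarrow> F y \<le> F x" "\<And>y. y \<in> S \<Longrightarrow> F y = F x \<Longrightarrow> N y \<le> N x"
proof -
  define S1 where "S1 = {x\<in>S. F x = Max (F ` S)}"
  have "Max (F ` S) \<in> F ` S" using assms by simp
  then obtain x0 where "x0 \<in> S" "F x0 = Max (F ` S)" by auto
  then have S1: "finite S1" "S1 \<noteq> {}" using assms(1) by (auto simp: S1_def)
  then have "Max (N ` S1) \<in> N ` S1" by simp
  then obtain x where "x \<in> S1" "N x = Max (N ` S1)" by auto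
  then show ?thesis using that[of x] assms S1 by (auto simp: S1_def)
qed

text \<open>
  The potential $N$ breaks ties among the optimal assignments. If two parts are not separated, the
  relation between their lifted points is normalized to two convex combinations of the same point,
  whose product weights $\<theta>$ on the swaps make the average displacement 0. Averaging turns the
  optimality of $f$ into the optimality of all swaps of positive weight, but increases the average of
  $N$ by the weighted mean of the squared displacements, which are positive since distinct elements
  have distinct lifted points.
\<close>

lemma separated_optimum_exists:
  fixes A :: "real mat" and C :: "real mat \<Rightarrow> real"
  assumes A: "A \<in> carrier_mat k n" and ne: "\<Lambda> \<noteq> {}" and sub: "\<Lambda> \<subseteq> p_shapes p n"
    and C: "convex_functional k p C"
  obtains f where "\<And>i. i < n \<Longrightarrow> f i < p" "optimal_partition p n A \<Lambda> C (partition_of p n f)"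
    "\<And>r s. r < s \<Longrightarrow> pointed {i. i < n \<and> (f i = r \<or> f i = s)} (k + 2)
       (\<lambda>i c. (if f i = r then 1 else -1) * lift k (\<lambda>i r. A $$ (r, i)) i c)"
proof -
  define w where "w = lift k (\<lambda>i r. A $$ (r, i))"
  define F where "F f = C (A_matrix A (partition_of p n f))" for f
  define N where "N f = (\<Sum>q<p. \<Sum>c<k + 2. (part_sum n (\<lambda>i. w i c) f q)\<^sup>2)" for f
  define S where "S = {f \<in> {..<n} \<rightarrow>\<^sub>E {..<p}. shape (partition_of p n f) \<in> \<Lambda>}"
  have restr: "(\<lambda>i\<in>{..<n}. f i) \<in> S \<and> partition_of p n (\<lambda>i\<in>{..<n}. f i) = partition_of p n f"
    if "\<And>i. i < n \<Longrightarrow> f i < p" "shape (partition_of p n f) \<in> \<Lambda>" for f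
  proof -
    have "partition_of p n (\<lambda>i\<in>{..<n}. f i) = partition_of p n f" by (rule partition_of_cong) simp
    then show ?thesis using that by (auto simp: S_def)
  qed
  have finS: "finite S" unfolding S_def by (simp add: finite_PiE)
  obtain l where l: "l \<in> \<Lambda>" "length l = p" "sum_list l = n"
    using ne sub by (auto simp: p_shapes_def)
  obtain f0 where f0: "\<forall>i<n. f0 i < p" "\<forall>j<p. card {i. i < n \<and> f0 i = j} = l ! j"
    using assignment_of_shape[of l] l by auto
  have "shape (partition_of p n f0) = l"
    using f0 l by (intro nth_equalityI) (auto simp: shape_partition_of)
  then have "S \<noteq> {}" using restr[of f0] f0 l by auto
  from finite_lexicographic_max[OF finS this, of F N]
  obtain f where f: "f \<in> S" and Fmax: "\<And>g. g \<in> S \<Longrightarrow> F g \<le> F f"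
    and Nmax: "\<And>g. g \<in> S \<Longrightarrow> F g = F f \<Longrightarrow> N g \<le> N f" by blast
  have fp: "f i < p" if "i < n" for i using f that by (auto simp: S_def)
  show ?thesis
  proof (rule that[of f, folded w_def])
    show "optimal_partition p n A \<Lambda> C (partition_of p n f)"
      unfolding optimal_partition_def Lambda_partition_def
    proof (intro conjI allI impI)
      fix \<pi> assume "p_partition p n \<pi> \<and> shape \<pi> \<in> \<Lambda>"
      then obtain g where "\<And>i. i < n \<Longrightarrow> g i < p" "\<pi> = partition_of p n g" "shape \<pi> \<in> \<Lambda>"
        using p_partition_obtain by metis
      then show "C (A_matrix A \<pi>) \<le> C (A_matrix A (partition_of p n f))"
        using Fmax restr[of g] by (metis F_def)
    qed (use fp f in \<open>auto intro: p_partition_partition_of simp: S_def\<close>)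
  next
    fix r s :: nat assume rs: "r < s"
    define sg where "sg i = (if f i = r then 1 else -1 :: real)" for i
    define I where "I q = {i. i < n \<and> f i = q}" for q
    have finI: "finite (I q)" for q by (simp add: I_def)
    have un: "{i. i < n \<and> (f i = r \<or> f i = s)} = I r \<union> I s" "I r \<inter> I s = {}"
      using rs by (auto simp: I_def)
    show "pointed {i. i < n \<and> (f i = r \<or> f i = s)} (k + 2)
        (\<lambda>i c. (if f i = r then 1 else -1) * w i c)"
      unfolding un(1) pointed_def
    proof (intro allI impI, elim conjE, rule ccontr)
      fix lam :: "nat \<Rightarrow> real"
      assume lam0: "\<forall>i\<in>I r \<union> I s. 0 \<le> lam i"
        and rel: "\<forall>c<k + 2. (\<Sum>i\<in>I r \<union> I s. lam i * ((if f i = r then 1 else -1) * w i c)) = 0"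
        and nz: "\<not> (\<forall>i\<in>I r \<union> I s. lam i = 0)"
      have bal: "(\<Sum>i\<in>I r. lam i * w i c) = (\<Sum>j\<in>I s. lam j * w j c)" if "c < k + 2" for c
      proof -
        have "(\<Sum>i\<in>I r \<union> I s. lam i * ((if f i = r then 1 else -1) * w i c)) =
            (\<Sum>i\<in>I r. lam i * w i c) + (\<Sum>j\<in>I s. - (lam j * w j c))"
          unfolding sum.union_disjoint[OF finI finI un(2)]
          by (intro arg_cong2[where f="(+)"] sum.cong) (use rs in \<open>auto simp: I_def\<close>)
        then show ?thesis using rel that by (simp add: sum_negf)
      qed
      define m where "m = sum lam (I r)"
      have ms: "sum lam (I s) = m" using bal[of 0] by (simp add: m_def w_def lift_def)
      have "m \<noteq> 0"
      proof
        assume "m = 0"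
        then have "\<forall>i\<in>I r. lam i = 0" "\<forall>i\<in>I s. lam i = 0"
          using lam0 ms m_def finI sum_nonneg_eq_0_iff[of _ lam] by auto
        then show False using nz by auto
      qed
      moreover have "0 \<le> m" unfolding m_def using lam0 by (intro sum_nonneg) auto
      ultimately have m: "0 < m" by simp
      define T where "T = I r \<times> I s"
      have finT: "finite T" by (simp add: T_def finI)
      \<comment> \<open>Product weights on the swaps of an element of part $r$ with one of part $s$.\<close>
      define th where "th t = lam (fst t) * lam (snd t) / m\<^sup>2" for t :: "nat \<times> nat"
      define sw where "sw t = f(fst t := s, snd t := r)" for t
      have th0: "0 \<le> th t" if "t \<in> T" for t
        using lam0 that by (auto simp: th_def T_def)
      have factor: "(\<Sum>t\<in>T. th t * (u (fst t) * v (snd t))) =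
          (\<Sum>i\<in>I r. lam i * u i) * (\<Sum>j\<in>I s. lam j * v j) / m\<^sup>2" for u v
        unfolding T_def th_def sum_product sum.cartesian_product
        by (simp add: sum_divide_distrib) (intro sum.cong, auto)
      have th1: "sum th T = 1"
        using factor[of "\<lambda>_. 1" "\<lambda>_. 1"] m ms by (simp add: m_def[symmetric] power2_eq_square)
      have drift: "(\<Sum>t\<in>T. th t * (w (snd t) c - w (fst t) c)) = 0" if "c < k + 2" for c
      proof -
        have "(\<Sum>t\<in>T. th t * w (snd t) c) = (\<Sum>t\<in>T. th t * w (fst t) c)"
          using factor[of "\<lambda>_. 1" "\<lambda>j. w j c"] factor[of "\<lambda>i. w i c" "\<lambda>_. 1"] bal[OF that] ms
          by (simp add: m_def[symmetric])
        then show ?thesis by (simp add: sum_subtractf right_diff_distrib)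
      qed
      have swt: "fst t < n" "snd t < n" "f (fst t) = r" "f (snd t) = s" "r \<noteq> s" if "t \<in> T" for t
        using that rs by (auto simp: T_def I_def)
      have ps: "part_sum n h (sw t) q =
          part_sum n h f q + (of_bool (q = r) - of_bool (q = s)) * (h (snd t) - h (fst t))"
        if "t \<in> T" for t h q
        unfolding sw_def by (rule part_sum_swap[OF swt[OF that]])
      have swS: "sw t \<in> S" if "t \<in> T" for t
      proof -
        have "shape (partition_of p n (sw t)) \<in> \<Lambda>"
          unfolding sw_def shape_swap[OF swt[OF that]] using f by (simp add: S_def)
        moreover have "r < p" "s < p" using fp[of "fst t"] fp[of "snd t"] swt[OF that] by auto
        ultimately show ?thesis
          using f swt[OF that] by (auto simp: S_def sw_def PiE_def extensional_def)
      qed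
      \<comment> \<open>The part sums of $f$ are the average of those of the swapped assignments.\<close>
      have "F f \<le> (\<Sum>t\<in>T. th t * F (sw t))"
      proof -
        have "part_sum n (\<lambda>i. A $$ (x, i)) f q =
            (\<Sum>t\<in>T. th t * part_sum n (\<lambda>i. A $$ (x, i)) (sw t) q)" if x: "x < k" for x q
        proof -
          have w: "w i (Suc x) = A $$ (x, i)" for i using x by (simp add: w_def lift_def)
          have "(\<Sum>t\<in>T. th t * part_sum n (\<lambda>i. A $$ (x, i)) (sw t) q) =
              (\<Sum>t\<in>T. th t * part_sum n (\<lambda>i. A $$ (x, i)) f q +
                (of_bool (q = r) - of_bool (q = s)) * (th t * (w (snd t) (Suc x) - w (fst t) (Suc x))))"
            by (rule sum.cong) (simp_all add: ps w algebra_simps)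
          also have "\<dots> = part_sum n (\<lambda>i. A $$ (x, i)) f q"
            using drift[of "Suc x"] x th1
            by (simp add: sum.distrib sum_distrib_left[symmetric] sum_distrib_right[symmetric])
          finally show ?thesis by simp
        qed
        then have "mat k p (\<lambda>(x, q). part_sum n (\<lambda>i. A $$ (x, i)) f q) =
            mat k p (\<lambda>(x, q). \<Sum>t\<in>T. th t * part_sum n (\<lambda>i. A $$ (x, i)) (sw t) q)"
          by (intro eq_matI) auto
        then show ?thesis
          using convex_functional_sum[OF C finT th0 th1,
              of "\<lambda>t x q. part_sum n (\<lambda>i. A $$ (x, i)) (sw t) q"]
          by (simp add: F_def A_matrix_partition_of[OF A])
      qed
      then have "(\<Sum>t\<in>T. th t * (F f - F (sw t))) \<le> 0"
        using th1 by (simp add: right_diff_distrib sum_subtractf sum_distrib_right[symmetric])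
      moreover have nn: "0 \<le> th t * (F f - F (sw t))" if "t \<in> T" for t
        using th0[OF that] Fmax[OF swS[OF that]] by simp
      ultimately have "(\<Sum>t\<in>T. th t * (F f - F (sw t))) = 0"
        by (meson antisym sum_nonneg)
      then have Feq: "th t = 0 \<or> F (sw t) = F f" if "t \<in> T" for t
        using that finT nn by (subst (asm) sum_nonneg_eq_0_iff) auto
      \<comment> \<open>The linear part averages to 0, the quadratic one is positive.\<close>
      have Ndiff: "N (sw t) - N f = (\<Sum>c<k + 2. 2 * (part_sum n (\<lambda>i. w i c) f r -
            part_sum n (\<lambda>i. w i c) f s) * (w (snd t) c - w (fst t) c)) +
          2 * (\<Sum>c<k + 2. (w (snd t) c - w (fst t) c)\<^sup>2)" if t: "t \<in> T" for t
      proof -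
        have p: "r < p" "s < p" using fp[of "fst t"] fp[of "snd t"] swt[OF t] by auto
        have one: "(\<Sum>q<p. (part_sum n (\<lambda>i. w i c) (sw t) q)\<^sup>2 - (part_sum n (\<lambda>i. w i c) f q)\<^sup>2) =
            2 * (part_sum n (\<lambda>i. w i c) f r - part_sum n (\<lambda>i. w i c) f s) * (w (snd t) c - w (fst t) c) +
            2 * (w (snd t) c - w (fst t) c)\<^sup>2" for c
        proof -
          define e where "e = w (snd t) c - w (fst t) c"
          have "(\<Sum>q<p. (part_sum n (\<lambda>i. w i c) (sw t) q)\<^sup>2 - (part_sum n (\<lambda>i. w i c) f q)\<^sup>2) =
              (\<Sum>q<p. (if q = r then 2 * part_sum n (\<lambda>i. w i c) f q * e + e\<^sup>2 else 0) +
                (if q = s then e\<^sup>2 - 2 * part_sum n (\<lambda>i. w i c) f q * e else 0))"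
            by (rule sum.cong) (use rs in \<open>auto simp: ps[OF t] e_def[symmetric] power2_eq_square algebra_simps\<close>)
          also have "\<dots> = 2 * (part_sum n (\<lambda>i. w i c) f r - part_sum n (\<lambda>i. w i c) f s) * e + 2 * e\<^sup>2"
            using p by (simp add: sum.distrib algebra_simps)
          finally show ?thesis by (simp add: e_def)
        qed
        have "N (sw t) - N f = (\<Sum>c<k + 2. \<Sum>q<p.
            (part_sum n (\<lambda>i. w i c) (sw t) q)\<^sup>2 - (part_sum n (\<lambda>i. w i c) f q)\<^sup>2)"
          unfolding N_def by (subst (3) sum.swap) (simp only: sum_subtractf)
        then show ?thesis unfolding one by (simp add: sum.distrib sum_distrib_left)
      qed
      have "(\<Sum>t\<in>T. th t * (N (sw t) - N f)) \<le> 0"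
        using Feq Nmax swS th0 by (intro sum_nonpos) (metis diff_le_0_iff_le mult_nonneg_nonpos mult_zero_left order_refl)
      moreover have "(\<Sum>t\<in>T. th t * (N (sw t) - N f)) =
          2 * (\<Sum>t\<in>T. th t * (\<Sum>c<k + 2. (w (snd t) c - w (fst t) c)\<^sup>2))"
      proof -
        let ?b = "\<lambda>c. 2 * (part_sum n (\<lambda>i. w i c) f r - part_sum n (\<lambda>i. w i c) f s)"
        have "(\<Sum>t\<in>T. th t * (\<Sum>c<k + 2. ?b c * (w (snd t) c - w (fst t) c))) =
            (\<Sum>c<k + 2. ?b c * (\<Sum>t\<in>T. th t * (w (snd t) c - w (fst t) c)))"
          unfolding sum_distrib_left by (subst sum.swap) (simp add: algebra_simps)
        also have "\<dots> = 0" by (rule sum.neutral) (use drift in auto)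
        finally have "(\<Sum>t\<in>T. th t * (\<Sum>c<k + 2. ?b c * (w (snd t) c - w (fst t) c))) = 0" .
        moreover have "(\<Sum>t\<in>T. th t * (N (sw t) - N f)) =
            (\<Sum>t\<in>T. th t * (\<Sum>c<k + 2. ?b c * (w (snd t) c - w (fst t) c)) +
              2 * (th t * (\<Sum>c<k + 2. (w (snd t) c - w (fst t) c)\<^sup>2)))"
          by (rule sum.cong) (simp_all only: Ndiff, simp_all add: algebra_simps)
        ultimately show ?thesis by (simp only: sum.distrib sum_distrib_left[symmetric])
      qed
      moreover have nn2: "0 \<le> th t * (\<Sum>c<k + 2. (w (snd t) c - w (fst t) c)\<^sup>2)" if "t \<in> T" for t
        using th0[OF that] by (intro mult_nonneg_nonneg sum_nonneg) auto
      ultimately have "(\<Sum>t\<in>T. th t * (\<Sum>c<k + 2. (w (snd t) c - w (fst t) c)\<^sup>2)) = 0"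
        using sum_nonneg[of T "\<lambda>t. th t * (\<Sum>c<k + 2. (w (snd t) c - w (fst t) c)\<^sup>2)"] by force
      then have z: "th t * (\<Sum>c<k + 2. (w (snd t) c - w (fst t) c)\<^sup>2) = 0" if "t \<in> T" for t
        using that finT nn2 by (subst (asm) sum_nonneg_eq_0_iff) auto
      have "th t = 0" if "t \<in> T" for t
      proof -
        \<comment> \<open>The index coordinate separates the two swapped elements.\<close>
        have "w i (Suc k) = real i" for i by (simp add: w_def lift_def)
        then have "0 < (w (snd t) (Suc k) - w (fst t) (Suc k))\<^sup>2"
          using swt[OF that] by auto
        then have "0 < (\<Sum>c<k + 2. (w (snd t) c - w (fst t) c)\<^sup>2)"
          by (intro sum_pos2[of _ "Suc k"]) auto
        then show ?thesis using z[OF that] by auto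
      qed
      then show False using th1 by simp
    qed
  qed (use fp in auto)
qed

section \<open>Partitions coded by pivots\<close>

lemma side_cong:
  assumes "\<And>x. x < m \<Longrightarrow> L x = L' x \<and> D x = D' x"
  shows "side L D E w m = side L' D' E w m"
  using reduced_cong[of m L L' w] mark_cong[of m L L' D D' w] assms by (simp add: side_def fun_eq_iff)

text \<open>
  A digit below $4n$ packs a pivot and two signs. The second sign, that of the coordinate which is left
  at the end, is read from the last digit of a pair only. With $k + 2$ digits per
  pair the exponent would exceed the available one for $k = 1$ and $p \<ge> 3$.
\<close>

definition pivot :: "nat \<Rightarrow> nat \<Rightarrow> nat" where
  "pivot n v = v mod n"

definition mark_sign :: "nat \<Rightarrow> nat \<Rightarrow> real" where
  "mark_sign n v = (if n \<le> v mod (2 * n) then -1 else 1)"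

definition last_sign :: "nat \<Rightarrow> nat \<Rightarrow> real" where
  "last_sign n v = (if 2 * n \<le> v then -1 else 1)"

definition loses :: "nat \<Rightarrow> nat \<Rightarrow> (nat \<Rightarrow> nat \<Rightarrow> real) \<Rightarrow> (nat \<Rightarrow> nat) \<Rightarrow> nat \<Rightarrow> bool" where
  "loses k n w v i \<longleftrightarrow>
     side (\<lambda>j. pivot n (v j)) (\<lambda>j. mark_sign n (v j)) (last_sign n (v k)) w (k + 1) i < 0"

lemma digits_encode:
  assumes "L < n" "D = 1 \<or> D = (-1::real)" "E = 1 \<or> E = (-1::real)"
  defines "v \<equiv> L + (if D = 1 then 0 else n) + (if E = 1 then 0 else 2 * n)"
  shows "v < 4 * n" "pivot n v = L" "mark_sign n v = D" "last_sign n v = E"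
proof -
  show "v < 4 * n" "pivot n v = L" "last_sign n v = E"
    using assms by (auto simp: pivot_def last_sign_def mod_add_eq)
  have "(L + n + 2 * n) mod (2 * n) = L + n" "(L + n) mod (2 * n) = L + n" "(L + 2 * n) mod (2 * n) = L"
    using assms(1) by (simp_all only: mod_add_self2) simp_all
  then show "mark_sign n v = D" using assms by (auto simp: mark_sign_def add.assoc)
qed

lemma digit_decode:
  assumes "x < 4 * n"
  defines "y \<equiv> (if x < n + n then x else x - (n + n))"
  shows "pivot n x = (if y < n then y else y - n)" "mark_sign n x = (if y < n then 1 else -1)"
    "last_sign n x = (if x < n + n then 1 else -1)" "pivot n x < n"
proof -
  have y: "y < n + n" using assms by (auto simp: y_def)
  have xy: "x mod (2 * n) = y"
    using assms(1) le_mod_geq[of "n + n" x] by (cases "x < n + n") (simp_all add: y_def mult_2)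
  have "x mod n = y mod n"
    using xy by (metis dvd_triv_right mod_mod_cancel)
  also have "\<dots> = (if y < n then y else y - n)" using y le_mod_geq[of n y] by (cases "y < n") simp_all
  finally show p: "pivot n x = (if y < n then y else y - n)" by (simp add: pivot_def)
  show "pivot n x < n" unfolding p using y by auto
  show "mark_sign n x = (if y < n then 1 else -1)" using xy by (simp add: mark_sign_def)
  show "last_sign n x = (if x < n + n then 1 else -1)" by (simp add: last_sign_def mult_2)
qed

definition digit :: "nat \<Rightarrow> nat \<Rightarrow> nat \<Rightarrow> nat" where
  "digit R t j = t div R ^ j mod R"

lemma number_with_digits:
  assumes "\<forall>j<Q. g j < R"
  shows "\<exists>t<R ^ Q. \<forall>j<Q. digit R t j = g j"
  using assms
proof (induction Q arbitrary: g)
  case (Suc Q)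
  from Suc.IH[of "\<lambda>j. g (Suc j)"] Suc.prems obtain t
    where t: "t < R ^ Q" "\<forall>j<Q. digit R t j = g (Suc j)" by auto
  have g0: "g 0 < R" using Suc.prems by simp
  show ?case
  proof (intro exI[of _ "g 0 + R * t"] conjI allI impI)
    have "g 0 + R * t < R * Suc t" using g0 by simp
    also have "\<dots> \<le> R ^ Suc Q" using t by (simp del: mult_Suc_right) 
    finally show "g 0 + R * t < R ^ Suc Q" .
    fix j assume j: "j < Suc Q"
    have "(g 0 + R * t) div R = t" using g0 by simp
    then show "digit R (g 0 + R * t) j = g j"
      using t j g0 by (cases j) (auto simp: digit_def div_mult2_eq)
  qed
qed simp

text \<open>
  Together with the next lemma, this is the increment of an odometer: digit $j$ changes exactly when a
  carry arrives, that is, when $R^j$ divides the new number.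
\<close>

lemma digit_Suc:
  assumes "0 < R"
  shows "digit R (Suc t) j = (if R ^ j dvd Suc t
     then (if digit R t j + 1 < R then digit R t j + 1 else 0) else digit R t j)"
proof -
  have "Suc x mod R = (if x mod R + 1 < R then x mod R + 1 else 0)" for x
    using mod_less_divisor[OF assms, of x] by (simp add: mod_Suc)
  moreover have "Suc t div R ^ j = (if R ^ j dvd Suc t then Suc (t div R ^ j) else t div R ^ j)"
    by (simp only: div_Suc dvd_eq_mod_eq_0)
  ultimately show ?thesis unfolding digit_def by simp
qed

lemma power_Suc_dvd_Suc:
  assumes "0 < R"
  shows "R ^ Suc j dvd Suc t \<longleftrightarrow> R ^ j dvd Suc t \<and> digit R t j + 1 = R"
proof (cases "R ^ j dvd Suc t")
  case True
  then have "Suc t = R ^ j * Suc (t div R ^ j)"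
    by (metis div_Suc dvd_eq_mod_eq_0 dvd_mult_div_cancel)
  then have "R ^ Suc j dvd Suc t \<longleftrightarrow> R ^ j * R dvd R ^ j * Suc (t div R ^ j)"
    by (simp only: power_Suc2)
  also have "\<dots> \<longleftrightarrow> R dvd Suc (t div R ^ j)"
    unfolding nat_mult_dvd_cancel_disj using assms by simp
  also have "\<dots> \<longleftrightarrow> digit R t j + 1 = R"
    unfolding digit_def dvd_eq_mod_eq_0 mod_Suc by simp
  finally show ?thesis using True by simp
next
  case False
  then show ?thesis by (metis dvd_mult_right power_Suc)
qed

text \<open>
  Pairs $r < s$ are enumerated by $s$, then by $r$, and each occupies $k + 1$ consecutive digits.
\<close>

definition offset :: "nat \<Rightarrow> nat \<Rightarrow> nat \<Rightarrow> nat" where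
  "offset k r s = ((\<Sum>x<s. x) + r) * (k + 1)"

lemma triangle_mono: "s < s' \<Longrightarrow> (\<Sum>x<s. x) + s \<le> (\<Sum>x<s'. x::nat)"
proof -
  assume "s < s'"
  then have "(\<Sum>x<Suc s. x) \<le> (\<Sum>x<s'. x)" by (intro sum_mono2) auto
  then show ?thesis by simp
qed

lemma offset_less:
  assumes "r < s" "s < p" "j < k + 1"
  shows "offset k r s + j < (\<Sum>x<p. x) * (k + 1)"
proof -
  have "offset k r s + j < ((\<Sum>x<s. x) + r + 1) * (k + 1)"
    using assms(3) by (simp add: offset_def algebra_simps)
  also have "\<dots> \<le> (\<Sum>x<p. x) * (k + 1)"
    using triangle_mono[OF assms(2)] assms(1) by (intro mult_right_mono) auto
  finally show ?thesis .
qed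

lemma offset_inj:
  assumes "offset k r s + j = offset k r' s' + j'" "r < s" "r' < s'" "j < k + 1" "j' < k + 1"
  shows "r = r' \<and> s = s' \<and> j = j'"
proof -
  let ?t = "\<lambda>r s. (\<Sum>x<s. x) + (r::nat)"
  have "(offset k r s + j) div (k + 1) = ?t r s" "(offset k r' s' + j') div (k + 1) = ?t r' s'"
    using assms(4,5) unfolding offset_def by (simp_all only: div_mult_self3) simp_all
  then have t: "?t r s = ?t r' s'" using assms(1) by simp
  then have s: "s = s'" using triangle_mono[of s s'] triangle_mono[of s' s] assms(2,3)
    by (cases s s' rule: linorder_cases) linarith+
  then show ?thesis using t assms(1) by (simp add: offset_def)
qed

text \<open>
  In round $s$ the newcomer $s$ meets the current champion of every element $i$. The opponents are
  the candidates $r < s$ in turn; only the one that equals the champion counts, and once $s$ has won it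
  meets none of the remaining ones.
\<close>

fun duel :: "(nat \<Rightarrow> nat \<Rightarrow> nat \<Rightarrow> bool) \<Rightarrow> nat \<Rightarrow> nat \<Rightarrow> (nat \<Rightarrow> nat) \<Rightarrow> nat \<Rightarrow> nat" where
  "duel beaten s 0 c i = c i"
| "duel beaten s (Suc r) c i =
     (if duel beaten s r c i = r \<and> beaten r s i then s else duel beaten s r c i)"

fun tournament :: "(nat \<Rightarrow> nat \<Rightarrow> nat \<Rightarrow> bool) \<Rightarrow> nat \<Rightarrow> nat \<Rightarrow> nat" where
  "tournament beaten 0 i = 0"
| "tournament beaten (Suc s) i = duel beaten s s (tournament beaten s) i"

lemma duel_range: "duel beaten s r c i = c i \<or> duel beaten s r c i = s"
  by (induction r) auto

lemma tournament_less: "tournament beaten s i < Suc s \<and> (0 < s \<longrightarrow> tournament beaten s i < s)"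
proof (induction s)
  case (Suc s)
  then show ?case
    using duel_range[of beaten s s "tournament beaten s" i] by (auto simp: less_Suc_eq)
qed simp

lemma duel_loser:
  assumes "c i = r" "beaten r s i" "r < m" "m \<le> s"
  shows "duel beaten s m c i = s"
  using assms(3,4)
proof (induction m)
  case (Suc m)
  show ?case
  proof (cases "r = m")
    case True
    then show ?thesis using duel_range[of beaten s m c i] assms(1,2) by auto
  next
    case False
    then show ?thesis using Suc by auto
  qed
qed simp

lemma duel_survivor:
  assumes "\<not> beaten (c i) s i" "m \<le> s"
  shows "duel beaten s m c i = c i"
  using assms(2) by (induction m) (use assms(1) in auto)

text \<open>
  Comparisons that do not involve $z$ may have any outcome. This is essential, because the code of a pair
  of parts says nothing about the elements of the other parts.
\<close>

lemma tournament_winner: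
  assumes "z < p" "\<And>s. z < s \<Longrightarrow> s < p \<Longrightarrow> \<not> beaten z s i" "\<And>r. r < z \<Longrightarrow> beaten r z i"
  shows "tournament beaten p i = z"
proof -
  have "tournament beaten (Suc z) i = z"
  proof (cases "z = 0")
    case False
    then have "tournament beaten z i < z" using tournament_less[of beaten z i] by simp
    then show ?thesis using duel_loser[of "tournament beaten z" i _ beaten z z] assms(3) by simp
  qed simp
  then have "tournament beaten (Suc z + m) i = z" if "Suc z + m \<le> p" for m
    using that
  proof (induction m)
    case (Suc m)
    then have won: "tournament beaten (Suc z + m) i = z" and nb: "\<not> beaten z (Suc z + m) i"
      using assms(2)[of "Suc z + m"] by simp_all
    have "tournament beaten (Suc z + Suc m) i =
        duel beaten (Suc z + m) (Suc z + m) (tournament beaten (Suc z + m)) i"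
      by (simp only: add_Suc_right tournament.simps)
    also have "\<dots> = z"
      using duel_survivor[of beaten "tournament beaten (Suc z + m)" i "Suc z + m" "Suc z + m"] won nb
      by simp
    finally show ?case .
  qed simp
  then show ?thesis using assms(1) by (metis Suc_leI le_add_diff_inverse order_refl)
qed

definition candidate :: "nat \<Rightarrow> nat \<Rightarrow> nat \<Rightarrow> (nat \<Rightarrow> nat \<Rightarrow> real) \<Rightarrow> (nat \<Rightarrow> nat) \<Rightarrow> nat \<Rightarrow> nat" where
  "candidate k n p w g = tournament (\<lambda>r s. loses k n w (\<lambda>j. g (offset k r s + j))) p"

lemma candidate_less: "0 < p \<Longrightarrow> candidate k n p w g i < p"
  using tournament_less by (simp add: candidate_def)

text \<open>
  Each pair of parts provides pivots and signs through \<open>side_exists\<close>, applied to the elements of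
  these two parts only; encoding them in the digits that belong to the pair and reading the
  digits as a number gives $t$.
\<close>

lemma separated_is_candidate:
  assumes n: "0 < n" and fp: "\<And>i. i < n \<Longrightarrow> f i < p"
    and sep: "\<And>r s. r < s \<Longrightarrow> pointed {i. i < n \<and> (f i = r \<or> f i = s)} (k + 2)
       (\<lambda>i c. (if f i = r then 1 else -1) * w i c)"
  shows "\<exists>t<(4 * n) ^ ((\<Sum>x<p. x) * (k + 1)). \<forall>i<n. candidate k n p w (digit (4 * n) t) i = f i"
proof -
  define separates where "separates L D E r s \<longleftrightarrow>
      (\<forall>x. L x < n) \<and> (\<forall>x. D x = 1 \<or> D x = -1) \<and> (E = 1 \<or> E = -1) \<and>
      (\<forall>i<n. (f i = r \<longrightarrow> 0 < side L D E w (k + 1) i) \<and> (f i = s \<longrightarrow> side L D E w (k + 1) i < 0))"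
    for L D E r s
  have "\<exists>L D E. separates L D E r s" if rs: "r < s" for r s
  proof -
    obtain L D E where "\<And>x. L x < n" "\<And>x. D x = 1 \<or> D x = -1" "E = 1 \<or> E = -1"
      and side: "\<And>i. i \<in> {i. i < n \<and> (f i = r \<or> f i = s)} \<Longrightarrow>
        0 < (if f i = r then 1 else -1) * side L D E w (k + 1) i"
      by (rule side_exists[of "{i. i < n \<and> (f i = r \<or> f i = s)}" n
            "\<lambda>i. if f i = r then 1 else -1" "k + 1" w]) (use n sep[OF rs] in auto)
    moreover have "(f i = r \<longrightarrow> 0 < side L D E w (k + 1) i) \<and>
        (f i = s \<longrightarrow> side L D E w (k + 1) i < 0)" if "i < n" for i
      using side[of i] that rs by auto
    ultimately show ?thesis unfolding separates_def by blast
  qed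
  then obtain L D E where "\<And>r s. r < s \<Longrightarrow> separates (L r s) (D r s) (E r s) r s" by metis
  then have LDE: "\<And>r s x. r < s \<Longrightarrow> L r s x < n"
      "\<And>r s x. r < s \<Longrightarrow> D r s x = 1 \<or> D r s x = (-1::real)"
      "\<And>r s. r < s \<Longrightarrow> E r s = 1 \<or> E r s = (-1::real)"
    and side: "\<And>r s i. r < s \<Longrightarrow> i < n \<Longrightarrow>
      (f i = r \<longrightarrow> 0 < side (L r s) (D r s) (E r s) w (k + 1) i) \<and>
      (f i = s \<longrightarrow> side (L r s) (D r s) (E r s) w (k + 1) i < 0)"
    unfolding separates_def by auto
  define enc where "enc r s j = L r s j + (if D r s j = 1 then 0 else n) +
      (if E r s = 1 then 0 else 2 * n)" for r s j
  have enc: "enc r s j < 4 * n" "pivot n (enc r s j) = L r s j"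
      "mark_sign n (enc r s j) = D r s j" "last_sign n (enc r s j) = E r s" if "r < s" for r s j
    unfolding enc_def by (rule digits_encode[OF LDE(1)[OF that] LDE(2)[OF that] LDE(3)[OF that]])+
  define T where "T = {(r, s, j). r < s \<and> s < p \<and> j < k + 1}"
  define h where "h = (\<lambda>(r, s, j). offset k r s + j)"
  have inj: "inj_on h T" by (auto simp: inj_on_def h_def T_def dest: offset_inj)
  define g where "g x = (if x \<in> h ` T then (case inv_into T h x of (r, s, j) \<Rightarrow> enc r s j) else 0)" for x
  have g: "g (offset k r s + j) = enc r s j" if "r < s" "s < p" "j < k + 1" for r s j
  proof -
    have "(r, s, j) \<in> T" "h (r, s, j) = offset k r s + j" using that by (auto simp: T_def h_def)
    then show ?thesis unfolding g_def using inv_into_f_f[OF inj, of "(r, s, j)"] by force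
  qed
  have "g x < 4 * n" for x
  proof (cases "x \<in> h ` T")
    case True
    then obtain r s j where "(r, s, j) \<in> T" "x = offset k r s + j" by (auto simp: h_def)
    then show ?thesis using g enc(1) by (auto simp: T_def)
  qed (use n in \<open>simp add: g_def\<close>)
  from number_with_digits[of _ g, OF allI[OF impI[OF this]]] obtain t
    where t: "t < (4 * n) ^ ((\<Sum>x<p. x) * (k + 1))"
      "\<And>j. j < (\<Sum>x<p. x) * (k + 1) \<Longrightarrow> digit (4 * n) t j = g j" by blast
  have dig: "digit (4 * n) t (offset k r s + j) = enc r s j" if "r < s" "s < p" "j < k + 1" for r s j
    using t(2)[OF offset_less[OF that]] g[OF that] by simp
  have loses: "loses k n w (\<lambda>j. digit (4 * n) t (offset k r s + j)) i \<longleftrightarrow>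
      side (L r s) (D r s) (E r s) w (k + 1) i < 0" if "r < s" "s < p" for r s i
  proof -
    have "side (\<lambda>j. pivot n (digit (4 * n) t (offset k r s + j)))
        (\<lambda>j. mark_sign n (digit (4 * n) t (offset k r s + j))) (E r s) w (k + 1) =
        side (L r s) (D r s) (E r s) w (k + 1)"
      by (rule side_cong) (use that dig enc in auto)
    then show ?thesis unfolding loses_def using that dig enc by simp
  qed
  have "candidate k n p w (digit (4 * n) t) i = f i" if i: "i < n" for i
    unfolding candidate_def
  proof (rule tournament_winner)
    show "f i < p" by (rule fp[OF i])
    show "\<not> loses k n w (\<lambda>j. digit (4 * n) t (offset k (f i) s + j)) i" if "f i < s" "s < p" for s
      using loses[OF that] side[OF that(1) i] by force
    show "loses k n w (\<lambda>j. digit (4 * n) t (offset k r (f i) + j)) i" if "r < f i" for r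
      using loses[OF that fp[OF i]] side[OF that i] by force
  qed
  then show ?thesis using t(1) by blast
qed

section \<open>Total correctness, running time and number sizes of programs\<close>

abbreviation var :: "string \<Rightarrow> nexp" where "var x \<equiv> NGet x (NConst 0)"
abbreviation rvar :: "string \<Rightarrow> rexp" where "rvar x \<equiv> RGet x (NConst 0)"

text \<open>
  The bound is a variable that the body leaves alone. All loops of the program have this form, which
  is why running times can be read off from the syntax.
\<close>

definition For :: "string \<Rightarrow> string \<Rightarrow> com \<Rightarrow> com" where
  "For i b c = Seq (NSet i (NConst 0) (NConst 0)) (While (NLess (var i) (var b))
     (Seq c (NSet i (NConst 0) (NAdd (var i) (NConst 1)))))"

text \<open>
  An upper bound for the length of the trace of an expression which also accounts for the size of its
  constants. With a common bound on the bit sizes of the cells, the bit size of every intermediate result is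
  at most this multiple of it, as shown by \<open>nval_bound\<close> and \<open>rval_level_exact\<close>.
\<close>

fun nlen :: "nexp \<Rightarrow> nat" where
  "nlen (NConst m) = m + 1"
| "nlen (NGet a e) = nlen e + 1"
| "nlen (NAdd e f) = nlen e + nlen f + 1"
| "nlen (NSub e f) = nlen e + nlen f + 1"
| "nlen (NMul e f) = nlen e + nlen f + 1"

fun rlen :: "rexp \<Rightarrow> nat" where
  "rlen (RNat e) = nlen e + 1"
| "rlen (RGet a e) = nlen e + 1"
| "rlen (RAdd e f) = rlen e + rlen f + 1"
| "rlen (RSub e f) = rlen e + rlen f + 1"
| "rlen (RMul e f) = rlen e + rlen f + 1"
| "rlen (RDiv e f) = rlen e + rlen f + 1"

fun blen :: "bexp \<Rightarrow> nat" where
  "blen (NLess e f) = nlen e + nlen f + 1"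
| "blen (RLess e f) = rlen e + rlen f + 1"
| "blen (Neg b) = blen b"
| "blen (Conj b c) = blen b + blen c"

lemma length_ntrace: "length (ntrace s e) \<le> nlen e"
  by (induction e) auto

lemma length_rtrace: "length (rtrace s e) \<le> rlen e"
proof (induction e)
  case (RNat e) then show ?case using length_ntrace[of s e] by simp
next
  case (RGet a e) then show ?case using length_ntrace[of s e] by simp
qed auto

lemma length_btrace: "length (btrace s b) \<le> blen b"
proof (induction b)
  case (NLess e f) then show ?case using length_ntrace[of s e] length_ntrace[of s f] by simp
next
  case (RLess e f) then show ?case using length_rtrace[of s e] length_rtrace[of s f] by simp
qed auto

text \<open>
  The constant 50 bounds the trace length of every atomic command and test of the program.
\<close>

fun small :: "com \<Rightarrow> bool" where
  "small Skip \<longleftrightarrow> True"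
| "small (NSet a e f) \<longleftrightarrow> nlen e + nlen f + 1 \<le> 50"
| "small (RSet a e f) \<longleftrightarrow> nlen e + rlen f + 1 \<le> 50"
| "small (AskShape a e x l) \<longleftrightarrow> nlen e + nlen l + 1 \<le> 50"
| "small (AskValue a e x r c) \<longleftrightarrow> nlen e + nlen r + nlen c + 1 \<le> 50"
| "small (Seq c1 c2) \<longleftrightarrow> small c1 \<and> small c2"
| "small (If b c1 c2) \<longleftrightarrow> blen b \<le> 50 \<and> small c1 \<and> small c2"
| "small (While b c) \<longleftrightarrow> blen b \<le> 50 \<and> small c"

fun loop_bound :: "(string \<Rightarrow> nat) \<Rightarrow> bexp \<Rightarrow> nat" where
  "loop_bound bound (NLess e (NGet b f)) = bound b"
| "loop_bound bound _ = 0"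

text \<open>
  Running time in units of \<open>50\<close> trace steps, as a function of upper bounds for the loop limits only.
\<close>

fun units :: "(string \<Rightarrow> nat) \<Rightarrow> com \<Rightarrow> nat" where
  "units bound Skip = 0"
| "units bound (NSet a e f) = 1"
| "units bound (RSet a e f) = 1"
| "units bound (AskShape a e x l) = 1"
| "units bound (AskValue a e x r c) = 1"
| "units bound (Seq c1 c2) = units bound c1 + units bound c2"
| "units bound (If b c1 c2) = 1 + units bound c1 + units bound c2"
| "units bound (While b c) = 1 + loop_bound bound b * (units bound c + 1)"

fun nat_writes :: "com \<Rightarrow> string set" where
  "nat_writes (NSet a e f) = {a}"
| "nat_writes (AskShape a e x l) = {a}"
| "nat_writes (Seq c1 c2) = nat_writes c1 \<union> nat_writes c2"
| "nat_writes (If b c1 c2) = nat_writes c1 \<union> nat_writes c2"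
| "nat_writes (While b c) = nat_writes c"
| "nat_writes _ = {}"

fun real_writes :: "com \<Rightarrow> string set" where
  "real_writes (RSet a e f) = {a}"
| "real_writes (AskValue a e x r c) = {a}"
| "real_writes (Seq c1 c2) = real_writes c1 \<union> real_writes c2"
| "real_writes (If b c1 c2) = real_writes c1 \<union> real_writes c2"
| "real_writes (While b c) = real_writes c"
| "real_writes _ = {}"

lemma For_writes [simp]:
  "nat_writes (For i b c) = insert i (nat_writes c)" "real_writes (For i b c) = real_writes c"
  by (auto simp: For_def)

lemma For_small [simp]: "small (For i b c) \<longleftrightarrow> small c"
  by (simp add: For_def)

lemma For_units [simp]: "units bound (For i b c) = 2 + bound b * (units bound c + 2)"
  by (simp add: For_def)

text \<open>
  The arrays that a command may write are determined by its syntax, so specifications only have to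
  describe the contents of those.
\<close>

definition frame :: "string set \<Rightarrow> string set \<Rightarrow> state \<Rightarrow> state \<Rightarrow> bool" where
  "frame X Y s t \<longleftrightarrow> (\<forall>a. a \<notin> X \<longrightarrow> nat_mem t a = nat_mem s a) \<and>
     (\<forall>a. a \<notin> Y \<longrightarrow> real_mem t a = real_mem s a)"

lemma nat_mem_set_nat [simp]:
  "nat_mem (set_nat a i v s) b j = (if b = a \<and> j = i then v else nat_mem s b j)"
  by (simp add: set_nat_def)

lemma real_mem_set_real [simp]:
  "real_mem (set_real a i v s) b j = (if b = a \<and> j = i then v else real_mem s b j)"
  by (simp add: set_real_def)

lemma mem_set_other [simp]:
  "nat_mem (set_real a i x s) = nat_mem s" "real_mem (set_nat a i v s) = real_mem s"
  by (simp_all add: set_nat_def set_real_def)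

lemma mem_set_other_array [simp]:
  "b \<noteq> a \<Longrightarrow> nat_mem (set_nat a i v s) b = nat_mem s b"
  "b \<noteq> a \<Longrightarrow> real_mem (set_real a i x s) b = real_mem s b"
  by (simp_all add: set_nat_def set_real_def)

lemma exec_frame: "exec lo vo c s t tr \<Longrightarrow> frame (nat_writes c) (real_writes c) s t"
  by (induction rule: exec.induct) (auto simp: frame_def fun_eq_iff)

lemma frame_trans:
  "frame X Y s t \<Longrightarrow> frame X' Y' t u \<Longrightarrow> X \<subseteq> Z \<Longrightarrow> X' \<subseteq> Z \<Longrightarrow> Y \<subseteq> W \<Longrightarrow> Y' \<subseteq> W \<Longrightarrow> frame Z W s u"
  unfolding frame_def by (metis subsetD)

text \<open>
  Level $b$ stands for the numbers of bit size about $b$. Taking all reals for each level gives the real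
  arithmetic model, in which nothing is claimed about sizes.
\<close>

locale level_sets =
  fixes P :: "nat \<Rightarrow> real set"
  assumes level_mono: "b \<le> b' \<Longrightarrow> P b \<subseteq> P b'"
    and level_nat: "m \<le> 2 ^ b \<Longrightarrow> real m \<in> P b"
    and level_add: "x \<in> P b \<Longrightarrow> y \<in> P c \<Longrightarrow> x + y \<in> P (b + c + 1)"
    and level_sub: "x \<in> P b \<Longrightarrow> y \<in> P c \<Longrightarrow> x - y \<in> P (b + c + 1)"
    and level_mult: "x \<in> P b \<Longrightarrow> y \<in> P c \<Longrightarrow> x * y \<in> P (b + c)"
    and level_div: "x \<in> P b \<Longrightarrow> y \<in> P c \<Longrightarrow> x / y \<in> P (b + c)"

locale machine = level_sets P for P +
  fixes lo :: "nat list \<Rightarrow> bool" and vo :: "real mat \<Rightarrow> real"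
    and bits_bound width :: nat and bound :: "string \<Rightarrow> nat"
  assumes bits_bound_pos: "1 \<le> bits_bound"
begin

definition bounded :: "state \<Rightarrow> bool" where
  "bounded s \<longleftrightarrow> (\<forall>a i. nat_mem s a i \<le> 2 ^ bits_bound) \<and> (\<forall>a i. real_mem s a i \<in> P bits_bound)"

definition tame :: "nat \<Rightarrow> step list \<Rightarrow> bool" where
  "tame l tr \<longleftrightarrow> (\<forall>st\<in>set tr. length (numbers st) \<le> width + 4 \<and> set (numbers st) \<subseteq> P (bits_bound * l))"

text \<open>
  Total correctness with accounting. Halting, the running time and the sizes of all
  numbers in the trace are part of the meaning of a triple, so that its rules only ask for bounds on the values
  that are stored. Smallness of the program and boundedness of the initial state are premises inside the
  definition, to be discharged once for the whole program.
\<close>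

definition run :: "com \<Rightarrow> state \<Rightarrow> (state \<Rightarrow> bool) \<Rightarrow> bool" where
  "run c s Q \<longleftrightarrow> (small c \<and> bounded s \<longrightarrow>
     (\<exists>t tr. exec lo vo c s t tr \<and> bounded t \<and> length tr \<le> 50 * units bound c \<and> tame 50 tr \<and> Q t))"

lemma tame_append [simp]: "tame l (tr1 @ tr2) \<longleftrightarrow> tame l tr1 \<and> tame l tr2"
  by (auto simp: tame_def)

lemma tame_single: "tame l [st] \<longleftrightarrow> length (numbers st) \<le> width + 4 \<and> set (numbers st) \<subseteq> P (bits_bound * l)"
  by (simp add: tame_def)

lemma level_natI: "m \<le> 2 ^ (bits_bound * l) \<Longrightarrow> l \<le> l' \<Longrightarrow> real m \<in> P (bits_bound * l')"
  using level_nat[of m "bits_bound * l"] level_mono[of "bits_bound * l" "bits_bound * l'"] by auto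

lemma level_le: "x \<in> P (bits_bound * l) \<Longrightarrow> l \<le> l' \<Longrightarrow> x \<in> P (bits_bound * l')"
  using level_mono[of "bits_bound * l" "bits_bound * l'"] by auto

lemma cell_nat: "bounded s \<Longrightarrow> nat_mem s a i \<le> 2 ^ (bits_bound * (l + 1))"
proof -
  assume "bounded s"
  then have "nat_mem s a i \<le> 2 ^ bits_bound" by (simp add: bounded_def)
  also have "\<dots> \<le> (2::nat) ^ (bits_bound * (l + 1))" by (rule power_increasing) auto
  finally show ?thesis .
qed

lemma cell_real: "bounded s \<Longrightarrow> real_mem s a i \<in> P (bits_bound * (l + 1))"
  using level_le[of "real_mem s a i" 1 "l + 1"] by (simp add: bounded_def)

lemma nval_bound: "bounded s \<Longrightarrow> nval s e \<le> 2 ^ (bits_bound * nlen e)"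
proof (induction e)
  case (NConst m)
  have "m \<le> (2::nat) ^ (m + 1)" using less_exp[of "m + 1"] by linarith
  also have "\<dots> \<le> (2::nat) ^ (bits_bound * (m + 1))"
    using mult_le_mono1[OF bits_bound_pos, of "m + 1"] by (intro power_increasing) auto
  finally show ?case by simp
next
  case (NGet a e)
  then show ?case using cell_nat[of s a "nval s e" "nlen e"] by simp
next
  case (NAdd e f)
  let ?a = "bits_bound * nlen e" and ?b = "bits_bound * nlen f"
  have "nval s e + nval s f \<le> 2 ^ ?a + 2 ^ ?b" using NAdd by (simp add: add_mono)
  also have "\<dots> \<le> 2 ^ (?a + ?b) + 2 ^ (?a + ?b)" by (intro add_mono power_increasing) auto
  also have "\<dots> = 2 ^ (?a + ?b + 1)" by simp
  also have "\<dots> \<le> 2 ^ (bits_bound * nlen (NAdd e f))"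
    using bits_bound_pos by (intro power_increasing) (auto simp: algebra_simps)
  finally show ?case by simp
next
  case (NSub e f)
  have "nval s e - nval s f \<le> 2 ^ (bits_bound * nlen e)" using NSub by (meson diff_le_self le_trans)
  also have "\<dots> \<le> 2 ^ (bits_bound * nlen (NSub e f))"
    by (intro power_increasing mult_le_mono) auto
  finally show ?case by simp
next
  case (NMul e f)
  have "nval s e * nval s f \<le> 2 ^ (bits_bound * nlen e) * 2 ^ (bits_bound * nlen f)"
    using NMul by (intro mult_mono) auto
  also have "\<dots> = 2 ^ (bits_bound * (nlen e + nlen f))" by (simp add: power_add algebra_simps)
  also have "\<dots> \<le> 2 ^ (bits_bound * nlen (NMul e f))"
    by (intro power_increasing mult_le_mono) auto
  finally show ?case by simp
qed

lemma nval_level: "bounded s \<Longrightarrow> nlen e \<le> l \<Longrightarrow> real (nval s e) \<in> P (bits_bound * l)"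
  by (rule level_natI[OF nval_bound])

lemma tame_ntrace: "bounded s \<Longrightarrow> nlen e \<le> l \<Longrightarrow> tame l (ntrace s e)"
proof (induction e)
  case (NConst m)
  then show ?case using nval_level[of s "NConst m" l] by (simp add: tame_single)
next
  case (NGet a e)
  then show ?case using nval_level[of s "NGet a e" l] nval_level[of s e l] by (simp add: tame_single)
next
  case (NAdd e f)
  then show ?case using nval_level[of s "NAdd e f" l] nval_level[of s e l] nval_level[of s f l]
    by (simp add: tame_single)
next
  case (NSub e f)
  then show ?case using nval_level[of s "NSub e f" l] nval_level[of s e l] nval_level[of s f l]
    by (simp add: tame_single)
next
  case (NMul e f)
  then show ?case using nval_level[of s "NMul e f" l] nval_level[of s e l] nval_level[of s f l]
    by (simp add: tame_single)
qed

lemma rval_level_exact: "bounded s \<Longrightarrow> rval s e \<in> P (bits_bound * rlen e)"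
proof (induction e)
  case (RNat e)
  then show ?case using nval_level[of s e "nlen e + 1"] by simp
next
  case (RGet a e)
  then show ?case using cell_real[of s a "nval s e" "nlen e"] by simp
next
  have le: "x \<in> P (bits_bound * (a + b + 1))" if "x \<in> P (bits_bound * a + bits_bound * b + 1)" for x a b
    using that level_mono[of "bits_bound * a + bits_bound * b + 1" "bits_bound * (a + b + 1)"]
      bits_bound_pos by (auto simp: algebra_simps)
  have le': "x \<in> P (bits_bound * (a + b + 1))" if "x \<in> P (bits_bound * a + bits_bound * b)" for x a b
    using that level_mono[of "bits_bound * a + bits_bound * b" "bits_bound * (a + b + 1)"]
    by (auto simp: algebra_simps)
  {
    case (RAdd e f)
    then show ?case using le level_add by simp
  next
    case (RSub e f)
    then show ?case using le level_sub by simp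
  next
    case (RMul e f)
    then show ?case using le' level_mult by simp
  next
    case (RDiv e f)
    then show ?case using le' level_div by simp
  }
qed

lemma rval_level: "bounded s \<Longrightarrow> rlen e \<le> l \<Longrightarrow> rval s e \<in> P (bits_bound * l)"
  by (rule level_le[OF rval_level_exact])

lemma tame_rtrace: "bounded s \<Longrightarrow> rlen e \<le> l \<Longrightarrow> tame l (rtrace s e)"
proof (induction e)
  case (RNat e)
  then show ?case using rval_level[of s "RNat e" l] tame_ntrace[of s e l] by (simp add: tame_single)
next
  case (RGet a e)
  then show ?case using rval_level[of s "RGet a e" l] tame_ntrace[of s e l] nval_level[of s e l]
    by (simp add: tame_single)
next
  case (RAdd e f)
  then show ?case using rval_level[of s "RAdd e f" l] rval_level[of s e l] rval_level[of s f l]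
    by (simp add: tame_single)
next
  case (RSub e f)
  then show ?case using rval_level[of s "RSub e f" l] rval_level[of s e l] rval_level[of s f l]
    by (simp add: tame_single)
next
  case (RMul e f)
  then show ?case using rval_level[of s "RMul e f" l] rval_level[of s e l] rval_level[of s f l]
    by (simp add: tame_single)
next
  case (RDiv e f)
  then show ?case using rval_level[of s "RDiv e f" l] rval_level[of s e l] rval_level[of s f l]
    by (simp add: tame_single)
qed

lemma tame_btrace: "bounded s \<Longrightarrow> blen b \<le> l \<Longrightarrow> tame l (btrace s b)"
proof (induction b)
  case (NLess e f)
  then show ?case using tame_ntrace[of s e l] tame_ntrace[of s f l] nval_level[of s e l] nval_level[of s f l]
    by (simp add: tame_single)
next
  case (RLess e f)
  then show ?case using tame_rtrace[of s e l] tame_rtrace[of s f l] rval_level[of s e l] rval_level[of s f l]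
    by (simp add: tame_single)
qed auto

lemma bounded_set_nat: "bounded s \<Longrightarrow> v \<le> 2 ^ bits_bound \<Longrightarrow> bounded (set_nat a i v s)"
  by (auto simp: bounded_def)

lemma bounded_set_real: "bounded s \<Longrightarrow> x \<in> P bits_bound \<Longrightarrow> bounded (set_real a i x s)"
  by (auto simp: bounded_def)

lemma runI:
  assumes "exec lo vo c s t tr"
    "small c \<Longrightarrow> bounded s \<Longrightarrow> bounded t \<and> length tr \<le> 50 * units bound c \<and> tame 50 tr \<and> Q t"
  shows "run c s Q"
  unfolding run_def using assms by blast

lemma run_Skip: "Q s \<Longrightarrow> run Skip s Q"
  by (rule runI, rule exec.Skip) (simp add: tame_def)

lemma run_NSet:
  assumes "bounded s \<Longrightarrow> nval s f \<le> 2 ^ bits_bound" "Q (set_nat a (nval s e) (nval s f) s)"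
  shows "run (NSet a e f) s Q"
proof (rule runI, rule exec.NSet)
  assume sm: "small (NSet a e f)" and bd: "bounded s"
  show "bounded (set_nat a (nval s e) (nval s f) s) \<and>
      length (ntrace s e @ ntrace s f @ [Move [real (nval s e), real (nval s f)]]) \<le> 50 * units bound (NSet a e f) \<and>
      tame 50 (ntrace s e @ ntrace s f @ [Move [real (nval s e), real (nval s f)]]) \<and>
      Q (set_nat a (nval s e) (nval s f) s)"
    using sm assms bounded_set_nat[OF bd] length_ntrace[of s e] length_ntrace[of s f]
      tame_ntrace[OF bd, of e 50] tame_ntrace[OF bd, of f 50]
      nval_level[OF bd, of e 50] nval_level[OF bd, of f 50] bd
    by (auto simp: tame_single)
qed

lemma run_RSet:
  assumes "bounded s \<Longrightarrow> rval s f \<in> P bits_bound" "Q (set_real a (nval s e) (rval s f) s)"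
  shows "run (RSet a e f) s Q"
proof (rule runI, rule exec.RSet)
  assume sm: "small (RSet a e f)" and bd: "bounded s"
  show "bounded (set_real a (nval s e) (rval s f) s) \<and>
      length (ntrace s e @ rtrace s f @ [Move [real (nval s e), rval s f]]) \<le> 50 * units bound (RSet a e f) \<and>
      tame 50 (ntrace s e @ rtrace s f @ [Move [real (nval s e), rval s f]]) \<and>
      Q (set_real a (nval s e) (rval s f) s)"
    using sm assms bounded_set_real[OF bd] length_ntrace[of s e] length_rtrace[of s f]
      tame_ntrace[OF bd, of e 50] tame_rtrace[OF bd, of f 50]
      nval_level[OF bd, of e 50] rval_level[OF bd, of f 50] bd
    by (auto simp: tame_single)
qed

lemma run_AskShape:
  assumes "nval s l \<le> width"
    "Q (set_nat a (nval s e) (of_bool (lo (read_tuple s x (nval s l)))) s)"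
  shows "run (AskShape a e x l) s Q"
proof (rule runI, rule exec.AskShape[OF refl refl])
  assume sm: "small (AskShape a e x l)" and bd: "bounded s"
  have "real (nat_mem s x i) \<in> P (bits_bound * 50)" for i
    using level_natI[of "nat_mem s x i" 1 50] bd by (simp add: bounded_def)
  moreover have "real (of_bool b) \<in> P (bits_bound * 50)" for b
    using level_nat[of "of_bool b"] by simp
  moreover have "(of_bool b :: nat) \<le> 2 ^ bits_bound" for b by simp
  ultimately show "bounded (set_nat a (nval s e) (of_bool (lo (read_tuple s x (nval s l)))) s) \<and>
      length (ntrace s e @ ntrace s l @
      [Query ([real (nval s e), real (nval s l)] @ map real (read_tuple s x (nval s l)) @
        [real (of_bool (lo (read_tuple s x (nval s l))))])]) \<le> 50 * units bound (AskShape a e x l) \<and>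
      tame 50 (ntrace s e @ ntrace s l @
      [Query ([real (nval s e), real (nval s l)] @ map real (read_tuple s x (nval s l)) @
        [real (of_bool (lo (read_tuple s x (nval s l))))])]) \<and>
      Q (set_nat a (nval s e) (of_bool (lo (read_tuple s x (nval s l)))) s)"
    using sm assms bounded_set_nat[OF bd] length_ntrace[of s e] length_ntrace[of s l]
      tame_ntrace[OF bd, of e 50] tame_ntrace[OF bd, of l 50]
      nval_level[OF bd, of e 50] nval_level[OF bd, of l 50] bd
    by (auto simp: tame_single read_tuple_def simp del: of_nat_of_bool of_bool_eq_iff)
qed

lemma run_AskValue:
  assumes "nval s r * nval s c \<le> width"
    "bounded s \<Longrightarrow> vo (read_mat s x (nval s r) (nval s c)) \<in> P bits_bound"
    "Q (set_real a (nval s e) (vo (read_mat s x (nval s r) (nval s c))) s)"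
  shows "run (AskValue a e x r c) s Q"
proof (rule runI, rule exec.AskValue[OF refl refl])
  assume sm: "small (AskValue a e x r c)" and bd: "bounded s"
  have "real_mem s x i \<in> P (bits_bound * 50)" for i
    using cell_real[OF bd, of x i 49] by simp
  moreover have "vo (read_mat s x (nval s r) (nval s c)) \<in> P (bits_bound * 50)"
    using assms(2)[OF bd] level_le[of _ 1 50] by simp
  ultimately show "bounded (set_real a (nval s e) (vo (read_mat s x (nval s r) (nval s c))) s) \<and>
      length (ntrace s e @ ntrace s r @ ntrace s c @
      [Query ([real (nval s e), real (nval s r), real (nval s c)] @
        map (real_mem s x) [0..<nval s r * nval s c] @ [vo (read_mat s x (nval s r) (nval s c))])]) \<le> 50 * units bound (AskValue a e x r c) \<and>
      tame 50 (ntrace s e @ ntrace s r @ ntrace s c @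
      [Query ([real (nval s e), real (nval s r), real (nval s c)] @
        map (real_mem s x) [0..<nval s r * nval s c] @ [vo (read_mat s x (nval s r) (nval s c))])]) \<and>
      Q (set_real a (nval s e) (vo (read_mat s x (nval s r) (nval s c))) s)"
    using sm assms bounded_set_real[OF bd]
      length_ntrace[of s e] length_ntrace[of s r] length_ntrace[of s c]
      tame_ntrace[OF bd, of e 50] tame_ntrace[OF bd, of r 50] tame_ntrace[OF bd, of c 50]
      nval_level[OF bd, of e 50] nval_level[OF bd, of r 50] nval_level[OF bd, of c 50] bd
    by (auto simp: tame_single)
qed

lemma run_Seq: "run c1 s (\<lambda>t. run c2 t Q) \<Longrightarrow> run (Seq c1 c2) s Q"
  unfolding run_def
proof (intro impI, elim conjE)
  assume r: "small c1 \<and> bounded s \<longrightarrow> (\<exists>t tr. exec lo vo c1 s t tr \<and> bounded t \<and>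
      length tr \<le> 50 * units bound c1 \<and> tame 50 tr \<and> (small c2 \<and> bounded t \<longrightarrow>
      (\<exists>t' tr. exec lo vo c2 t t' tr \<and> bounded t' \<and> length tr \<le> 50 * units bound c2 \<and> tame 50 tr \<and> Q t')))"
    and "small (Seq c1 c2)" "bounded s"
  then obtain t tr t' tr' where "exec lo vo c1 s t tr" "length tr \<le> 50 * units bound c1" "tame 50 tr"
    "exec lo vo c2 t t' tr'" "bounded t'" "length tr' \<le> 50 * units bound c2" "tame 50 tr'" "Q t'"
    by (auto)
  then show "\<exists>t tr. exec lo vo (Seq c1 c2) s t tr \<and> bounded t \<and>
      length tr \<le> 50 * units bound (Seq c1 c2) \<and> tame 50 tr \<and> Q t"
    by (intro exI[of _ t'] exI[of _ "tr @ tr'"]) (auto intro: exec.Seq)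
qed

lemma run_If:
  assumes "bval s b \<Longrightarrow> run c1 s Q" "\<not> bval s b \<Longrightarrow> run c2 s Q"
  shows "run (If b c1 c2) s Q"
  unfolding run_def
proof (intro impI, elim conjE)
  assume sm: "small (If b c1 c2)" and bd: "bounded s"
  have b: "length (btrace s b) \<le> 50" "tame 50 (btrace s b)"
    using sm length_btrace[of s b] tame_btrace[OF bd, of b 50] by auto
  show "\<exists>t tr. exec lo vo (If b c1 c2) s t tr \<and> bounded t \<and>
      length tr \<le> 50 * units bound (If b c1 c2) \<and> tame 50 tr \<and> Q t"
  proof (cases "bval s b")
    case True
    then obtain t tr where "exec lo vo c1 s t tr" "bounded t" "length tr \<le> 50 * units bound c1" "tame 50 tr" "Q t"
      using assms(1) sm bd unfolding run_def by auto
    then show ?thesis using b True by (intro exI[of _ t] exI[of _ "btrace s b @ tr"]) (auto intro: exec.IfTrue)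
  next
    case False
    then obtain t tr where "exec lo vo c2 s t tr" "bounded t" "length tr \<le> 50 * units bound c2" "tame 50 tr" "Q t"
      using assms(2) sm bd unfolding run_def by auto
    then show ?thesis using b False by (intro exI[of _ t] exI[of _ "btrace s b @ tr"]) (auto intro: exec.IfFalse)
  qed
qed

lemma run_frame:
  assumes "run c s Q'" "\<And>t. frame (nat_writes c) (real_writes c) s t \<Longrightarrow> Q' t \<Longrightarrow> Q t"
  shows "run c s Q"
  using assms exec_frame unfolding run_def by blast

text \<open>
  The invariant may use that only the arrays written by the body, and the counter, differ from the
  initial state.
\<close>

lemma run_For:
  assumes i: "i \<notin> nat_writes c" and b: "b \<notin> nat_writes c" and ib: "i \<noteq> b"
    and N: "nat_mem s b 0 = N" "N \<le> bound b"
    and init: "Inv 0 (set_nat i 0 0 s)"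
    and step: "\<And>m t. m < N \<Longrightarrow> frame (insert i (nat_writes c)) (real_writes c) s t \<Longrightarrow>
      nat_mem t i 0 = m \<Longrightarrow> Inv m t \<Longrightarrow> run c t (\<lambda>t'. Inv (Suc m) (set_nat i 0 (Suc m) t'))"
    and final: "\<And>t. frame (insert i (nat_writes c)) (real_writes c) s t \<Longrightarrow> Inv N t \<Longrightarrow> Q t"
  shows "run (For i b c) s Q"
  unfolding For_def
proof (rule run_Seq, rule run_NSet)
  let ?cond = "NLess (var i) (var b)"
  let ?body = "Seq c (NSet i (NConst 0) (NAdd (var i) (NConst 1)))"
  let ?fr = "frame (insert i (nat_writes c)) (real_writes c) s"
  let ?U = "units bound c + 2"
  have iter: "\<exists>t tr. exec lo vo (While ?cond ?body) u t tr \<and> bounded t \<and>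
      length tr \<le> 50 * (1 + (N - m) * ?U) \<and> tame 50 tr \<and> Q t"
    if "small c" "m \<le> N" "bounded u" "?fr u" "nat_mem u i 0 = m" "Inv m u" for m u
    using that
  proof (induction "N - m" arbitrary: m u)
    case 0
    then have "\<not> bval u ?cond" using N b ib by (auto simp: frame_def)
    then have "exec lo vo (While ?cond ?body) u u (btrace u ?cond)" by (rule exec.WhileFalse)
    moreover have "Q u" using 0 final by simp
    moreover have "length (btrace u ?cond) \<le> 50" "tame 50 (btrace u ?cond)"
      using length_btrace[of u ?cond] tame_btrace[OF 0(4), of ?cond 50] by auto
    moreover have "length (btrace u ?cond) \<le> 50 * (1 + (N - m) * ?U)"
      using length_btrace[of u ?cond] by simp
    ultimately show ?case using \<open>bounded u\<close> by blast
  next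
    case (Suc x)
    then have m: "m < N" by simp
    have ub: "nat_mem u b 0 = N" using Suc N b ib by (auto simp: frame_def)
    have cond: "bval u ?cond" using m Suc.prems ub by simp
    have len: "length (btrace u ?cond) \<le> 50" "tame 50 (btrace u ?cond)"
      using length_btrace[of u ?cond] tame_btrace[OF \<open>bounded u\<close>, of ?cond 50] by auto
    from step[OF m Suc.prems(4-6)] Suc.prems obtain v tr1
      where v: "exec lo vo c u v tr1" "bounded v" "length tr1 \<le> 50 * units bound c" "tame 50 tr1"
        and inv: "Inv (Suc m) (set_nat i 0 (Suc m) v)" unfolding run_def by auto
    have vi: "nat_mem v i 0 = m"
      using exec_frame[OF v(1)] i Suc.prems by (auto simp: frame_def)
    let ?v = "set_nat i 0 (Suc m) v"
    have "N \<le> 2 ^ bits_bound" using ub Suc.prems by (auto simp: bounded_def)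
    then have bv: "bounded ?v" using m v by (intro bounded_set_nat) auto
    have "run (NSet i (NConst 0) (NAdd (var i) (NConst 1))) v (\<lambda>t. t = ?v)"
      using m \<open>N \<le> 2 ^ bits_bound\<close> by (intro run_NSet) (auto simp: vi)
    then obtain tr2 where tr2: "exec lo vo (NSet i (NConst 0) (NAdd (var i) (NConst 1))) v ?v tr2"
      "length tr2 \<le> 50" "tame 50 tr2" using v by (auto simp: run_def)
    have "?fr v" using frame_trans[OF \<open>?fr u\<close> exec_frame[OF v(1)]] by blast
    then have frv: "?fr ?v" by (auto simp: frame_def fun_eq_iff)
    obtain t tr3 where t: "exec lo vo (While ?cond ?body) ?v t tr3" "bounded t"
      "length tr3 \<le> 50 * (1 + (N - Suc m) * ?U)" "tame 50 tr3" "Q t"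
      using Suc(1)[of "Suc m" ?v, OF _ \<open>small c\<close> _ bv frv _ inv] Suc(2) m by force
    have "N - m = Suc (N - Suc m)" using m by simp
    then have "length (btrace u ?cond @ (tr1 @ tr2) @ tr3) \<le> 50 * (1 + (N - m) * ?U)"
      using len tr2 t(3) v(3) by (simp add: algebra_simps)
    moreover have "exec lo vo (While ?cond ?body) u t (btrace u ?cond @ (tr1 @ tr2) @ tr3)"
      by (rule exec.WhileTrue[OF cond exec.Seq[OF v(1) tr2(1)] t(1)])
    moreover have "tame 50 (btrace u ?cond @ (tr1 @ tr2) @ tr3)"
      unfolding tame_append using len tr2 t v by blast
    ultimately show ?case using t by blast
  qed
  show "run (While ?cond ?body) (set_nat i (nval s (NConst 0)) (nval s (NConst 0)) s) Q"
    unfolding run_def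
  proof (intro impI, elim conjE)
    assume "small (While ?cond ?body)" and bd: "bounded (set_nat i (nval s (NConst 0)) (nval s (NConst 0)) s)"
    moreover have "?fr (set_nat i 0 0 s)" by (auto simp: frame_def fun_eq_iff)
    ultimately obtain t tr where t: "exec lo vo (While ?cond ?body) (set_nat i 0 0 s) t tr" "bounded t"
      "length tr \<le> 50 * (1 + N * ?U)" "tame 50 tr" "Q t"
      using iter[of 0 "set_nat i 0 0 s"] init by auto
    have "N * ?U \<le> bound b * ?U" using N by (intro mult_right_mono) auto
    then have "length tr \<le> 50 * units bound (While ?cond ?body)" using t(3) by simp
    then show "\<exists>t tr. exec lo vo (While ?cond ?body) (set_nat i (nval s (NConst 0)) (nval s (NConst 0)) s) t tr \<and>
        bounded t \<and> length tr \<le> 50 * units bound (While ?cond ?body) \<and> tame 50 tr \<and> Q t"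
      using t by auto
  qed
qed simp

end

section \<open>The program\<close>

notation Seq (infixr ";;" 60)

abbreviation cell :: "nexp \<Rightarrow> nexp \<Rightarrow> nexp \<Rightarrow> nexp" where
  "cell i d c \<equiv> NAdd (NMul i d) c"

text \<open>
  Memory: \<open>W\<close> holds the lifted points, later their reduced vectors, row by row with row length \<open>d\<close>;
  \<open>S\<close> the marks; \<open>V\<close> a copy of the pivot vector, which is itself overwritten by the elimination;
  \<open>g\<close> the digits of the current code; \<open>cur\<close> the part of each element; \<open>sh\<close> and \<open>X\<close> the
  shape and the part sums that are sent to the oracles; \<open>out\<close> the best partition so far.
\<close>

definition lift_points :: com where
  "lift_points = For ''i'' ''n'' (
     RSet ''W'' (NMul (var ''i'') (var ''d'')) (RNat (NConst 1)) ;;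
     For ''c'' ''k'' (RSet ''W'' (cell (var ''i'') (var ''d'') (NAdd (var ''c'') (NConst 1)))
       (RGet ''A'' (cell (var ''i'') (var ''k'') (var ''c'')))) ;;
     RSet ''W'' (cell (var ''i'') (var ''d'') (var ''k1'')) (RNat (var ''i'')) ;;
     RSet ''S'' (var ''i'') (RNat (NConst 0)))"

definition decode :: com where
  "decode =
     NSet ''v'' (NConst 0) (NGet ''g'' (NAdd (var ''ptr'') (var ''j''))) ;;
     RSet ''D'' (NConst 0) (RNat (NConst 1)) ;;
     RSet ''E'' (NConst 0) (RNat (NConst 1)) ;;
     If (NLess (var ''v'') (NAdd (var ''n'') (var ''n''))) Skip
       (RSet ''E'' (NConst 0) (RSub (RNat (NConst 0)) (RNat (NConst 1))) ;;
        NSet ''v'' (NConst 0) (NSub (var ''v'') (NAdd (var ''n'') (var ''n'')))) ;;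
     If (NLess (var ''v'') (var ''n'')) Skip
       (RSet ''D'' (NConst 0) (RSub (RNat (NConst 0)) (RNat (NConst 1))) ;;
        NSet ''v'' (NConst 0) (NSub (var ''v'') (var ''n'')))"

definition eliminate :: com where
  "eliminate =
     For ''c'' ''d'' (RSet ''V'' (var ''c'') (RGet ''W'' (cell (var ''v'') (var ''d'') (var ''c'')))) ;;
     For ''i'' ''n'' (
       (let x = RGet ''W'' (cell (var ''i'') (var ''d'') (var ''j'')) in
          If (RLess (RNat (NConst 0)) (RMul x x)) (RSet ''S'' (var ''i'') (RMul (rvar ''D'') x)) Skip ;;
          RSet ''f'' (NConst 0) (RDiv x (RGet ''V'' (var ''j'')))) ;;
       For ''c'' ''d'' (
         RSet ''W'' (cell (var ''i'') (var ''d'') (var ''c''))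
           (RSub (RGet ''W'' (cell (var ''i'') (var ''d'') (var ''c'')))
             (RMul (rvar ''f'') (RGet ''V'' (var ''c''))))))"

text \<open>
  The square test is a test for being nonzero. The final coordinate overrides the marks, and then the elements
  whose champion is \<open>r\<close> and which lie on the negative side pass to \<open>s\<close>.
\<close>

definition settle :: com where
  "settle = For ''i'' ''n'' (
     (let x = RGet ''W'' (cell (var ''i'') (var ''d'') (var ''k1'')) in
        If (RLess (RNat (NConst 0)) (RMul x x)) (RSet ''S'' (var ''i'') (RMul (rvar ''E'') x)) Skip) ;;
     If (Conj (Neg (NLess (NGet ''cur'' (var ''i'')) (var ''r'')))
          (Conj (Neg (NLess (var ''r'') (NGet ''cur'' (var ''i''))))
            (RLess (RGet ''S'' (var ''i'')) (RNat (NConst 0)))))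
       (NSet ''cur'' (var ''i'') (var ''s'')) Skip)"

definition play_pair :: com where
  "play_pair = lift_points ;; For ''j'' ''k1'' (decode ;; eliminate) ;; settle ;;
     NSet ''ptr'' (NConst 0) (NAdd (var ''ptr'') (var ''k1''))"

definition play :: com where
  "play = For ''i'' ''n'' (NSet ''cur'' (var ''i'') (NConst 0)) ;;
     NSet ''ptr'' (NConst 0) (NConst 0) ;;
     For ''s'' ''p'' (For ''r'' ''s'' play_pair)"

definition evaluate :: com where
  "evaluate =
     For ''j'' ''p'' (NSet ''sh'' (var ''j'') (NConst 0) ;;
       For ''c'' ''k'' (RSet ''X'' (cell (var ''j'') (var ''k'') (var ''c'')) (RNat (NConst 0)))) ;;
     For ''i'' ''n'' (
       NSet ''sh'' (NGet ''cur'' (var ''i'')) (NAdd (NGet ''sh'' (NGet ''cur'' (var ''i''))) (NConst 1)) ;;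
       For ''c'' ''k'' (
         (let x = cell (NGet ''cur'' (var ''i'')) (var ''k'') (var ''c'') in
            RSet ''X'' x (RAdd (RGet ''X'' x) (RGet ''A'' (cell (var ''i'') (var ''k'') (var ''c'')))))))"

definition record_best :: com where
  "record_best =
     AskShape ''ans'' (NConst 0) ''sh'' (var ''p'') ;;
     If (NLess (NConst 0) (var ''ans''))
       (AskValue ''val'' (NConst 0) ''X'' (var ''k'') (var ''p'') ;;
        If (Conj (NLess (NConst 0) (var ''found'')) (Neg (RLess (rvar ''best'') (rvar ''val'')))) Skip
          (RSet ''best'' (NConst 0) (rvar ''val'') ;;
           NSet ''found'' (NConst 0) (NConst 1) ;;
           For ''i'' ''n'' (NSet ''out'' (var ''i'') (NGet ''cur'' (var ''i'')))))
       Skip"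

definition advance :: com where
  "advance = NSet ''carry'' (NConst 0) (NConst 1) ;;
     For ''j'' ''Q'' (If (NLess (NConst 0) (var ''carry''))
       (If (NLess (NAdd (NGet ''g'' (var ''j'')) (NConst 1)) (var ''R''))
          (NSet ''g'' (var ''j'') (NAdd (NGet ''g'' (var ''j'')) (NConst 1)) ;;
           NSet ''carry'' (NConst 0) (NConst 0))
          (NSet ''g'' (var ''j'') (NConst 0)))
       Skip)"

definition prepare :: com where
  "prepare =
     NSet ''k1'' (NConst 0) (NAdd (var ''k'') (NConst 1)) ;;
     NSet ''d'' (NConst 0) (NAdd (var ''k'') (NConst 2)) ;;
     NSet ''R'' (NConst 0) (NMul (NConst 4) (var ''n'')) ;;
     For ''s'' ''p'' (NSet ''Q'' (NConst 0) (NAdd (var ''Q'') (NMul (var ''s'') (var ''k1'')))) ;;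
     NSet ''T'' (NConst 0) (NConst 1) ;;
     For ''j'' ''Q'' (NSet ''T'' (NConst 0) (NMul (var ''T'') (var ''R'')))"

definition solver :: com where
  "solver = prepare ;; For ''t'' ''T'' (play ;; evaluate ;; record_best ;; advance)"

lemma small_solver: "small solver"
  by (simp add: solver_def prepare_def play_def evaluate_def record_best_def advance_def play_pair_def
      lift_points_def decode_def eliminate_def settle_def Let_def)

section \<open>Correctness of the program\<close>

lemma cell_eq_iff:
  fixes d :: nat
  assumes "c < d" "c' < d"
  shows "i * d + c = i' * d + c' \<longleftrightarrow> i = i' \<and> c = c'"
proof
  assume eq: "i * d + c = i' * d + c'"
  have "(i * d + c) div d = i" "(i' * d + c') div d = i'" using assms by simp_all
  then have "i = i'" using eq by simp
  then show "i = i' \<and> c = c'" using eq by simp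
qed simp

definition constants :: "string set" where
  "constants = {''n'', ''k'', ''p'', ''k1'', ''d'', ''R'', ''Q'', ''T''}"

definition part_sizes :: "nat \<Rightarrow> nat \<Rightarrow> (nat \<Rightarrow> nat) \<Rightarrow> nat list" where
  "part_sizes n p f = map (\<lambda>j. card {i. i < n \<and> f i = j}) [0..<p]"

definition part_sum_matrix :: "nat \<Rightarrow> nat \<Rightarrow> nat \<Rightarrow> (nat \<Rightarrow> nat \<Rightarrow> real) \<Rightarrow> (nat \<Rightarrow> nat) \<Rightarrow> real mat" where
  "part_sum_matrix n k p a f = mat k p (\<lambda>(c, j). \<Sum>i | i < n \<and> f i = j. a i c)"

lemma part_Suc: "{i. i < Suc m \<and> f i = j} =
    (if f m = j then insert m {i. i < m \<and> f i = j} else {i. i < m \<and> f i = j})"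
  by (auto simp: less_Suc_eq)

text \<open>
  The assumptions on \<open>bits_bound\<close> are those that keep every stored value admissible. The
  factor $5^d$ bounds the growth of the entries during the elimination.
\<close>

locale shaped_solver = machine P lo vo bits_bound width bound
  for P lo vo bits_bound width bound +
  fixes n k p d Q L0 :: nat and a :: "nat \<Rightarrow> nat \<Rightarrow> real"
  assumes d_def: "d = k + 2" and Q_def: "Q = (\<Sum>x<p. x) * (k + 1)"
    and n_pos: "0 < n" and p_pos: "0 < p"
    and size: "4 * n \<le> 2 ^ bits_bound" "k + 2 \<le> 2 ^ bits_bound" "p \<le> 2 ^ bits_bound"
      "Q \<le> 2 ^ bits_bound" "(4 * n) ^ Q \<le> 2 ^ bits_bound"
    and bound: "bound ''n'' = n" "bound ''k'' = k" "bound ''p'' = p" "bound ''s'' = p"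
      "bound ''k1'' = k + 1" "bound ''d'' = d" "bound ''Q'' = Q" "bound ''T'' = (4 * n) ^ Q"
    and lift_level: "\<And>i c. i < n \<Longrightarrow> c < d \<Longrightarrow> lift k a i c \<in> P L0"
    and L0: "1 \<le> L0" "5 ^ d * L0 \<le> bits_bound"
    and sum_level: "\<And>J c. J \<subseteq> {..<n} \<Longrightarrow> c < k \<Longrightarrow> (\<Sum>i\<in>J. a i c) \<in> P bits_bound"
    and answer_level: "\<And>f. (\<And>i. i < n \<Longrightarrow> f i < p) \<Longrightarrow> lo (part_sizes n p f) \<Longrightarrow>
      vo (part_sum_matrix n k p a f) \<in> P bits_bound"
    and width: "p \<le> width" "k * p \<le> width"
begin

definition inputs :: "state \<Rightarrow> bool" where
  "inputs s \<longleftrightarrow> nat_mem s ''n'' 0 = n \<and> nat_mem s ''k'' 0 = k \<and> nat_mem s ''p'' 0 = p \<and>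
     nat_mem s ''k1'' 0 = k + 1 \<and> nat_mem s ''d'' 0 = d \<and> nat_mem s ''R'' 0 = 4 * n \<and>
     nat_mem s ''Q'' 0 = Q \<and> nat_mem s ''T'' 0 = (4 * n) ^ Q \<and>
     (\<forall>i<n. \<forall>c<k. real_mem s ''A'' (i * k + c) = a i c)"

lemma inputs_frame:
  assumes "frame X Y s t" "inputs s" "X \<inter> constants = {}" "''A'' \<notin> Y"
  shows "inputs t"
proof -
  have "nat_mem t x = nat_mem s x" if "x \<in> constants" for x
    using assms(1,3) that unfolding frame_def by blast
  moreover have "real_mem t ''A'' = real_mem s ''A''" using assms unfolding frame_def by blast
  ultimately show ?thesis using assms(2) by (simp add: inputs_def constants_def)
qed

lemma inputs_set [simp]:
  "x \<notin> constants \<Longrightarrow> inputs (set_nat x i v s) = inputs s"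
  "x \<noteq> ''A'' \<Longrightarrow> inputs (set_real x i y s) = inputs s"
  by (auto simp: inputs_def constants_def)

lemma inputs_nat:
  assumes "inputs s"
  shows "nat_mem s ''n'' 0 = n" "nat_mem s ''k'' 0 = k" "nat_mem s ''p'' 0 = p"
     "nat_mem s ''k1'' 0 = Suc k" "nat_mem s ''d'' 0 = d" "nat_mem s ''R'' 0 = 4 * n"
     "nat_mem s ''Q'' 0 = Q" "nat_mem s ''T'' 0 = (4 * n) ^ Q"
  using assms by (simp_all add: inputs_def)

lemma inputs_A: "inputs s \<Longrightarrow> i < n \<Longrightarrow> c < k \<Longrightarrow> real_mem s ''A'' (i * k + c) = a i c"
  by (simp add: inputs_def)

lemma level_up: "x \<in> P l \<Longrightarrow> l \<le> bits_bound \<Longrightarrow> x \<in> P bits_bound"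
  using level_mono by blast

lemma small_nat_level: "m \<le> 1 \<Longrightarrow> real m \<in> P bits_bound"
  using level_nat[of m 0] level_up[of _ 0] by simp

lemma L0_le: "L0 \<le> bits_bound"
proof -
  have "L0 \<le> 5 ^ d * L0" by simp
  then show ?thesis using L0(2) by (rule le_trans)
qed

definition stores :: "state \<Rightarrow> (nat \<Rightarrow> nat \<Rightarrow> real) \<Rightarrow> bool" where
  "stores s w \<longleftrightarrow> (\<forall>i<n. \<forall>c<d. real_mem s ''W'' (i * d + c) = w i c)"

lemma run_lift_points:
  assumes inp: "inputs s"
  shows "run lift_points s (\<lambda>t. stores t (lift k a) \<and> (\<forall>i<n. real_mem t ''S'' i = 0))"
  unfolding lift_points_def
proof (rule run_For[where N = n and Inv = "\<lambda>m t. (\<forall>i<m. \<forall>c<d. real_mem t ''W'' (i * d + c) = lift k a i c) \<and>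
      (\<forall>i<m. real_mem t ''S'' i = 0)"], goal_cases)
  case (7 m t)
  have inp1: "inputs t" by (rule inputs_frame[OF 7(2) inp]) (simp_all add: constants_def)
  have d0: "0 < d" "Suc k < d" by (simp_all add: d_def)
  show ?case
  proof (rule run_Seq, rule run_RSet, goal_cases)
    case 1
    show ?case using small_nat_level[of 1] by simp
  next
    case 2
    show ?case
    proof (rule run_Seq, rule run_For[where N = k and Inv = "\<lambda>x u. \<forall>i c. c < d \<longrightarrow> (i < m \<or> i = m \<and> c \<le> x) \<longrightarrow>
        real_mem u ''W'' (i * d + c) = lift k a i c"], goal_cases)
      case 6
      show ?case using 7(4) cell_eq_iff[OF _ d0(1)] d0 by (auto simp: 7(3) inputs_nat[OF inp1] lift_def)
    next
      case (7 x u)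
      have inp2: "inputs u" by (rule inputs_frame[OF 7(2)]) (use inp1 in \<open>simp_all add: constants_def\<close>)
      have i2: "nat_mem u ''i'' 0 = m" using 7(2) \<open>nat_mem t ''i'' 0 = m\<close> by (simp add: frame_def)
      have lv: "a m x \<in> P bits_bound"
        using lift_level[of m "Suc x"] \<open>m < n\<close> 7(1) d_def level_up[OF _ L0_le] by (simp add: lift_def)
      show ?case
        using inputs_nat[OF inp2] inputs_A[OF inp2 \<open>m < n\<close> 7(1)] i2 7 \<open>m < n\<close> d0 lv
          cell_eq_iff[of _ d "Suc x"]
        by (intro run_RSet) (auto simp: lift_def le_Suc_eq)
    next
      case (8 u)
      have inp2: "inputs u" by (rule inputs_frame[OF 8(1)]) (use inp1 in \<open>simp_all add: constants_def\<close>)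
      have i2: "nat_mem u ''i'' 0 = m" using 8(1) \<open>nat_mem t ''i'' 0 = m\<close> by (simp add: frame_def)
      have S: "real_mem u ''S'' = real_mem t ''S''" using 8(1) by (simp add: frame_def fun_eq_iff)
      have lv: "real m \<in> P bits_bound"
        using lift_level[of m "Suc k"] \<open>m < n\<close> d0 level_up[OF _ L0_le] by (simp add: lift_def)
      show ?case
        using inputs_nat[OF inp2] i2 8 \<open>m < n\<close> d0 lv S 7(4) small_nat_level[of 0] cell_eq_iff[of _ d "Suc k"]
        by (intro run_Seq run_RSet) (auto simp: lift_def less_Suc_eq d_def)
    qed (simp_all add: inputs_nat[OF inp1] bound)
  qed
qed (use inp in \<open>simp_all add: inputs_nat bound stores_def\<close>)

lemma minus_one_level: "-1 \<in> P bits_bound"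
  using level_sub[of 0 0 1 0] level_nat[of 0 0] level_nat[of 1 0] level_up[of "-1" 1] bits_bound_pos
  by simp

lemma bounded_nat: "bounded s \<Longrightarrow> nat_mem s x i \<le> 2 ^ bits_bound"
  and bounded_real: "bounded s \<Longrightarrow> real_mem s x i \<in> P bits_bound"
  by (simp_all add: bounded_def)

lemma run_decode:
  assumes "inputs s" "nat_mem s ''g'' (nat_mem s ''ptr'' 0 + nat_mem s ''j'' 0) = x" "x < 4 * n"
  shows "run decode s (\<lambda>t. nat_mem t ''v'' 0 = pivot n x \<and> real_mem t ''D'' 0 = mark_sign n x \<and>
    real_mem t ''E'' 0 = last_sign n x)"
proof -
  have x: "y \<le> x \<Longrightarrow> y \<le> 2 ^ bits_bound" for y using assms(3) size(1) by linarith
  show ?thesis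
    unfolding decode_def
    by (intro run_Seq run_NSet run_RSet run_If run_Skip)
      (use assms x small_nat_level[of 1] minus_one_level in
        \<open>auto simp: inputs_nat[OF assms(1)] digit_decode[OF assms(3)]\<close>)
qed

lemma run_eliminate:
  assumes inp: "inputs s" and rows: "stores s w" and j: "nat_mem s ''j'' 0 = j" "j < d"
    and l: "nat_mem s ''v'' 0 = l" "l < n" and D: "real_mem s ''D'' 0 = D"
    and S: "\<And>i. i < n \<Longrightarrow> real_mem s ''S'' i = z i"
    and lv: "\<And>i. i < n \<Longrightarrow> w i j / w l j \<in> P bits_bound" "\<And>i. i < n \<Longrightarrow> D * w i j \<in> P bits_bound"
      "\<And>i c. i < n \<Longrightarrow> c < d \<Longrightarrow> w i c - w i j / w l j * w l c \<in> P bits_bound"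
  shows "run eliminate s (\<lambda>t. stores t (\<lambda>i c. w i c - w i j / w l j * w l c) \<and>
    (\<forall>i<n. real_mem t ''S'' i = (if w i j = 0 then z i else D * w i j)))"
  unfolding eliminate_def Let_def
proof (rule run_Seq, rule run_For[where N = d and Inv = "\<lambda>x u. \<forall>c<x. real_mem u ''V'' c = w l c"], goal_cases)
  case (7 x u)
  have inp2: "inputs u" by (rule inputs_frame[OF 7(2) inp]) (simp_all add: constants_def)
  have "real_mem u ''W'' = real_mem s ''W''" "nat_mem u ''v'' 0 = l"
    using 7(2) l by (auto simp: frame_def)
  moreover from this have "bounded u \<Longrightarrow> w l x \<in> P bits_bound"
    using bounded_real[of u "''W''" "l * d + x"] rows 7(1) l(2) by (simp add: stores_def)
  ultimately show ?case using rows 7 l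
    by (intro run_RSet) (auto simp: inputs_nat[OF inp2] stores_def less_Suc_eq)
next
  case (8 s')
  let ?w = "\<lambda>i c. w i c - w i j / w l j * w l c"
  have inp2: "inputs s'" by (rule inputs_frame[OF 8(1) inp]) (simp_all add: constants_def)
  have fr: "real_mem s' ''W'' = real_mem s ''W''" "real_mem s' ''S'' = real_mem s ''S''"
    "real_mem s' ''D'' 0 = D" "nat_mem s' ''j'' 0 = j"
    using 8(1) l j D by (auto simp: frame_def)
  show ?case
  proof (rule run_For[where N = n and Inv = "\<lambda>m u.
      (\<forall>i<n. \<forall>c<d. real_mem u ''W'' (i * d + c) = (if i < m then ?w i c else w i c)) \<and>
      (\<forall>i<n. real_mem u ''S'' i = (if i < m \<and> w i j \<noteq> 0 then D * w i j else z i))"], goal_cases)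
    case (7 m u)
    have inp3: "inputs u" by (rule inputs_frame[OF 7(2) inp2]) (simp_all add: constants_def)
    have fr3: "real_mem u ''V'' = real_mem s' ''V''" "real_mem u ''D'' 0 = D" "nat_mem u ''j'' 0 = j"
      using 7(2) fr by (auto simp: frame_def)
    note st = inputs_nat[OF inp3] fr3 7(3)
    have wj: "real_mem u ''W'' (m * d + j) = w m j" using 7(1,4) j(2) by simp
    have Vj: "real_mem s' ''V'' j = w l j" using 8(2) j(2) by simp
    show ?case
    proof (rule run_Seq, rule run_Seq, rule run_frame, rule run_If[where Q = "\<lambda>t. \<forall>i<n. real_mem t ''S'' i =
        (if i < Suc m \<and> w i j \<noteq> 0 then D * w i j else z i)"], goal_cases)
      case 1
      then show ?case using 7 lv(2)[of m]
        by (intro run_RSet) (auto simp: st wj less_Suc_eq)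
    next
      case 2
      then have "w m j = 0" by (simp add: st wj)
      then show ?case using 7 by (intro run_Skip) (auto simp: less_Suc_eq)
    next
      case (3 u1)
      have W1: "real_mem u1 ''W'' = real_mem u ''W''" "real_mem u1 ''V'' = real_mem s' ''V''"
        "nat_mem u1 = nat_mem u"
        using 3(1) fr3 by (auto simp: frame_def)
      have inp4: "inputs u1" by (rule inputs_frame[OF 3(1) inp3]) (simp_all add: constants_def)
      show ?case
      proof (rule run_RSet, goal_cases)
        case 1
        then show ?case using lv(1)[OF 7(1)] by (simp add: W1 st wj Vj)
      next
        case 2
        show ?case
        proof (rule run_For[where N = d and Inv = "\<lambda>x u2. \<forall>i<n. \<forall>c<d. real_mem u2 ''W'' (i * d + c) =
            (if i < m \<or> i = m \<and> c < x then ?w i c else w i c)"], goal_cases)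
          case 6
          then show ?case using 7(4) by (auto simp: W1)
        next
          case (7 x u2)
          have inp5: "inputs u2"
            by (rule inputs_frame[OF 7(2)]) (use inp4 in \<open>simp_all add: constants_def\<close>)
          have fr5: "real_mem u2 ''V'' = real_mem s' ''V''" "real_mem u2 ''f'' 0 = w m j / w l j"
            "nat_mem u2 ''i'' 0 = m"
            using 7(2) st by (auto simp: frame_def W1 wj Vj)
          show ?case using 7 8(2) \<open>m < n\<close> lv(3)[of m x]
            by (intro run_RSet) (auto simp: inputs_nat[OF inp5] fr5 cell_eq_iff[where d = d] less_Suc_eq)
        next
          case (8 u2)
          have "real_mem u2 ''S'' = real_mem u1 ''S''" using 8(1) by (auto simp: frame_def)
          then show ?case using 8(2) 3(2) by (auto simp: less_Suc_eq)
        qed (use inp4 in \<open>simp_all add: inputs_nat bound\<close>)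
      qed
    qed
  next
    case (8 u)
    then show ?case by (auto simp: stores_def)
  qed (use inp2 fr rows S in \<open>simp_all add: inputs_nat bound stores_def\<close>)
qed (use inp in \<open>simp_all add: inputs_nat bound\<close>)

lemma run_settle:
  assumes inp: "inputs s" and rows: "stores s w" and E: "real_mem s ''E'' 0 = E"
    and rq: "nat_mem s ''r'' 0 = r" "nat_mem s ''s'' 0 = q"
    and S: "\<And>i. i < n \<Longrightarrow> real_mem s ''S'' i = z i"
    and lv: "\<And>i. i < n \<Longrightarrow> E * w i (k + 1) \<in> P bits_bound"
  shows "run settle s (\<lambda>t. \<forall>i<n. nat_mem t ''cur'' i =
    (if nat_mem s ''cur'' i = r \<and> (if w i (k + 1) = 0 then z i else E * w i (k + 1)) < 0 then q
     else nat_mem s ''cur'' i))"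
proof -
  define lose where "lose i \<longleftrightarrow> nat_mem s ''cur'' i = r \<and> (if w i (k + 1) = 0 then z i else E * w i (k + 1)) < 0" for i
  show ?thesis
    unfolding settle_def Let_def lose_def[symmetric]
  proof (rule run_For[where N = n and Inv = "\<lambda>m u. (\<forall>i<n. nat_mem u ''cur'' i =
      (if i < m \<and> lose i then q else nat_mem s ''cur'' i)) \<and>
      (\<forall>i<n. m \<le> i \<longrightarrow> real_mem u ''S'' i = z i)"], goal_cases)
    case (7 m u)
    have inp2: "inputs u" by (rule inputs_frame[OF 7(2) inp]) (simp_all add: constants_def)
    have fr: "real_mem u ''W'' = real_mem s ''W''" "real_mem u ''E'' 0 = E" "nat_mem u ''r'' 0 = r"
      "nat_mem u ''s'' 0 = q"
      using 7(2) E rq by (auto simp: frame_def)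
    note st = inputs_nat[OF inp2] fr 7(3)
    have "Suc k < d" by (simp add: d_def)
    then have "real_mem s ''W'' (m * d + Suc k) = w m (Suc k)" using rows 7(1) unfolding stores_def by blast
    then have wk: "real_mem s ''W'' (Suc (m * d + k)) = w m (Suc k)" by simp
    show ?case
    proof (rule run_Seq, rule run_frame, rule run_If[where Q = "\<lambda>t. (\<forall>i<n. Suc m \<le> i \<longrightarrow> real_mem t ''S'' i = z i) \<and>
        real_mem t ''S'' m = (if w m (k + 1) = 0 then z m else E * w m (k + 1))"], goal_cases)
      case 1
      then show ?case using 7 lv[of m] by (intro run_RSet) (auto simp: st wk)
    next
      case 2
      then have "w m (Suc k) = 0" by (simp add: st wk)
      then show ?case using 7 by (intro run_Skip) auto
    next
      case (3 u1)
      have fr4: "nat_mem u1 = nat_mem u" using 3(1) by (auto simp: frame_def)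
      have cur: "nat_mem u ''cur'' m = nat_mem s ''cur'' m" using 7(1,4) by simp
      have "real_mem u1 ''S'' m < 0 \<longleftrightarrow> (if w m (k + 1) = 0 then z m else E * w m (k + 1)) < 0"
        using 3(2) by simp
      then have lose: "nat_mem s ''cur'' m = r \<and> real_mem u1 ''S'' m < 0 \<longleftrightarrow> lose m"
        by (simp only: lose_def)
      show ?case
      proof (rule run_If, goal_cases)
        case 1
        then have "nat_mem s ''cur'' m = r \<and> real_mem u1 ''S'' m < 0" by (simp add: st fr4 cur)
        then have "lose m" using lose by simp
        moreover have "bounded u1 \<Longrightarrow> q \<le> 2 ^ bits_bound"
          using bounded_nat[of u1 "''s''" 0] by (simp add: st fr4)
        ultimately show ?case using 3(2) 7(4)
          by (intro run_NSet) (auto simp: st fr4 less_Suc_eq)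
      next
        case 2
        then have "\<not> (nat_mem s ''cur'' m = r \<and> real_mem u1 ''S'' m < 0)" by (auto simp: st fr4 cur)
        then have "\<not> lose m" using lose by simp
        then show ?case using 3(2) 7(4)
          by (intro run_Skip) (auto simp: st fr4 less_Suc_eq)
      qed
    qed
  qed (use inp S in \<open>simp_all add: inputs_nat bound\<close>)
qed

text \<open>
  One step computes $x - y / z \<cdot> u$ from four entries of level $l$, which gives level
  $4l + 1 \<le> 5l$.
\<close>

lemma reduced_level:
  assumes L: "\<And>x. L x < n" and "i < n" "c < d" "j < d"
  shows "reduced L (lift k a) j i c \<in> P (5 ^ j * L0)"
  using assms(2-)
proof (induction j arbitrary: i c)
  case 0
  then show ?case using lift_level by simp
next
  case (Suc j)
  let ?l = "5 ^ j * L0"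
  have "reduced L (lift k a) (Suc j) i c \<in> P (?l + ((?l + ?l) + ?l) + 1)"
    unfolding reduced.simps
    using Suc L by (intro level_sub level_mult level_div) auto
  moreover have "1 \<le> ?l" using L0(1) by simp
  ultimately show ?case
    using level_mono[of "?l + ((?l + ?l) + ?l) + 1" "5 ^ Suc j * L0"] by auto
qed

lemma run_play_pair:
  assumes inp: "inputs s" and rq: "nat_mem s ''r'' 0 = r" "nat_mem s ''s'' 0 = q"
    and ptr: "nat_mem s ''ptr'' 0 + (k + 1) \<le> Q"
    and v: "\<And>j. j < k + 1 \<Longrightarrow> v j = nat_mem s ''g'' (nat_mem s ''ptr'' 0 + j)"
      "\<And>j. j < k + 1 \<Longrightarrow> v j < 4 * n"
  shows "run play_pair s (\<lambda>t. (\<forall>i<n. nat_mem t ''cur'' i =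
      (if nat_mem s ''cur'' i = r \<and> loses k n (lift k a) v i then q else nat_mem s ''cur'' i)) \<and>
    nat_mem t ''ptr'' 0 = nat_mem s ''ptr'' 0 + (k + 1))"
  unfolding play_pair_def
proof (rule run_Seq, rule run_frame[OF run_lift_points[OF inp]], goal_cases)
  case (1 s1)
  define L where "L j = pivot n (v j)" for j
  define D where "D j = mark_sign n (v j)" for j
  let ?w = "lift k a"
  have Ln: "L x < n" for x using n_pos by (simp add: L_def pivot_def)
  have inp1: "inputs s1" by (rule inputs_frame[OF 1(1) inp]) (simp_all add: constants_def lift_points_def)
  have fr1: "nat_mem s1 ''r'' 0 = r" "nat_mem s1 ''s'' 0 = q" "nat_mem s1 ''cur'' = nat_mem s ''cur''"
    "nat_mem s1 ''g'' = nat_mem s ''g''" "nat_mem s1 ''ptr'' = nat_mem s ''ptr''"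
    using 1(1) rq by (simp_all add: frame_def lift_points_def)
  have sg: "D x = 1 \<or> D x = -1" for x by (simp add: D_def mark_sign_def)
  have pow: "5 ^ x * L0 \<le> 5 ^ d * L0" if "x \<le> d" for x
    using that by (intro mult_right_mono power_increasing) auto
  have pow_up: "5 ^ x * L0 \<le> bits_bound" if "x \<le> d" for x
    using pow[OF that] L0(2) by linarith
  have lev: "reduced L ?w j i c \<in> P (5 ^ j * L0)" if "i < n" "c < d" "j \<le> k + 1" for i c j
    by (rule reduced_level[OF Ln]) (use that in \<open>simp_all add: d_def\<close>)
  have signed: "e * reduced L ?w j i c \<in> P bits_bound"
    if "e = 1 \<or> e = -1" "i < n" "c < d" "j \<le> k + 1" for e i c j
  proof -
    have e: "e \<in> P 1" using that(1) level_nat[of 1 1] level_sub[of 0 0 1 0] level_nat[of 0 0] level_nat[of 1 0]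
      by auto
    have "1 + 5 ^ j * L0 \<le> 5 ^ Suc j * L0" using L0(1) by simp
    also have "\<dots> \<le> bits_bound" using pow_up[of "Suc j"] that(4) by (simp add: d_def)
    finally show ?thesis by (rule level_up[OF level_mult[OF e lev[OF that(2-4)]]])
  qed
  have ratio: "reduced L ?w j i c / reduced L ?w j l c \<in> P bits_bound"
    if "i < n" "l < n" "c < d" "j < k + 1" for i l c j
  proof -
    have "5 ^ j * L0 + 5 ^ j * L0 \<le> 5 ^ Suc j * L0" by simp
    also have "\<dots> \<le> bits_bound" using pow_up[of "Suc j"] that(4) by (simp add: d_def)
    finally show ?thesis
      by (rule level_up[OF level_div[OF lev[OF that(1,3)] lev[OF that(2,3)]], rotated 2])
        (use that(4) in auto)
  qed
  show ?case
  proof (rule run_Seq, rule run_For[where N = "k + 1" and Inv = "\<lambda>j u. stores u (reduced L ?w j) \<and>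
      (\<forall>i<n. real_mem u ''S'' i = mark L D ?w j i) \<and> (0 < j \<longrightarrow> real_mem u ''E'' 0 = last_sign n (v (j - 1)))"],
      goal_cases)
    case 6
    then show ?case using 1(2) by (simp add: stores_def)
  next
    case (7 j u)
    have inp2: "inputs u"
      by (rule inputs_frame[OF 7(2) inp1]) (simp_all add: constants_def decode_def eliminate_def Let_def)
    have fr2: "nat_mem u ''g'' = nat_mem s ''g''" "nat_mem u ''ptr'' = nat_mem s ''ptr''"
      using 7(2) fr1 by (simp_all add: frame_def decode_def eliminate_def Let_def)
    have dig: "nat_mem u ''g'' (nat_mem u ''ptr'' 0 + nat_mem u ''j'' 0) = v j"
      using v(1)[OF 7(1)] by (simp add: fr2 7(3))
    have jd: "j < d" using 7(1) by (simp add: d_def)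
    show ?case
    proof (rule run_Seq, rule run_frame[OF run_decode[OF inp2 dig v(2)[OF 7(1)]]], goal_cases)
      case (1 u1)
      have inp3: "inputs u1" by (rule inputs_frame[OF 1(1) inp2]) (simp_all add: constants_def decode_def)
      have fr3: "real_mem u1 ''W'' = real_mem u ''W''" "real_mem u1 ''S'' = real_mem u ''S''"
        "nat_mem u1 ''j'' 0 = j"
        using 1(1) 7(3) by (simp_all add: frame_def decode_def)
      have step: "reduced L ?w j i c - reduced L ?w j i j / reduced L ?w j (pivot n (v j)) j *
          reduced L ?w j (pivot n (v j)) c = reduced L ?w (Suc j) i c" for i c
        by (simp add: L_def)
      have rows3: "stores u1 (reduced L ?w j)" using 7(4) fr3 by (simp add: stores_def)
      have S3: "real_mem u1 ''S'' i = mark L D ?w j i" if "i < n" for i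
        using 7(4) fr3 that by simp
      have v3: "nat_mem u1 ''v'' 0 = pivot n (v j)" and D3: "real_mem u1 ''D'' 0 = D j"
        and E3: "real_mem u1 ''E'' 0 = last_sign n (v j)"
        using 1(2) by (simp_all add: D_def)
      have lv1: "reduced L ?w j i j / reduced L ?w j (pivot n (v j)) j \<in> P bits_bound" if "i < n" for i
        using ratio[OF that Ln[of j] jd 7(1)] by (simp add: L_def)
      have lv2: "D j * reduced L ?w j i j \<in> P bits_bound" if "i < n" for i
        using signed[OF sg that jd] 7(1) by simp
      have lv3: "reduced L ?w j i c - reduced L ?w j i j / reduced L ?w j (pivot n (v j)) j *
          reduced L ?w j (pivot n (v j)) c \<in> P bits_bound" if "i < n" "c < d" for i c
        unfolding step using level_up[OF lev[OF that, of "Suc j"] pow_up] 7(1) jd by simp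
      have "run eliminate u1 (\<lambda>t. stores t (\<lambda>i c. reduced L ?w j i c - reduced L ?w j i j /
          reduced L ?w j (pivot n (v j)) j * reduced L ?w j (pivot n (v j)) c) \<and>
          (\<forall>i<n. real_mem t ''S'' i = (if reduced L ?w j i j = 0 then mark L D ?w j i
            else D j * reduced L ?w j i j)))"
        by (rule run_eliminate[OF inp3 rows3 fr3(3) jd v3 Ln[of j, unfolded L_def] D3 S3 lv1 lv2 lv3])
      then show ?case
      proof (rule run_frame, goal_cases)
        case (1 t)
        have "real_mem t ''E'' = real_mem u1 ''E''"
          using 1(1) by (simp add: frame_def eliminate_def Let_def)
        then show ?case using 1(2) E3 unfolding step by (simp add: stores_def D_def)
      qed
    qed
  next
    case (8 u)
    have inp2: "inputs u"
      by (rule inputs_frame[OF 8(1) inp1]) (simp_all add: constants_def decode_def eliminate_def Let_def)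
    have fr2: "nat_mem u ''r'' 0 = r" "nat_mem u ''s'' 0 = q" "nat_mem u ''cur'' = nat_mem s ''cur''"
      "nat_mem u ''ptr'' = nat_mem s ''ptr''"
      using 8(1) fr1 by (simp_all add: frame_def decode_def eliminate_def Let_def)
    have E: "real_mem u ''E'' 0 = last_sign n (v k)" using 8(2) by simp
    have lE: "last_sign n (v k) = 1 \<or> last_sign n (v k) = -1" by (simp add: last_sign_def)
    show ?case
    proof (rule run_Seq, rule run_frame[OF run_settle[where w = "reduced L ?w (k + 1)" and z = "mark L D ?w (k + 1)",
          OF inp2 _ E fr2(1,2)]], goal_cases)
      case (3 i)
      then show ?case by (intro signed[OF lE]) (simp_all add: d_def)
    next
      case (4 t)
      have inp3: "inputs t" by (rule inputs_frame[OF 4(1) inp2]) (simp_all add: constants_def settle_def Let_def)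
      have ptr': "nat_mem t ''ptr'' 0 = nat_mem s ''ptr'' 0"
        using 4(1) fr2 by (simp add: frame_def settle_def Let_def)
      have "loses k n ?w v i \<longleftrightarrow> (if reduced L ?w (k + 1) i (k + 1) = 0 then mark L D ?w (k + 1) i
          else last_sign n (v k) * reduced L ?w (k + 1) i (k + 1)) < 0" for i
        unfolding loses_def side_def L_def D_def by (rule refl)
      then show ?case using 4(2) ptr size(4) fr2(3)
        by (intro run_NSet) (auto simp: inputs_nat[OF inp3] ptr')
    qed (use 8 in auto)
  qed (use inp1 in \<open>simp_all add: inputs_nat bound decode_def eliminate_def Let_def\<close>)
qed

lemma play_pair_writes:
  "nat_writes play_pair = {''i'', ''c'', ''j'', ''v'', ''cur'', ''ptr''}"
  "real_writes play_pair = {''W'', ''S'', ''D'', ''E'', ''V'', ''f''}"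
  by (auto simp: play_pair_def lift_points_def decode_def eliminate_def settle_def Let_def)

lemma run_play:
  assumes inp: "inputs s" and g: "\<And>j. j < Q \<Longrightarrow> nat_mem s ''g'' j = g j" "\<And>j. j < Q \<Longrightarrow> g j < 4 * n"
  shows "run play s (\<lambda>t. \<forall>i<n. nat_mem t ''cur'' i = candidate k n p (lift k a) g i)"
  unfolding play_def
proof (rule run_Seq, rule run_For[where N = n and Inv = "\<lambda>m u. \<forall>i<m. nat_mem u ''cur'' i = 0"], goal_cases)
  case (7 m u)
  then show ?case by (intro run_NSet) (auto simp: less_Suc_eq)
next
  case (8 s1)
  define beaten where "beaten r q i = loses k n (lift k a) (\<lambda>j. g (offset k r q + j)) i" for r q i
  have inp1: "inputs s1" by (rule inputs_frame[OF 8(1) inp]) (simp_all add: constants_def)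
  have g1: "nat_mem s1 ''g'' = nat_mem s ''g''" using 8(1) by (simp add: frame_def)
  let ?s2 = "set_nat ''ptr'' 0 0 s1"
  show ?case
  proof (rule run_Seq, rule run_NSet, goal_cases)
    case 2
    have "run (For ''s'' ''p'' (For ''r'' ''s'' play_pair)) ?s2
      (\<lambda>t. \<forall>i<n. nat_mem t ''cur'' i = candidate k n p (lift k a) g i)"
    proof (rule run_For[where N = p and Inv = "\<lambda>q u. (\<forall>i<n. nat_mem u ''cur'' i = tournament beaten q i) \<and>
        nat_mem u ''ptr'' 0 = offset k 0 q"], goal_cases)
      case 6
      then show ?case using 8(2) by (simp add: offset_def)
    next
      case (7 q u)
      have inp2: "inputs u"
        by (rule inputs_frame[OF 7(2)]) (use inp1 in \<open>simp_all add: constants_def play_pair_writes\<close>)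
      have g2: "nat_mem u ''g'' = nat_mem s ''g''"
        using 7(2) g1 by (simp add: frame_def play_pair_writes)
      show ?case
      proof (rule run_For[where N = q and Inv = "\<lambda>r u. (\<forall>i<n. nat_mem u ''cur'' i =
          duel beaten q r (tournament beaten q) i) \<and> nat_mem u ''ptr'' 0 = offset k r q"], goal_cases)
        case 6
        then show ?case using 7(4) by simp
      next
        case (7 r u1)
        have inp3: "inputs u1"
          by (rule inputs_frame[OF 7(2)]) (use inp2 in \<open>simp_all add: constants_def play_pair_writes\<close>)
        have g3: "nat_mem u1 ''g'' = nat_mem s ''g''" and s3: "nat_mem u1 ''s'' 0 = q"
          using 7(2) g2 \<open>nat_mem u ''s'' 0 = q\<close> by (simp_all add: frame_def play_pair_writes)
        have less: "offset k r q + j < Q" if "j < k + 1" for j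
          unfolding Q_def by (rule offset_less) (use 7(1) \<open>q < p\<close> that in auto)
        show ?case
        proof (rule run_frame[OF run_play_pair[where v = "\<lambda>j. g (offset k r q + j)", OF inp3 7(3) s3]], goal_cases)
          case 1
          then show ?case using less[of k] 7(4) by simp
        next
          case (2 j)
          then show ?case using less[of j] g 7(4) g3 by simp
        next
          case (3 j)
          then show ?case using less[of j] g by simp
        next
          case (4 t)
          then show ?case using 7(4) by (simp add: beaten_def offset_def algebra_simps)
        qed
      next
        case (8 u1)
        then show ?case by (simp add: offset_def)
      qed (use inp2 7 in \<open>simp_all add: inputs_nat bound play_pair_writes\<close>)
    next
      case (8 u)
      then show ?case by (simp add: candidate_def beaten_def[abs_def])
    qed (use inp1 in \<open>simp_all add: inputs_nat bound play_pair_writes\<close>)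
    then show ?case by simp
  qed simp
qed (use inp in \<open>simp_all add: inputs_nat bound\<close>)

lemma run_evaluate:
  assumes inp: "inputs s" and f: "\<And>i. i < n \<Longrightarrow> nat_mem s ''cur'' i = f i" "\<And>i. i < n \<Longrightarrow> f i < p"
  shows "run evaluate s (\<lambda>t. (\<forall>j<p. nat_mem t ''sh'' j = card {i. i < n \<and> f i = j}) \<and>
    (\<forall>j<p. \<forall>c<k. real_mem t ''X'' (j * k + c) = (\<Sum>i | i < n \<and> f i = j. a i c)))"
  unfolding evaluate_def Let_def
proof (rule run_Seq, rule run_For[where N = p and Inv = "\<lambda>m u. (\<forall>j<m. nat_mem u ''sh'' j = 0) \<and>
    (\<forall>j<m. \<forall>c<k. real_mem u ''X'' (j * k + c) = 0)"], goal_cases)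
  case (7 m u)
  have inp1: "inputs u" by (rule inputs_frame[OF 7(2) inp]) (simp_all add: constants_def)
  let ?u = "set_nat ''sh'' m 0 u"
  have "run (For ''c'' ''k'' (RSet ''X'' (cell (var ''j'') (var ''k'') (var ''c'')) (RNat (NConst 0)))) ?u
    (\<lambda>t'. (\<forall>j<Suc m. nat_mem t' ''sh'' j = 0) \<and> (\<forall>j<Suc m. \<forall>c<k. real_mem t' ''X'' (j * k + c) = 0))"
  proof (rule run_For[where N = k and Inv = "\<lambda>x u. \<forall>j c. c < k \<longrightarrow> (j < m \<or> j = m \<and> c < x) \<longrightarrow>
      real_mem u ''X'' (j * k + c) = 0"], goal_cases)
    case 6
    then show ?case using 7(4) by auto
  next
    case (7 x u2)
    have inp2: "inputs u2"
      by (rule inputs_frame[OF 7(2)]) (use inp1 in \<open>simp_all add: constants_def\<close>)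
    have j2: "nat_mem u2 ''j'' 0 = m" using 7(2) \<open>nat_mem u ''j'' 0 = m\<close> by (simp add: frame_def)
    show ?case using 7 small_nat_level[of 0]
      by (intro run_RSet) (auto simp: inputs_nat[OF inp2] j2 cell_eq_iff[where d = k] less_Suc_eq)
  next
    case (8 u2)
    have "nat_mem u2 ''sh'' = nat_mem ?u ''sh''" using 8(1) by (simp add: frame_def)
    then show ?case using 8(2) 7(4) by (auto simp: less_Suc_eq)
  qed (use inp1 in \<open>simp_all add: inputs_nat bound\<close>)
  then show ?case by (intro run_Seq run_NSet) (use 7(3) in simp_all)
next
  case (8 s1)
  have inp1: "inputs s1" by (rule inputs_frame[OF 8(1) inp]) (simp_all add: constants_def)
  have cur1: "nat_mem s1 ''cur'' = nat_mem s ''cur''" using 8(1) by (simp add: frame_def)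
  let ?x = "\<lambda>m j c. \<Sum>i | i < m \<and> f i = j. a i c"
  have fin: "finite {i. i < m \<and> f i = j}" for m j by simp
  have x_Suc: "?x (Suc m) j c = (if f m = j then ?x m j c + a m c else ?x m j c)" for m j c
    by (simp add: part_Suc sum.insert_if)
  have x_level: "?x m j c \<in> P bits_bound" if "m \<le> n" "c < k" for m j c
    by (rule sum_level) (use that in auto)
  show ?case
  proof (rule run_For[where N = n and Inv = "\<lambda>m u. (\<forall>j<p. nat_mem u ''sh'' j = card {i. i < m \<and> f i = j}) \<and>
      (\<forall>j<p. \<forall>c<k. real_mem u ''X'' (j * k + c) = ?x m j c)"], goal_cases)
    case 6
    then show ?case using 8(2) by simp
  next
    case (7 m u)
    have inp2: "inputs u" by (rule inputs_frame[OF 7(2) inp1]) (simp_all add: constants_def)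
    have cur2: "nat_mem u ''cur'' m = f m" using 7(1,2) cur1 f by (simp add: frame_def)
    note st = inputs_nat[OF inp2] cur2 7(3)
    let ?u = "set_nat ''sh'' (f m) (Suc (nat_mem u ''sh'' (f m))) u"
    have shm: "nat_mem u ''sh'' (f m) = card {i. i < m \<and> f i = f m}" using 7 f by simp
    have "card {i. i < m \<and> f i = f m} \<le> card {..<m}" by (rule card_mono) auto
    then have "Suc (nat_mem u ''sh'' (f m)) \<le> 2 ^ bits_bound" using shm 7(1) size(1) by simp
    moreover have "run (For ''c'' ''k'' (RSet ''X'' (cell (NGet ''cur'' (var ''i'')) (var ''k'') (var ''c''))
        (RAdd (RGet ''X'' (cell (NGet ''cur'' (var ''i'')) (var ''k'') (var ''c'')))
          (RGet ''A'' (cell (var ''i'') (var ''k'') (var ''c'')))))) ?u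
      (\<lambda>t'. (\<forall>j<p. nat_mem t' ''sh'' j = card {i. i < Suc m \<and> f i = j}) \<and>
        (\<forall>j<p. \<forall>c<k. real_mem t' ''X'' (j * k + c) = ?x (Suc m) j c))"
    proof (rule run_For[where N = k and Inv = "\<lambda>y u. \<forall>j<p. \<forall>c<k. real_mem u ''X'' (j * k + c) =
        (if c < y then ?x (Suc m) j c else ?x m j c)"], goal_cases)
      case 6
      then show ?case using 7(4) by auto
    next
      case (7 y u2)
      have inp3: "inputs u2"
        by (rule inputs_frame[OF 7(2)]) (use inp2 in \<open>simp_all add: constants_def\<close>)
      have st2: "nat_mem u2 ''i'' 0 = m" "nat_mem u2 ''cur'' m = f m"
        using 7(2) st by (simp_all add: frame_def)
      have X: "real_mem u2 ''X'' (f m * k + y) = ?x m (f m) y" using 7(1,4) f(2)[OF \<open>m < n\<close>] by simp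
      have new: "?x m (f m) y + a m y = ?x (Suc m) (f m) y" by (simp add: x_Suc)
      show ?case
      proof (rule run_RSet, goal_cases)
        case 1
        show ?case using x_level[of "Suc m" y "f m"] 7(1) \<open>m < n\<close> new
          by (simp add: inputs_nat[OF inp3] st2 7(3) X inputs_A[OF inp3])
      next
        case 2
        have "?x (Suc m) j c = ?x m j c" if "j \<noteq> f m" for j c using that by (simp add: x_Suc)
        then show ?case using 7(1,4) new \<open>m < n\<close>
          by (auto simp: inputs_nat[OF inp3] st2 7(3) X inputs_A[OF inp3] cell_eq_iff[where d = k]
              less_Suc_eq[where n = y])
      qed
    next
      case (8 u2)
      have "nat_mem u2 ''sh'' = nat_mem ?u ''sh''" using 8(1) by (simp add: frame_def)
      then show ?case using 8(2) 7(4) shm by (auto simp: part_Suc)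
    qed (use inp2 in \<open>simp_all add: inputs_nat bound\<close>)
    ultimately show ?case by (intro run_Seq run_NSet) (simp_all add: st)
  next
    case (8 u)
    then show ?case by simp
  qed (use inp1 in \<open>simp_all add: inputs_nat bound\<close>)
qed (use inp in \<open>simp_all add: inputs_nat bound\<close>)

abbreviation accepted :: "(nat \<Rightarrow> nat) \<Rightarrow> bool" where
  "accepted f \<equiv> lo (part_sizes n p f)"

abbreviation objective :: "(nat \<Rightarrow> nat) \<Rightarrow> real" where
  "objective f \<equiv> vo (part_sum_matrix n k p a f)"

text \<open>
  The output array records some assignment $u$, not necessarily a member of $F$ as a function, because
  assignments matter only below $n$.
\<close>

definition best_among :: "(nat \<Rightarrow> nat) set \<Rightarrow> state \<Rightarrow> bool" where
  "best_among F s \<longleftrightarrow> (if nat_mem s ''found'' 0 = 0 then \<forall>f\<in>F. \<not> accepted f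
     else \<exists>u. (\<forall>i<n. nat_mem s ''out'' i = u i \<and> u i < p) \<and> accepted u \<and> real_mem s ''best'' 0 = objective u \<and>
       (\<forall>f\<in>F. accepted f \<longrightarrow> objective f \<le> objective u))"

lemma best_among_cong:
  "nat_mem t ''found'' = nat_mem s ''found'' \<Longrightarrow> nat_mem t ''out'' = nat_mem s ''out'' \<Longrightarrow>
    real_mem t ''best'' = real_mem s ''best'' \<Longrightarrow> best_among F t = best_among F s"
  by (simp only: best_among_def)

lemma run_record_best:
  assumes inp: "inputs s" and best: "best_among F s"
    and f: "\<And>i. i < n \<Longrightarrow> nat_mem s ''cur'' i = f i" "\<And>i. i < n \<Longrightarrow> f i < p"
    and sh: "\<And>j. j < p \<Longrightarrow> nat_mem s ''sh'' j = card {i. i < n \<and> f i = j}"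
    and X: "\<And>j c. j < p \<Longrightarrow> c < k \<Longrightarrow> real_mem s ''X'' (j * k + c) = (\<Sum>i | i < n \<and> f i = j. a i c)"
  shows "run record_best s (best_among (insert f F))"
proof -
  have tup: "read_tuple s ''sh'' p = part_sizes n p f"
    using sh by (simp add: read_tuple_def part_sizes_def)
  have mat: "read_mat s ''X'' k p = part_sum_matrix n k p a f"
    using X by (intro eq_matI) (auto simp: read_mat_def part_sum_matrix_def)
  let ?s1 = "set_nat ''ans'' 0 (of_bool (accepted f)) s"
  have best1: "best_among F ?s1" using best by (simp add: best_among_def)
  have mat1: "read_mat (set_nat x i v s) ''X'' k p = part_sum_matrix n k p a f" for x i v
    using mat by (simp add: read_mat_def)
  have answer: "accepted f \<Longrightarrow> objective f \<in> P bits_bound" using answer_level[of f] f(2) by blast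
  note st = inputs_nat[OF inp]
  have *: "run (If (NLess (NConst 0) (var ''ans''))
       (AskValue ''val'' (NConst 0) ''X'' (var ''k'') (var ''p'') ;;
        If (Conj (NLess (NConst 0) (var ''found'')) (Neg (RLess (rvar ''best'') (rvar ''val'')))) Skip
          (RSet ''best'' (NConst 0) (rvar ''val'') ;;
           NSet ''found'' (NConst 0) (NConst 1) ;;
           For ''i'' ''n'' (NSet ''out'' (var ''i'') (NGet ''cur'' (var ''i'')))))
       Skip) ?s1 (best_among (insert f F))"
  proof (rule run_If, rule run_Seq, rule run_AskValue, goal_cases)
    case 1
    then show ?case using width(2) by (simp add: st)
  next
    case 2
    then show ?case using answer by (simp add: st mat1)
  next
    case 3
    then have acc: "accepted f" by simp
    let ?s2 = "set_real ''val'' 0 (objective f) ?s1"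
    have best2: "best_among F ?s2" using best by (simp add: best_among_def)
    have "run (If (Conj (NLess (NConst 0) (var ''found'')) (Neg (RLess (rvar ''best'') (rvar ''val'')))) Skip
          (RSet ''best'' (NConst 0) (rvar ''val'') ;;
           NSet ''found'' (NConst 0) (NConst 1) ;;
           For ''i'' ''n'' (NSet ''out'' (var ''i'') (NGet ''cur'' (var ''i''))))) ?s2 (best_among (insert f F))"
    proof (rule run_If, goal_cases)
      case 1
      then show ?case using best2 by (intro run_Skip) (auto simp: best_among_def)
    next
      case 2
      have better: "objective h \<le> objective f" if "h \<in> F" "accepted h" for h
        using 2 best that by (force simp: best_among_def split: if_splits)
      let ?s3 = "set_nat ''found'' 0 1 (set_real ''best'' 0 (objective f) ?s2)"
      have "run (For ''i'' ''n'' (NSet ''out'' (var ''i'') (NGet ''cur'' (var ''i'')))) ?s3 (best_among (insert f F))"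
      proof (rule run_For[where N = n and Inv = "\<lambda>m u. \<forall>i<m. nat_mem u ''out'' i = f i"], goal_cases)
        case (7 m u)
        have "nat_mem u ''cur'' = nat_mem s ''cur''" using 7(2) by (simp add: frame_def fun_eq_iff)
        then show ?case using 7 f bounded_nat[of u "''cur''" m]
          by (intro run_NSet) (auto simp: less_Suc_eq)
      next
        case (8 u)
        have "nat_mem u ''found'' 0 = 1" "real_mem u ''best'' 0 = objective f"
          using 8(1) by (simp_all add: frame_def)
        then show ?case using 8(2) acc better f(2) unfolding best_among_def by auto
      qed (use inp in \<open>simp_all add: inputs_nat bound\<close>)
      then show ?case using answer acc
        by (intro run_Seq run_RSet run_NSet) auto
    qed
    then show ?case by (simp add: st mat1)
  next
    case 4
    then have "\<not> accepted f" by simp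
    then show ?case using best1 by (intro run_Skip) (auto simp: best_among_def)
  qed
  show ?thesis unfolding record_best_def
    using * width(1) by (intro run_Seq run_AskShape) (simp_all add: inputs_nat[OF inp] tup)
qed

text \<open>
  The carry entering position $m$ is 1 exactly if $(4n)^m$ divides the new number.
\<close>

lemma run_advance:
  assumes inp: "inputs s" and g: "\<And>j. j < Q \<Longrightarrow> nat_mem s ''g'' j = digit (4 * n) t j"
  shows "run advance s (\<lambda>u. \<forall>j<Q. nat_mem u ''g'' j = digit (4 * n) (Suc t) j)"
  unfolding advance_def
proof (rule run_Seq, rule run_NSet, goal_cases)
  case 2
  let ?s = "set_nat ''carry'' 0 1 s"
  have inp0: "inputs ?s" using inp by (simp add: constants_def)
  have R: "0 < 4 * n" using n_pos by simp
  have dig: "digit (4 * n) t j < 4 * n" for j using R by (simp add: digit_def)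
  have "run (For ''j'' ''Q'' (If (NLess (NConst 0) (var ''carry''))
       (If (NLess (NAdd (NGet ''g'' (var ''j'')) (NConst 1)) (var ''R''))
          (NSet ''g'' (var ''j'') (NAdd (NGet ''g'' (var ''j'')) (NConst 1)) ;;
           NSet ''carry'' (NConst 0) (NConst 0))
          (NSet ''g'' (var ''j'') (NConst 0)))
       Skip)) ?s (\<lambda>u. \<forall>j<Q. nat_mem u ''g'' j = digit (4 * n) (Suc t) j)"
  proof (rule run_For[where N = Q and Inv = "\<lambda>m u. (\<forall>j<Q. nat_mem u ''g'' j =
      digit (4 * n) (if j < m then Suc t else t) j) \<and> nat_mem u ''carry'' 0 = of_bool ((4 * n) ^ m dvd Suc t)"],
      goal_cases)
    case 6
    then show ?case using g by simp
  next
    case (7 m u)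
    have inp1: "inputs u" by (rule inputs_frame[OF 7(2) inp0]) (simp_all add: constants_def)
    have gm: "nat_mem u ''g'' m = digit (4 * n) t m" using 7(1,4) by simp
    note st = inputs_nat[OF inp1] 7(3) gm
    have carry: "nat_mem u ''carry'' 0 = of_bool ((4 * n) ^ m dvd Suc t)" using 7(4) by simp
    note next_digit = digit_Suc[OF R, of t m] and next_carry = power_Suc_dvd_Suc[OF R, of m t]
    have others: "nat_mem u ''g'' j = digit (4 * n) (if j < Suc m then Suc t else t) j"
      if "j < Q" "j \<noteq> m" for j using 7(4) that by auto
    show ?case
    proof (rule run_If, rule run_If, goal_cases)
      case 1
      then have "(4 * n) ^ m dvd Suc t" "digit (4 * n) t m + 1 < 4 * n"
        by (auto simp: carry st split: if_splits)
      then have "digit (4 * n) (Suc t) m = Suc (digit (4 * n) t m)" "\<not> (4 * n) ^ Suc m dvd Suc t"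
        using next_digit next_carry by auto
      then show ?case using others size(1) dig[of m]
        by (intro run_Seq run_NSet) (auto simp: st)
    next
      case 2
      then have "(4 * n) ^ m dvd Suc t" "\<not> digit (4 * n) t m + 1 < 4 * n"
        by (auto simp: carry st split: if_splits)
      then have "digit (4 * n) (Suc t) m = 0" "(4 * n) ^ Suc m dvd Suc t"
        using next_digit next_carry dig[of m] by auto
      then show ?case using others carry \<open>(4 * n) ^ m dvd Suc t\<close>
        by (intro run_NSet) (auto simp: st)
    next
      case 3
      then have "\<not> (4 * n) ^ m dvd Suc t" by (auto simp: carry split: if_splits)
      then have "digit (4 * n) (Suc t) m = digit (4 * n) t m" "\<not> (4 * n) ^ Suc m dvd Suc t"
        using next_digit next_carry by auto
      then have "nat_mem u ''g'' j = digit (4 * n) (if j < Suc m then Suc t else t) j" if "j < Q" for j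
        using others[OF that] gm by (cases "j = m") auto
      then show ?case using carry \<open>\<not> (4 * n) ^ m dvd Suc t\<close> \<open>\<not> (4 * n) ^ Suc m dvd Suc t\<close>
        by (intro run_Skip) auto
    qed
  next
    case (8 u)
    then show ?case by simp
  qed (use inp in \<open>simp_all add: inputs_nat bound\<close>)
  then show ?case by simp
qed simp

lemma run_prepare:
  assumes "nat_mem s ''n'' 0 = n" "nat_mem s ''k'' 0 = k" "nat_mem s ''p'' 0 = p" "nat_mem s ''Q'' 0 = 0"
    "\<And>i c. i < n \<Longrightarrow> c < k \<Longrightarrow> real_mem s ''A'' (i * k + c) = a i c"
  shows "run prepare s inputs"
  unfolding prepare_def
proof (rule run_Seq, rule run_NSet, goal_cases)
  case 1
  then show ?case using assms size by simp
next
  case 2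
  let ?s = "set_nat ''R'' 0 (4 * n) (set_nat ''d'' 0 (Suc (Suc k)) (set_nat ''k1'' 0 (Suc k) s))"
  have "run (For ''s'' ''p'' (NSet ''Q'' (NConst 0) (NAdd (var ''Q'') (NMul (var ''s'') (var ''k1'')))) ;;
     NSet ''T'' (NConst 0) (NConst 1) ;;
     For ''j'' ''Q'' (NSet ''T'' (NConst 0) (NMul (var ''T'') (var ''R'')))) ?s inputs"
  proof (rule run_Seq, rule run_For[where N = p and Inv = "\<lambda>m u. nat_mem u ''Q'' 0 = (\<Sum>x<m. x) * (k + 1)"], goal_cases)
    case (7 m u)
    have "nat_mem u ''k1'' 0 = Suc k" using 7(2) by (simp add: frame_def)
    moreover have "(\<Sum>x<Suc m. x) * (k + 1) \<le> Q"
      unfolding Q_def using 7(1) by (intro mult_right_mono sum_mono2) auto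
    ultimately show ?case using 7 size(4)
      by (intro run_NSet) (auto simp: algebra_simps)
  next
    case (8 u)
    have u: "nat_mem u ''k1'' 0 = Suc k" "nat_mem u ''d'' 0 = d" "nat_mem u ''R'' 0 = 4 * n"
      "nat_mem u ''n'' 0 = n" "nat_mem u ''k'' 0 = k" "nat_mem u ''p'' 0 = p" "real_mem u ''A'' = real_mem s ''A''"
      using 8(1) assms by (simp_all add: frame_def d_def)
    have Q: "nat_mem u ''Q'' 0 = Q" using 8(2) by (simp add: Q_def)
    let ?u = "set_nat ''T'' 0 1 u"
    have "run (For ''j'' ''Q'' (NSet ''T'' (NConst 0) (NMul (var ''T'') (var ''R'')))) ?u inputs"
    proof (rule run_For[where N = Q and Inv = "\<lambda>m u. nat_mem u ''T'' 0 = (4 * n) ^ m"], goal_cases)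
      case (7 m u1)
      have "nat_mem u1 ''R'' 0 = 4 * n" using 7(2) u by (simp add: frame_def)
      moreover have "(4 * n) ^ Suc m \<le> (4 * n) ^ Q"
        using 7(1) n_pos by (intro power_increasing) auto
      ultimately show ?case using 7 size(5)
        by (intro run_NSet) (auto simp: mult.commute)
    next
      case (8 u1)
      then show ?case using u Q assms by (simp add: inputs_def frame_def)
    qed (use Q in \<open>simp_all add: bound\<close>)
    then show ?case by (intro run_Seq run_NSet) simp_all
  qed (use assms in \<open>simp_all add: bound\<close>)
  then have rest: "run (For ''s'' ''p'' (NSet ''Q'' (NConst 0) (NAdd (var ''Q'') (NMul (var ''s'') (var ''k1'')))) ;;
     NSet ''T'' (NConst 0) (NConst (Suc 0)) ;;
     For ''j'' ''Q'' (NSet ''T'' (NConst 0) (NMul (var ''T'') (var ''R'')))) ?s inputs"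
    by simp
  show ?case
    by (rule run_Seq, rule run_NSet, use assms size(2) in simp, rule run_Seq, rule run_NSet,
        use assms size(1) in simp, use rest in \<open>simp add: assms\<close>)
qed

lemma run_solver:
  assumes "nat_mem s ''n'' 0 = n" "nat_mem s ''k'' 0 = k" "nat_mem s ''p'' 0 = p" "nat_mem s ''Q'' 0 = 0"
    "\<And>i c. i < n \<Longrightarrow> c < k \<Longrightarrow> real_mem s ''A'' (i * k + c) = a i c"
    "nat_mem s ''found'' 0 = 0" "\<And>j. nat_mem s ''g'' j = 0"
  shows "run solver s (best_among ((\<lambda>t. candidate k n p (lift k a) (digit (4 * n) t)) ` {..<(4 * n) ^ Q}))"
  unfolding solver_def
proof (rule run_Seq, rule run_frame, rule run_prepare[OF assms(1-5)], assumption, assumption, goal_cases)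
  case 2: (1 s1)
  let ?cand = "\<lambda>t. candidate k n p (lift k a) (digit (4 * n) t)"
  note defs = constants_def play_def play_pair_writes evaluate_def record_best_def advance_def Let_def
  have s1: "nat_mem s1 ''found'' 0 = 0" "\<And>j. nat_mem s1 ''g'' j = 0"
    using 2(1) assms by (simp_all add: frame_def prepare_def)
  have dig: "digit (4 * n) t j < 4 * n" for t j using n_pos by (simp add: digit_def)
  show ?case
  proof (rule run_For[where N = "(4 * n) ^ Q" and Inv = "\<lambda>m u. (\<forall>j<Q. nat_mem u ''g'' j = digit (4 * n) m j) \<and>
      best_among (?cand ` {..<m}) u"], goal_cases)
    case 6
    then show ?case using s1 by (simp add: best_among_def digit_def)
  next
    case (7 m u)
    have inp: "inputs u" by (rule inputs_frame[OF 7(2) 2(2)]) (simp_all add: defs)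
    have g: "j < Q \<Longrightarrow> nat_mem u ''g'' j = digit (4 * n) m j" for j using 7(4) by simp
    have "run play u (\<lambda>t. \<forall>i<n. nat_mem t ''cur'' i = ?cand m i)"
      by (rule run_play[OF inp]) (use g dig in auto)
    then show ?case
    proof (rule run_Seq[OF run_frame], goal_cases)
      case 3: (1 u1)
      have inp1: "inputs u1" by (rule inputs_frame[OF 3(1) inp]) (simp_all add: defs)
      have fr1: "nat_mem u1 ''g'' = nat_mem u ''g''" "nat_mem u1 ''found'' = nat_mem u ''found''"
        "nat_mem u1 ''out'' = nat_mem u ''out''" "real_mem u1 ''best'' = real_mem u ''best''"
        using 3(1) by (simp_all add: frame_def defs)
      have cur: "i < n \<Longrightarrow> nat_mem u1 ''cur'' i = ?cand m i" for i using 3(2) by simp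
      have "run evaluate u1 (\<lambda>t. (\<forall>j<p. nat_mem t ''sh'' j = card {i. i < n \<and> ?cand m i = j}) \<and>
          (\<forall>j<p. \<forall>c<k. real_mem t ''X'' (j * k + c) = (\<Sum>i | i < n \<and> ?cand m i = j. a i c)))"
        by (rule run_evaluate[OF inp1]) (use cur candidate_less[OF p_pos] in auto)
      then show ?case
      proof (rule run_Seq[OF run_frame], goal_cases)
        case 2: (1 u2)
        have inp2: "inputs u2" by (rule inputs_frame[OF 2(1) inp1]) (simp_all add: defs)
        have fr2: "nat_mem u2 ''g'' = nat_mem u ''g''" "nat_mem u2 ''found'' = nat_mem u ''found''"
          "nat_mem u2 ''out'' = nat_mem u ''out''" "real_mem u2 ''best'' = real_mem u ''best''"
          "nat_mem u2 ''cur'' = nat_mem u1 ''cur''"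
          using 2(1) fr1 by (simp_all add: frame_def defs)
        have best: "best_among (?cand ` {..<m}) u2"
          using 7(4) best_among_cong[OF fr2(2-4)] by simp
        have "run record_best u2 (best_among (insert (?cand m) (?cand ` {..<m})))"
          by (rule run_record_best[OF inp2 best]) (use 2(2) cur fr2 candidate_less[OF p_pos] in auto)
        then show ?case
        proof (rule run_Seq[OF run_frame], goal_cases)
          case (1 u3)
          have inp3: "inputs u3" by (rule inputs_frame[OF 1(1) inp2]) (simp_all add: defs)
          have fr3: "nat_mem u3 ''g'' = nat_mem u ''g''"
            using 1(1) fr2 by (simp add: frame_def defs)
          have "run advance u3 (\<lambda>u. \<forall>j<Q. nat_mem u ''g'' j = digit (4 * n) (Suc m) j)"
            by (rule run_advance[OF inp3]) (use g fr3 in simp)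
          then show ?case
          proof (rule run_frame, goal_cases)
            case 2: (1 u4)
            have "nat_mem u4 ''found'' = nat_mem u3 ''found''"
              "nat_mem u4 ''out'' = nat_mem u3 ''out''" "real_mem u4 ''best'' = real_mem u3 ''best''"
              using 2(1) by (simp_all add: frame_def defs)
            then have "best_among F u4 = best_among F u3" for F by (rule best_among_cong)
            then have "best_among (?cand ` {..<Suc m}) u4"
              using 1(2) by (simp add: lessThan_Suc)
            then have "best_among (?cand ` {..<Suc m}) (set_nat ''t'' 0 (Suc m) u4)"
              using best_among_cong[of "set_nat ''t'' 0 (Suc m) u4" u4] by simp
            then show ?case using 2(2) by simp
          qed
        qed
      qed
    qed
  next
    case (8 u)
    then show ?case by simp
  qed (use 2(2) in \<open>simp_all add: inputs_nat bound defs\<close>)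
qed

end

section \<open>Heights of rational numbers\<close>

text \<open>
  The fraction need not be in lowest terms; reducing it only makes numerator and denominator smaller.
\<close>

definition height :: "nat \<Rightarrow> real set" where
  "height b = {x. \<exists>u v. x = real_of_int u / real_of_int v \<and> 0 < v \<and> \<bar>u\<bar> \<le> 2 ^ b \<and> v \<le> 2 ^ b}"

lemma heightI: "0 < v \<Longrightarrow> \<bar>u\<bar> \<le> 2 ^ b \<Longrightarrow> v \<le> 2 ^ b \<Longrightarrow> real_of_int u / real_of_int v \<in> height b"
  unfolding height_def by blast

lemma heightE:
  assumes "x \<in> height b"
  obtains u v where "x = real_of_int u / real_of_int v" "0 < v" "\<bar>u\<bar> \<le> 2 ^ b" "v \<le> 2 ^ b"
  using assms unfolding height_def by blast

lemma height_mult: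
  assumes "x \<in> height b" "y \<in> height c"
  shows "x * y \<in> height (b + c)"
proof -
  obtain u v where x: "x = real_of_int u / real_of_int v" "0 < v" "\<bar>u\<bar> \<le> 2 ^ b" "v \<le> 2 ^ b"
    by (rule heightE[OF assms(1)])
  obtain u' v' where y: "y = real_of_int u' / real_of_int v'" "0 < v'" "\<bar>u'\<bar> \<le> 2 ^ c" "v' \<le> 2 ^ c"
    by (rule heightE[OF assms(2)])
  have "\<bar>u * u'\<bar> \<le> 2 ^ (b + c)" unfolding abs_mult power_add using x y by (intro mult_mono) auto
  moreover have "v * v' \<le> 2 ^ (b + c)" unfolding power_add using x y by (intro mult_mono) auto
  ultimately show ?thesis using heightI[of "v * v'" "u * u'" "b + c"] x y by simp
qed

lemma height_inverse:
  assumes "x \<in> height b"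
  shows "inverse x \<in> height b"
proof -
  obtain u v where x: "x = real_of_int u / real_of_int v" "0 < v" "\<bar>u\<bar> \<le> 2 ^ b" "v \<le> 2 ^ b"
    by (rule heightE[OF assms(1)])
  consider "0 < u" | "u = 0" | "u < 0" by linarith
  then show ?thesis
  proof cases
    case 1
    then show ?thesis using heightI[of u v b] x by simp
  next
    case 2
    then show ?thesis using heightI[of 1 0 b] x by simp
  next
    case 3
    then show ?thesis using heightI[of "- u" "- v" b] x by simp
  qed
qed

lemma height_add:
  assumes "x \<in> height b" "y \<in> height c"
  shows "x + y \<in> height (b + c + 1)"
proof -
  obtain u v where x: "x = real_of_int u / real_of_int v" "0 < v" "\<bar>u\<bar> \<le> 2 ^ b" "v \<le> 2 ^ b"
    by (rule heightE[OF assms(1)])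
  obtain u' v' where y: "y = real_of_int u' / real_of_int v'" "0 < v'" "\<bar>u'\<bar> \<le> 2 ^ c" "v' \<le> 2 ^ c"
    by (rule heightE[OF assms(2)])
  have "\<bar>u * v'\<bar> \<le> 2 ^ b * 2 ^ c" "\<bar>v * u'\<bar> \<le> 2 ^ b * 2 ^ c"
    unfolding abs_mult using x y by (auto intro!: mult_mono)
  then have "\<bar>u * v' + v * u'\<bar> \<le> 2 ^ (b + c + 1)" by (simp add: power_add)
  have "v * v' \<le> 2 ^ b * 2 ^ c" using x y by (intro mult_mono) auto
  moreover have "(2::int) ^ b * 2 ^ c \<le> 2 ^ (b + c + 1)"
    unfolding power_add[symmetric] by (rule power_increasing) auto
  ultimately have "v * v' \<le> 2 ^ (b + c + 1)" by linarith
  have "x + y = real_of_int (u * v' + v * u') / real_of_int (v * v')"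
    using x y by (simp add: field_simps)
  then show ?thesis
    using heightI[of "v * v'" "u * v' + v * u'", OF _ \<open>\<bar>u * v' + v * u'\<bar> \<le> 2 ^ (b + c + 1)\<close>]
      \<open>v * v' \<le> 2 ^ (b + c + 1)\<close> x y by simp
qed

lemma height_uminus: "x \<in> height b \<Longrightarrow> - x \<in> height b"
  by (elim heightE) (use heightI[of _ "- _"] in force)

lemma level_sets_height: "level_sets height"
proof
  fix b b' :: nat assume b: "b \<le> b'"
  then have le: "(2::int) ^ b \<le> 2 ^ b'" by (intro power_increasing) auto
  then show "height b \<subseteq> height b'"
    by (auto elim!: heightE intro!: heightI order_trans[OF _ le])
next
  fix m b :: nat assume "m \<le> 2 ^ b"
  then have "int m \<le> 2 ^ b" by (metis of_nat_le_iff of_nat_numeral of_nat_power)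
  then show "real m \<in> height b" using heightI[of 1 "int m" b] by simp
next
  fix x y b c assume "x \<in> height b" "y \<in> height c"
  then show "x - y \<in> height (b + c + 1)" using height_add[of x b "- y" c] height_uminus by simp
next
  fix x y b c assume "x \<in> height b" "y \<in> height c"
  then show "x / y \<in> height (b + c)"
    using height_mult[of x b "inverse y" c] height_inverse by (simp add: divide_inverse)
qed (rule height_add height_mult; assumption)+

lemma level_sets_UNIV: "level_sets (\<lambda>_. UNIV)"
  by unfold_locales auto

lemma height_rational: "x \<in> height b \<Longrightarrow> x \<in> \<rat>"
  by (elim heightE) simp

lemma bits_of_rat: "bits (of_rat q) = rat_bits q"
  by (simp add: bits_def)

lemma bits_le_height:
  assumes "x \<in> height b"
  shows "bits x \<le> 2 * b + 3"
proof -
  obtain u v where x: "x = real_of_int u / real_of_int v" "0 < v" "\<bar>u\<bar> \<le> 2 ^ b" "v \<le> 2 ^ b"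
    by (rule heightE[OF assms(1)])
  define g where "g = gcd u v"
  have g: "0 < g" using x by (simp add: g_def)
  have q: "quotient_of (Fract u v) = (u div g, v div g)"
    using x(2) by (simp add: quotient_of_Fract Rat.normalize_def g_def Let_def)
  have "x = of_rat (Fract u v)" using x by (simp add: of_rat_rat)
  then have "bits x = rat_bits (Fract u v)" by (simp add: bits_of_rat)
  also have "\<dots> = 1 + floorlog 2 (nat \<bar>u div g\<bar>) + floorlog 2 (nat (v div g))"
    by (simp add: rat_bits_def q)
  also have "\<dots> \<le> 1 + (b + 1) + (b + 1)"
  proof -
    have le: "floorlog 2 (nat z) \<le> b + 1" if "z \<le> 2 ^ b" for z :: int
    proof -
      have "nat z \<le> 2 ^ b" using that by (simp add: nat_le_iff)
      then have "floorlog 2 (nat z) \<le> floorlog 2 (2 ^ b)" by (rule floorlog_mono)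
      also have "floorlog 2 (2 ^ b) = b + 1" using floorlog_power[of 1 2 b] by (simp add: floorlog_def)
      finally show ?thesis .
    qed
    have quot: "\<bar>z div g\<bar> \<le> \<bar>z\<bar>" if "g dvd z" for z
    proof -
      have "\<bar>z\<bar> = g * \<bar>z div g\<bar>" using that g by (metis abs_mult abs_of_pos dvd_mult_div_cancel)
      moreover have "1 * \<bar>z div g\<bar> \<le> g * \<bar>z div g\<bar>" using g by (intro mult_right_mono) auto
      ultimately show ?thesis by simp
    qed
    have "\<bar>u div g\<bar> \<le> \<bar>u\<bar>" by (rule quot) (simp add: g_def)
    moreover have "v div g \<le> v" using quot[of v] x(2) by (simp add: g_def)
    ultimately show ?thesis using le[of "\<bar>u div g\<bar>"] le[of "v div g"] x by linarith
  qed
  finally show ?thesis by simp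
qed

lemma height_bits:
  assumes "x \<in> \<rat>"
  shows "x \<in> height (bits x)"
proof -
  obtain q where q: "x = of_rat q" using assms by (elim Rats_cases)
  obtain u v where uv: "quotient_of q = (u, v)" by fastforce
  have v: "0 < v" by (rule quotient_of_denom_pos[OF uv])
  have b: "bits x = 1 + floorlog 2 (nat \<bar>u\<bar>) + floorlog 2 (nat v)"
    by (simp add: q bits_of_rat rat_bits_def uv)
  have le: "z \<le> 2 ^ floorlog 2 (nat z)" if "0 \<le> z" for z :: int
  proof (cases "z = 0")
    case False
    then have "nat z < 2 ^ floorlog 2 (nat z)" using that floorlog_bounds[of "nat z" 2] by simp
    then show ?thesis by (metis less_imp_le nat_less_iff of_nat_numeral of_nat_power that)
  qed simp
  have "\<bar>u\<bar> \<le> 2 ^ bits x" using le[of "\<bar>u\<bar>"] power_increasing[of "floorlog 2 (nat \<bar>u\<bar>)" "bits x" "2::int"] b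
    by linarith
  moreover have "v \<le> 2 ^ bits x" using le[of v] v power_increasing[of "floorlog 2 (nat v)" "bits x" "2::int"] b
    by linarith
  moreover have "x = real_of_int u / real_of_int v"
    unfolding q using quotient_of_div[OF uv] v by (simp add: of_rat_divide)
  ultimately show ?thesis using heightI[OF v] by simp
qed

section \<open>Complexity of the program\<close>

definition loop_limits :: "nat \<Rightarrow> nat \<Rightarrow> nat \<Rightarrow> string \<Rightarrow> nat" where
  "loop_limits n k p x =
     (let Q = (\<Sum>x<p. x) * (k + 1) in
      if x = ''n'' then n else if x = ''k'' then k else if x = ''p'' \<or> x = ''s'' then p
      else if x = ''k1'' then k + 1 else if x = ''d'' then k + 2
      else if x = ''Q'' then Q else if x = ''T'' then (4 * n) ^ Q else 0)"

lemma loop_limits_simps: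
  "loop_limits n k p ''n'' = n" "loop_limits n k p ''k'' = k" "loop_limits n k p ''p'' = p"
  "loop_limits n k p ''s'' = p" "loop_limits n k p ''k1'' = k + 1" "loop_limits n k p ''d'' = k + 2"
  "loop_limits n k p ''Q'' = (\<Sum>x<p. x) * (k + 1)"
  "loop_limits n k p ''T'' = (4 * n) ^ ((\<Sum>x<p. x) * (k + 1))"
  by (simp_all add: loop_limits_def Let_def)

text \<open>
  A syntactically checkable form of $f(n) = O(n)$: closed under sums and constant factors, with the
  explicit constant $f(1)$.
\<close>

definition sublinear :: "(nat \<Rightarrow> nat) \<Rightarrow> bool" where
  "sublinear f \<longleftrightarrow> (\<forall>n\<ge>1. f n \<le> n * f 1)"

lemma sublinear_const: "sublinear (\<lambda>n. c)"
  by (simp add: sublinear_def)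

lemma sublinear_linear: "sublinear (\<lambda>n. n * c)"
  by (simp add: sublinear_def)

lemma sublinear_add: "sublinear f \<Longrightarrow> sublinear g \<Longrightarrow> sublinear (\<lambda>n. f n + g n)"
  unfolding sublinear_def by (metis add_mono distrib_left)

lemma sublinear_mult: "sublinear f \<Longrightarrow> sublinear (\<lambda>n. c * f n)"
  unfolding sublinear_def by (metis mult.left_commute mult_le_mono2)

text \<open>
  No loop over the $n$ elements is nested in another one; all other loop bounds depend on $k$ and $p$ only.
\<close>

lemma sublinear_iteration:
  "sublinear (\<lambda>n. units (loop_limits n k p) (play ;; evaluate ;; record_best ;; advance))"
  unfolding play_def play_pair_def lift_points_def decode_def eliminate_def settle_def evaluate_def
    record_best_def advance_def Let_def For_units units.simps loop_limits_simps
  by (intro sublinear_add sublinear_mult sublinear_linear sublinear_const)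

lemma units_solver:
  "\<exists>c. \<forall>n\<ge>1. units (loop_limits n k p) solver \<le> c * n ^ ((\<Sum>x<p. x) * (k + 1) + 1)"
proof -
  define Q where "Q = (\<Sum>x<p. x) * (k + 1)"
  define u0 where "u0 = units (loop_limits 1 k p) prepare"
  define u1 where "u1 = units (loop_limits 1 k p) (play ;; evaluate ;; record_best ;; advance)"
  show ?thesis
  proof (intro exI[of _ "u0 + 2 + 4 ^ Q * (u1 + 2)"] allI impI)
    fix n :: nat assume n: "1 \<le> n"
    have "units (loop_limits n k p) prepare = u0"
      by (simp add: u0_def prepare_def loop_limits_simps)
    moreover have "units (loop_limits n k p) (play ;; evaluate ;; record_best ;; advance) \<le> n * u1"
      using sublinear_iteration[of k p] n by (simp add: sublinear_def u1_def)
    moreover have "units (loop_limits n k p) solver = units (loop_limits n k p) prepare +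
        (2 + (4 * n) ^ Q * (units (loop_limits n k p) (play ;; evaluate ;; record_best ;; advance) + 2))"
      by (simp only: solver_def units.simps For_units loop_limits_simps Q_def)
    ultimately have "units (loop_limits n k p) solver \<le> u0 + (2 + (4 * n) ^ Q * (n * u1 + 2))"
      by (simp only: add_mono mult_le_mono2 order_refl)
    also have "\<dots> \<le> u0 * n ^ (Q + 1) + (2 * n ^ (Q + 1) + (4 * n) ^ Q * (n * u1 + 2 * n))"
      using n one_le_power[OF n, of "Q + 1"]
      by (intro add_mono mult_le_mono) (simp_all del: power_Suc)
    also have "\<dots> = (u0 + 2 + 4 ^ Q * (u1 + 2)) * n ^ (Q + 1)"
      by (simp add: power_mult_distrib algebra_simps)
    finally show "units (loop_limits n k p) solver \<le> (u0 + 2 + 4 ^ Q * (u1 + 2)) * n ^ ((\<Sum>x<p. x) * (k + 1) + 1)"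
      by (simp only: Q_def)
  qed
qed

text \<open>
  The $p(p - 1)/2$ pairs use $k + 1 \<le> 2k$ digits each, which leaves an exponent $kp \<ge> 1$ for the
  linear cost of a single code.
\<close>

lemma pivot_count:
  fixes p k :: nat
  assumes "1 \<le> p" "1 \<le> k"
  shows "(\<Sum>x<p. x) * (k + 1) + 1 \<le> k * p\<^sup>2"
proof -
  have tri: "(\<Sum>x<p. x) * 2 + p = p * p" by (induction p) auto
  have "(\<Sum>x<p. x) * (k + 1) + 1 \<le> (\<Sum>x<p. x) * (2 * k) + p * k"
    using assms by (intro add_mono mult_le_mono) auto
  also have "\<dots> = ((\<Sum>x<p. x) * 2 + p) * k" by (simp add: algebra_simps)
  also have "\<dots> = k * p\<^sup>2" unfolding tri by (simp add: power2_eq_square)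
  finally show ?thesis .
qed

lemma part_sizes_in_p_shapes:
  assumes "\<And>i. i < n \<Longrightarrow> f i < p"
  shows "part_sizes n p f \<in> p_shapes p n"
proof -
  have "(\<Sum>j<p. card {i. i < n \<and> f i = j}) = n"
    using sum.group[of "{..<n}" "{..<p}" f "\<lambda>_. 1 :: nat"] assms by auto
  then show ?thesis
    by (simp add: p_shapes_def part_sizes_def sum_list_distinct_conv_sum_set atLeast0LessThan)
qed

lemma A_matrix_part_sum_matrix:
  "A \<in> carrier_mat k n \<Longrightarrow> A_matrix A (partition_of p n f) = part_sum_matrix n k p (\<lambda>i r. A $$ (r, i)) f"
  by (intro eq_matI) (auto simp: A_matrix_def partition_of_def part_sum_matrix_def)

lemma shape_part_sizes: "shape (partition_of p n f) = part_sizes n p f"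
  by (simp add: shape_def partition_of_def part_sizes_def)

lemma sum_in_level:
  assumes "level_sets P" "finite J" "\<And>i. i \<in> J \<Longrightarrow> x i \<in> P (b i)"
  shows "sum x J \<in> P (\<Sum>i\<in>J. b i + 1)"
  using assms(2,3)
proof (induction J rule: finite_induct)
  case empty
  then show ?case using level_sets.level_nat[OF assms(1), of 0 0] by simp
next
  case (insert i J)
  then show ?case using level_sets.level_add[OF assms(1), of "x i" "b i" "sum x J" "\<Sum>i\<in>J. b i + 1"]
    by (simp add: algebra_simps)
qed

text \<open>
  The sum of what is needed for reduced entries, for the number $(4n)^Q$ of codes, and for the remaining
  counters and addresses.
\<close>

definition bits_factor :: "nat \<Rightarrow> nat \<Rightarrow> nat" where
  "bits_factor k p = 5 ^ (k + 2) + 4 * ((\<Sum>x<p. x) * (k + 1)) + k + p + 6"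

text \<open>
  The correctness of the program for one admissible size $X$ of the data, in either
  model. That the recorded value is optimal follows from the presence of a separated optimal partition among
  the candidates; in particular some candidate is accepted.
\<close>

lemma solver_correct:
  fixes A :: "real mat" and P :: "nat \<Rightarrow> real set"
  assumes P: "level_sets P" and p: "1 \<le> p" and n: "1 \<le> n" and A: "A \<in> carrier_mat k n"
    and ne: "\<Lambda> \<noteq> {}" and sub: "\<Lambda> \<subseteq> p_shapes p n" and lo: "presents_shapes lo p n \<Lambda>"
    and C: "convex_functional k p C" and vo: "presents_functional vo p n A \<Lambda> C"
    and X: "n \<le> X" and entries: "\<And>i r. i < n \<Longrightarrow> r < k \<Longrightarrow> A $$ (r, i) \<in> P X"
    and sums: "\<And>J r. J \<subseteq> {..<n} \<Longrightarrow> r < k \<Longrightarrow> (\<Sum>i\<in>J. A $$ (r, i)) \<in> P X"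
    and answers: "\<And>\<pi>. Lambda_partition p n \<Lambda> \<pi> \<Longrightarrow> C (A_matrix A \<pi>) \<in> P X"
  obtains t tr where "exec lo vo solver (initial_state p k n A) t tr"
    "optimal_partition p n A \<Lambda> C (output_partition p n t)"
    "length tr \<le> 50 * units (loop_limits n k p) solver"
    "\<And>st. st \<in> set tr \<Longrightarrow> length (numbers st) \<le> p + k * p + 4 \<and>
      set (numbers st) \<subseteq> P (bits_factor k p * X * 50)"
proof -
  define a where "a i r = A $$ (r, i)" for i r
  define Q where "Q = (\<Sum>x<p. x) * (k + 1)"
  define B where "B = bits_factor k p * X"
  have X1: "1 \<le> X" using n X by simp
  have parts_B: "5 ^ (k + 2) * X \<le> B" "4 * Q * X \<le> B" "k * X \<le> B" "p * X \<le> B" "6 * X \<le> B"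
    "(k + 2) * X \<le> B"
    unfolding B_def bits_factor_def Q_def by (rule mult_right_mono; simp)+
  have le_pow: "x \<le> 2 ^ B" if "x \<le> B" for x
    using that less_exp[of B] by linarith
  have scale: "x \<le> B" if "x * X \<le> B" for x
    using mult_le_mono2[OF X1, of x] that by (metis le_trans mult.right_neutral)
  have up: "x \<in> P B" if "x \<in> P X" for x
  proof -
    have "X \<le> B" using parts_B(5) by simp
    then show ?thesis using that level_sets.level_mono[OF P] by blast
  qed
  have Lam: "Lambda_partition p n \<Lambda> (partition_of p n f) \<longleftrightarrow> lo (part_sizes n p f)"
    if "\<And>i. i < n \<Longrightarrow> f i < p" for f
    using lo part_sizes_in_p_shapes[OF that] p_partition_partition_of[OF that]
    by (simp add: Lambda_partition_def shape_part_sizes presents_shapes_def)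
  have val: "vo (part_sum_matrix n k p a f) = C (A_matrix A (partition_of p n f))"
    if "\<And>i. i < n \<Longrightarrow> f i < p" "lo (part_sizes n p f)" for f
  proof -
    have "Lambda_partition p n \<Lambda> (partition_of p n f)" using Lam[of f] that by blast
    then show ?thesis
      using vo A_matrix_part_sum_matrix[OF A, of p f] unfolding presents_functional_def a_def[abs_def]
      by metis
  qed
  have pow: "(4 * n) ^ Q \<le> 2 ^ B"
  proof -
    have "4 * n * Q \<le> 4 * Q * X" using X by simp
    then have e: "4 * n * Q \<le> B" using parts_B(2) by linarith
    have "(4 * n) ^ Q \<le> (2 ^ (4 * n)) ^ Q" using less_exp[of "4 * n"] by (intro power_mono) auto
    also have "\<dots> = 2 ^ (4 * n * Q)" by (simp add: power_mult)
    also have "(2::nat) ^ (4 * n * Q) \<le> 2 ^ B" using e by (rule power_increasing) simp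
    finally show ?thesis .
  qed
  have lifts: "lift k a i c \<in> P X" if "i < n" for i c
  proof -
    have "i \<le> 2 ^ X" using that X less_exp[of X] by linarith
    then have "real i \<in> P X" using level_sets.level_nat[OF P] by blast
    moreover have "real 1 \<in> P X" using level_sets.level_nat[OF P, of 1 X] by simp
    ultimately show ?thesis using entries[OF that] by (auto simp: lift_def a_def)
  qed
  interpret shaped_solver P lo vo B "p + k * p" "loop_limits n k p" n k p "k + 2" Q X a
  proof (intro shaped_solver.intro machine.intro machine_axioms.intro shaped_solver_axioms.intro P refl)
    show "1 \<le> B" using parts_B(5) X1 by linarith
    show "Q = (\<Sum>x<p. x) * (k + 1)" by (rule Q_def)
    show "0 < n" "0 < p" using n p by auto
    show "4 * n \<le> 2 ^ B" using parts_B(5) X by (intro le_pow) linarith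
    show "k + 2 \<le> 2 ^ B" by (rule le_pow[OF scale[OF parts_B(6)]])
    show "p \<le> 2 ^ B" by (rule le_pow[OF scale[OF parts_B(4)]])
    show "Q \<le> 2 ^ B" using scale[OF parts_B(2)] by (intro le_pow) linarith
    show "(4 * n) ^ Q \<le> 2 ^ B" by (rule pow)
    show "lift k a i c \<in> P X" if "i < n" "c < k + 2" for i c using lifts[OF that(1)] .
    show "1 \<le> X" by (rule X1)
    show "5 ^ (k + 2) * X \<le> B" by (rule parts_B(1))
    show "(\<Sum>i\<in>J. a i c) \<in> P B" if "J \<subseteq> {..<n}" "c < k" for J c
      using up[OF sums[OF that]] by (simp add: a_def)
    show "vo (part_sum_matrix n k p a f) \<in> P B" if "\<And>i. i < n \<Longrightarrow> f i < p" "lo (part_sizes n p f)" for f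
      using up[OF answers, of "partition_of p n f"] Lam[of f] val[of f] that by simp
  qed (simp_all add: loop_limits_simps Q_def)
  let ?s = "initial_state p k n A"
  have "run solver ?s (best_among ((\<lambda>t. candidate k n p (lift k a) (digit (4 * n) t)) ` {..<(4 * n) ^ Q}))"
  proof (rule run_solver)
    fix i c assume ic: "i < n" "c < k"
    have "i * k + c < Suc i * k" using ic by simp
    also have "\<dots> \<le> n * k" using ic by (intro mult_le_mono1) auto
    finally show "real_mem ?s ''A'' (i * k + c) = a i c"
      using ic by (simp add: initial_state_def a_def mult.commute)
  qed (simp_all add: initial_state_def)
  moreover have "bounded ?s"
    unfolding bounded_def
  proof (intro conjI allI)
    show "nat_mem ?s x i \<le> 2 ^ B" for x i
      using size n by (auto simp: initial_state_def)
    have z: "0 \<in> P B" using level_sets.level_nat[OF P, of 0 B] by simp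
    have "A $$ (i mod k, i div k) \<in> P B" if "i < k * n" for i
    proof -
      have "0 < k" using that by (cases k) auto
      then have "i mod k < k" "i div k < n"
        using that by (simp_all add: less_mult_imp_div_less mult.commute)
      then show ?thesis using up entries by simp
    qed
    then show "real_mem ?s x i \<in> P B" for x i using z by (auto simp: initial_state_def)
  qed
  ultimately obtain t tr where ex: "exec lo vo solver ?s t tr"
    and len: "length tr \<le> 50 * units (loop_limits n k p) solver" and tame: "tame 50 tr"
    and best: "best_among ((\<lambda>t. candidate k n p (lift k a) (digit (4 * n) t)) ` {..<(4 * n) ^ Q}) t"
    unfolding run_def using small_solver by blast
  have "\<exists>f. (\<forall>i<n. f i < p) \<and> optimal_partition p n A \<Lambda> C (partition_of p n f) \<and>
      (\<forall>r s. r < s \<longrightarrow> pointed {i. i < n \<and> (f i = r \<or> f i = s)} (k + 2)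
         (\<lambda>i c. (if f i = r then 1 else -1) * lift k a i c))"
    by (rule separated_optimum_exists[OF A ne sub C, folded a_def[abs_def]]) blast
  then obtain f where f: "\<And>i. i < n \<Longrightarrow> f i < p" "optimal_partition p n A \<Lambda> C (partition_of p n f)"
    and sep: "\<And>r s. r < s \<Longrightarrow> pointed {i. i < n \<and> (f i = r \<or> f i = s)} (k + 2)
       (\<lambda>i c. (if f i = r then 1 else -1) * lift k a i c)"
    by blast
  obtain m where m: "m < (4 * n) ^ Q" "\<And>i. i < n \<Longrightarrow> candidate k n p (lift k a) (digit (4 * n) m) i = f i"
    using separated_is_candidate[of n f p k "lift k a", OF _ f(1) sep] n unfolding Q_def by auto
  \<comment> \<open>The candidate agrees with the optimal assignment on the elements and may differ elsewhere.\<close>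
  let ?h = "candidate k n p (lift k a) (digit (4 * n) m)"
  have h: "partition_of p n ?h = partition_of p n f" "\<And>i. i < n \<Longrightarrow> ?h i < p"
    using m(2) f(1) by (auto intro: partition_of_cong)
  have acc: "lo (part_sizes n p ?h)"
    using f(2) Lam[of ?h] h unfolding optimal_partition_def by simp
  define F where "F = (\<lambda>t. candidate k n p (lift k a) (digit (4 * n) t)) ` {..<(4 * n) ^ Q}"
  have hF: "?h \<in> F" using m(1) unfolding F_def by blast
  note best = best[folded F_def]
  have "nat_mem t ''found'' 0 \<noteq> 0"
    using best hF acc unfolding best_among_def by (meson)
  then have "\<exists>u. (\<forall>i<n. nat_mem t ''out'' i = u i \<and> u i < p) \<and> lo (part_sizes n p u) \<and>
      (\<forall>f\<in>F. lo (part_sizes n p f) \<longrightarrow> vo (part_sum_matrix n k p a f) \<le> vo (part_sum_matrix n k p a u))"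
    using best unfolding best_among_def by auto
  then obtain u where u: "\<And>i. i < n \<Longrightarrow> nat_mem t ''out'' i = u i \<and> u i < p" "lo (part_sizes n p u)"
    "vo (part_sum_matrix n k p a ?h) \<le> vo (part_sum_matrix n k p a u)"
    using hF acc by blast
  have "C (A_matrix A (partition_of p n f)) \<le> C (A_matrix A (partition_of p n u))"
    using u val[of ?h] h(2) acc val[of u] h(1) by simp
  then have "optimal_partition p n A \<Lambda> C (partition_of p n u)"
    using f(2) Lam[of u] u unfolding optimal_partition_def by (meson order_trans)
  moreover have "output_partition p n t = partition_of p n u"
    using u(1) by (auto simp: output_partition_def partition_of_def)
  moreover have "length (numbers st) \<le> p + k * p + 4 \<and> set (numbers st) \<subseteq> P (bits_factor k p * X * 50)"
    if "st \<in> set tr" for st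
    using tame[unfolded tame_def] that unfolding B_def by blast
  ultimately show ?thesis using that[OF ex _ len] by simp
qed

lemma bit_time_le:
  assumes "\<And>st. st \<in> set tr \<Longrightarrow> length (numbers st) \<le> w"
    "\<And>st x. st \<in> set tr \<Longrightarrow> x \<in> set (numbers st) \<Longrightarrow> bits x \<le> b"
  shows "bit_time tr \<le> length tr * (1 + w * b)"
proof -
  have "1 + (\<Sum>x\<leftarrow>numbers st. bits x) \<le> 1 + w * b" if "st \<in> set tr" for st
  proof -
    have "(\<Sum>x\<leftarrow>numbers st. bits x) \<le> (\<Sum>x\<leftarrow>numbers st. b)"
      by (rule sum_list_mono) (use assms(2) that in auto)
    also have "\<dots> = length (numbers st) * b" by (simp add: sum_list_triv)
    also have "\<dots> \<le> w * b" using assms(1)[OF that] by simp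
    finally show ?thesis by simp
  qed
  then have "bit_time tr \<le> (\<Sum>st\<leftarrow>tr. 1 + w * b)"
    unfolding bit_time_def by (intro sum_list_mono) auto
  then show ?thesis by (simp only: sum_list_triv of_nat_id)
qed

text \<open>
  This bounds the bit size of a sum of entries of a row: without common denominators, the bit sizes add up.
\<close>

lemma mat_bits_ge_row_sum:
  assumes "A \<in> carrier_mat k n" "r < k" "J \<subseteq> {..<n}"
  shows "(\<Sum>i\<in>J. bits (A $$ (r, i))) \<le> mat_bits A"
proof -
  have "(\<Sum>i\<in>J. bits (A $$ (r, i))) \<le> (\<Sum>i<n. bits (A $$ (r, i)))"
    using assms(3) by (intro sum_mono2) auto
  also have "\<dots> \<le> (\<Sum>r<k. \<Sum>i<n. bits (A $$ (r, i)))"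
    using assms(2) by (intro member_le_sum[of r "{..<k}" "\<lambda>r. \<Sum>i<n. bits (A $$ (r, i))"]) auto
  finally show ?thesis using assms(1) by (simp add: mat_bits_def)
qed

theorem theorem4p6:
  shows "\<exists>algorithm :: com. \<forall>p k :: nat. p \<ge> 1 \<and> k \<ge> 1 \<longrightarrow>
    (\<exists>c K d :: nat. \<forall>(n :: nat) (A :: real mat) (\<Lambda> :: nat list set) (C :: real mat \<Rightarrow> real)
        (lam_oracle :: nat list \<Rightarrow> bool) (val_oracle :: real mat \<Rightarrow> real).
      n \<ge> 1 \<and> A \<in> carrier_mat k n \<and>
      \<Lambda> \<noteq> {} \<and> \<Lambda> \<subseteq> p_shapes p n \<and> presents_shapes lam_oracle p n \<Lambda> \<and>
      convex_functional k p C \<and> presents_functional val_oracle p n A \<Lambda> C \<longrightarrow>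
      (\<exists>t tr. exec lam_oracle val_oracle algorithm (initial_state p k n A) t tr \<and>
         optimal_partition p n A \<Lambda> C (output_partition p n t) \<and>
         operation_count tr \<le> c * n ^ (k * p\<^sup>2) \<and>
         (\<forall>M. rational_mat A \<and> guaranteed M p n A \<Lambda> C \<longrightarrow>
            all_numbers tr \<subseteq> \<rat> \<and>
            (\<forall>x\<in>all_numbers tr. bits x \<le> K * (n + M + mat_bits A) ^ d) \<and>
            bit_time tr \<le> K * (n + M + mat_bits A) ^ d)))"
proof (rule exI[of _ solver], intro allI impI, elim conjE, goal_cases)
  case (1 p k)
  note p = 1(1) and k = 1(2)
  define E where "E = k * p\<^sup>2"
  obtain c0 where c0: "\<And>n. 1 \<le> n \<Longrightarrow> units (loop_limits n k p) solver \<le>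
      c0 * n ^ ((\<Sum>x<p. x) * (k + 1) + 1)" using units_solver by blast
  define w where "w = p + k * p + 4"
  define F where "F = 2 * (bits_factor k p * 50) + 3"
  define K where "K = F + 50 * c0 * (1 + w * F)"
  show ?case
    unfolding E_def[symmetric]
  proof (rule exI[of _ "50 * c0"], rule exI[of _ K], rule exI[of _ "E + 1"], intro allI impI, elim conjE,
      goal_cases)
    case (1 n A \<Lambda> C lo vo)
    note n = 1(1) and A = 1(2) and ne = 1(3) and sub = 1(4) and lo = 1(5) and C = 1(6) and vo = 1(7)
    note solve = solver_correct[OF _ p n A ne sub lo C vo]
    \<comment> \<open>The real model yields the computation, before any $M$ is given.\<close>
    obtain t tr where ex: "exec lo vo solver (initial_state p k n A) t tr"
      and opt: "optimal_partition p n A \<Lambda> C (output_partition p n t)"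
      and len: "length tr \<le> 50 * units (loop_limits n k p) solver"
      by (rule solve[OF level_sets_UNIV order_refl]) auto
    have "n ^ ((\<Sum>x<p. x) * (k + 1) + 1) \<le> n ^ E"
      using pivot_count[OF p k] n unfolding E_def by (intro power_increasing) auto
    then have "c0 * n ^ ((\<Sum>x<p. x) * (k + 1) + 1) \<le> c0 * n ^ E" by (rule mult_le_mono2)
    then have len': "length tr \<le> 50 * c0 * n ^ E" using len c0[OF n] by linarith
    have "all_numbers tr \<subseteq> \<rat> \<and> (\<forall>x\<in>all_numbers tr. bits x \<le> K * (n + M + mat_bits A) ^ (E + 1)) \<and>
        bit_time tr \<le> K * (n + M + mat_bits A) ^ (E + 1)"
      if rat: "rational_mat A" and M: "guaranteed M p n A \<Lambda> C" for M
    proof -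
      define X where "X = n + M + mat_bits A"
      have X1: "1 \<le> X" using n by (simp add: X_def)
      have A_rat: "A $$ (r, i) \<in> \<rat>" if "r < k" "i < n" for r i
        using rat elements_matI[OF A that] unfolding rational_mat_def by blast
      have sums: "(\<Sum>i\<in>J. A $$ (r, i)) \<in> height X" if "J \<subseteq> {..<n}" "r < k" for J r
      proof -
        have "finite J" "card J \<le> n"
          using that(1) finite_subset card_mono[of "{..<n}" J] by auto
        then have "(\<Sum>i\<in>J. bits (A $$ (r, i)) + 1) \<le> X"
          using mat_bits_ge_row_sum[OF A that(2,1)] unfolding X_def sum.distrib by simp
        moreover have "(\<Sum>i\<in>J. A $$ (r, i)) \<in> height (\<Sum>i\<in>J. bits (A $$ (r, i)) + 1)"
          using that by (intro sum_in_level[OF level_sets_height \<open>finite J\<close>] height_bits A_rat) auto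
        ultimately show ?thesis using level_sets.level_mono[OF level_sets_height] by blast
      qed
      have entries: "A $$ (r, i) \<in> height X" if "i < n" "r < k" for i r
        using sums[of "{i}" r] that by simp
      have answers: "C (A_matrix A \<pi>) \<in> height X" if "Lambda_partition p n \<Lambda> \<pi>" for \<pi>
      proof -
        have "C (A_matrix A \<pi>) \<in> height (bits (C (A_matrix A \<pi>)))" "bits (C (A_matrix A \<pi>)) \<le> X"
          using M that by (auto simp: guaranteed_def X_def height_bits intro: trans_le_add1)
        then show ?thesis using level_sets.level_mono[OF level_sets_height] by blast
      qed
      obtain t' tr' where "exec lo vo solver (initial_state p k n A) t' tr'"
        and nums': "\<And>st. st \<in> set tr' \<Longrightarrow> length (numbers st) \<le> p + k * p + 4 \<and>
          set (numbers st) \<subseteq> height (bits_factor k p * X * 50)"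
        by (rule solve[OF level_sets_height _ entries sums answers]) (auto simp: X_def)
      \<comment> \<open>The bounds of the rational model concern the same trace, since execution is deterministic.\<close>
      then have nums: "length (numbers st) \<le> w" "set (numbers st) \<subseteq> height (bits_factor k p * X * 50)"
        if "st \<in> set tr" for st
        using exec_deterministic[OF ex] that unfolding w_def by blast+
      have bits: "bits x \<le> F * X" if "x \<in> height (bits_factor k p * X * 50)" for x
      proof -
        have "bits x \<le> 2 * (bits_factor k p * X * 50) + 3" by (rule bits_le_height[OF that])
        also have "\<dots> \<le> F * X" using X1 by (simp add: F_def algebra_simps)
        finally show ?thesis .
      qed
      have "bit_time tr \<le> length tr * (1 + w * (F * X))"
        by (rule bit_time_le) (use nums bits in auto)
      also have "\<dots> \<le> (50 * c0 * X ^ E) * ((1 + w * F) * X)"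
      proof (rule mult_le_mono)
        have "n ^ E \<le> X ^ E" by (rule power_mono) (simp_all add: X_def)
        then show "length tr \<le> 50 * c0 * X ^ E" using len' mult_le_mono2 order_trans by blast
        show "1 + w * (F * X) \<le> (1 + w * F) * X" using X1 by (simp add: algebra_simps)
      qed
      also have "\<dots> \<le> K * X ^ (E + 1)" by (simp add: K_def algebra_simps)
      finally have time: "bit_time tr \<le> K * X ^ (E + 1)" .
      have "F * X \<le> K * X ^ (E + 1)"
        using X1 by (intro mult_le_mono) (simp_all add: K_def)
      then have "\<forall>x\<in>all_numbers tr. bits x \<le> K * X ^ (E + 1)"
        using nums(2) bits unfolding all_numbers_def by (meson UN_E order_trans subsetD)
      moreover have "all_numbers tr \<subseteq> \<rat>"
        using nums(2) height_rational unfolding all_numbers_def by blast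
      ultimately show ?thesis using time unfolding X_def by blast
    qed
    moreover have "operation_count tr \<le> 50 * c0 * n ^ E"
      using len' length_filter_le[of _ tr] unfolding operation_count_def by (meson order_trans)
    ultimately show ?case
      using ex opt by blast
  qed
qed

end
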